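(* Let $d\ge1$, $\alpha>\frac{d-1}{2}$, $\beta>\frac{d-1}{2}$ and assume in addition that $\beta-\alpha>\frac{d-1}{2}$. Let $(X(n),n\ge1)$ be i.i.d. random matrices in $\mathcal{P}_d$ with the matrix Beta type II distribution $\mathrm{B}^{\mathrm{II}}_d(\alpha,\beta)$, and let $R=(R(n),n\ge0)$ be a $\mathrm{GL}_d$-invariant random walk on $\mathcal{P}_d$ with increments $(X(n),n\ge1)$ and with initial state $R(0)$ independent of $(X(n),n\ge1)$ and having the inverse Wishart distribution $\mathrm{IW}_d(\beta)$. Let $A(n):=\sum_{k=0}^nR(k)$. Then the limit $\lim_{n\to\infty}A(n)$ exists a.s. in $\mathcal{P}_d$ and has the inverse Wishart distribution $\mathrm{IW}_d(\beta-\alpha)$.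
   Context: $\mathcal{P}_d$ is the set of $d\times d$ real symmetric positive definite matrices; $|x|$ is the determinant, $\mathrm{tr}[x]$ the trace, $I$ the identity matrix; $x^{1/2}$ is the unique square root of $x$ in $\mathcal{P}_d$. Reference measure: $\mu(\mathrm{d}x):=|x|^{-(d+1)/2}\prod_{1\le i\le j\le d}\mathrm{d}x_{ij}$ on $\mathcal{P}_d$. For parameters $>\frac{d-1}{2}$: $\Gamma_d(\alpha):=\int_{\mathcal{P}_d}|x|^\alpha e^{-\mathrm{tr}[x]}\mu(\mathrm{d}x)$, $B_d(\alpha,\beta):=\Gamma_d(\alpha)\Gamma_d(\beta)/\Gamma_d(\alpha+\beta)$. The inverse Wishart distribution $\mathrm{IW}_d(\beta)$ is $\Gamma_d(\beta)^{-1}|x|^{-\beta}e^{-\mathrm{tr}[x^{-1}]}\mu(\mathrm{d}x)$. The matrix Beta type II distribution $\mathrm{B}^{\mathrm{II}}_d(\alpha,\beta)$ is $B_d(\alpha,\beta)^{-1}|x|^\alpha|I+x|^{-(\alpha+\beta)}\mu(\mathrm{d}x)$; it is invariant under $x\mapsto k^\top xk$ for orthogonal $k$. A $\mathrm{GL}_d$-invariant random walk on $\mathcal{P}_d$ with initial state $R(0)$ and increments $(X(n),n\ge1)$ (independent, orthogonally invariant in law, and independent of $R(0)$) is any process with the same law as the one defined recursively by $R(n)=R(n-1)^{1/2}X(n)R(n-1)^{1/2}$, $n\ge1$. *)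

theory Defs
  imports "HOL-Probability.Probability"
begin

text \<open>
  Real \<open>d \<times> d\<close> matrices are elements of \<open>real ^ 'n::_ ^ 'n::_\<close> with \<open>d = CARD('n)\<close>. The index type is
  well-ordered so that the coordinates \<open>x\<^sub>i\<^sub>j\<close> with \<open>i \<le> j\<close> make sense; every \<open>d \<ge> 1\<close> is the
  cardinality of such a type.
\<close>

definition pd_mats :: "(real ^ 'n::{finite,wellorder} ^ 'n::_) set" where
  "pd_mats = {x. transpose x = x \<and> (\<forall>v. v \<noteq> 0 \<longrightarrow> v \<bullet> (x *v v) > 0)}"

definition pd_borel :: "(real ^ 'n::{finite,wellorder} ^ 'n::_) measure" where
  "pd_borel = restrict_space borel pd_mats"

definition pd_sqrt :: "real ^ 'n::{finite,wellorder} ^ 'n::_ \<Rightarrow> real ^ 'n::_ ^ 'n::_" where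
  "pd_sqrt x = (THE y. y \<in> pd_mats \<and> y ** y = x)"

text \<open>
  The measure \<open>\<Prod>\<^sub>i\<^sub>\<le>\<^sub>j dx\<^sub>i\<^sub>j\<close> on symmetric matrices: the image of Lebesgue measure on the upper
  triangular coordinates. As a measure on all matrices it is concentrated on the symmetric ones.
\<close>

definition sym_lebesgue :: "(real ^ 'n::{finite,wellorder} ^ 'n::_) measure" where
  "sym_lebesgue =
     distr (Pi\<^sub>M {(i, j). i \<le> j} (\<lambda>_. lborel)) borel
       (\<lambda>u. \<chi> i j. if i \<le> j then u (i, j) else u (j, i))"

definition pd_mu :: "(real ^ 'n::{finite,wellorder} ^ 'n::_) measure" where
  "pd_mu = density (restrict_space sym_lebesgue pd_mats)
     (\<lambda>x. ennreal (det x powr (- (real CARD('n) + 1) / 2)))"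

text \<open>The dimension \<open>d\<close> of the constants below is passed as a type argument.\<close>

definition mv_gamma :: "'n::{finite,wellorder} itself \<Rightarrow> real \<Rightarrow> real" where
  "mv_gamma _ a = (\<integral>x. det x powr a * exp (- trace x) \<partial>(pd_mu :: (real ^ 'n::_ ^ 'n::_) measure))"

definition mv_beta :: "'n::{finite,wellorder} itself \<Rightarrow> real \<Rightarrow> real \<Rightarrow> real" where
  "mv_beta T a b = mv_gamma T a * mv_gamma T b / mv_gamma T (a + b)"

definition inv_wishart :: "real \<Rightarrow> (real ^ 'n::{finite,wellorder} ^ 'n::_) measure" where
  "inv_wishart b = density pd_mu
     (\<lambda>x. ennreal (inverse (mv_gamma TYPE('n) b) * det x powr (- b) * exp (- trace (matrix_inv x))))"

definition beta_II :: "real \<Rightarrow> real \<Rightarrow> (real ^ 'n::{finite,wellorder} ^ 'n::_) measure" where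
  "beta_II a b = density pd_mu
     (\<lambda>x. ennreal (inverse (mv_beta TYPE('n) a b) * det x powr a * det (mat 1 + x) powr (- (a + b))))"

primrec walk ::
  "real ^ 'n::{finite,wellorder} ^ 'n::_ \<Rightarrow> (nat \<Rightarrow> real ^ 'n::_ ^ 'n::_) \<Rightarrow> nat \<Rightarrow> real ^ 'n::_ ^ 'n::_" where
  "walk r x 0 = r"
| "walk r x (Suc n) = pd_sqrt (walk r x n) ** x (Suc n) ** pd_sqrt (walk r x n)"

text \<open>
  The process \<open>R\<close> on \<open>M\<close> is a \<open>GL\<^sub>d\<close>-invariant random walk with initial state \<open>R0\<close> and increments
  \<open>X n\<close>, \<open>n \<ge> 1\<close>, given on \<open>N\<close>. Only the law of \<open>R\<close> is prescribed, so \<open>R\<close> may live on another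
  probability space than \<open>R0\<close> and \<open>X\<close>; the case \<open>M = N\<close>, \<open>R0 = R 0\<close> is included. The value \<open>X 0\<close>
  is irrelevant. The independence of the increments among each other and from the initial state is
  the joint independence of \<open>R0, X 1, X 2, \<dots>\<close>.
\<close>

definition GL_random_walk ::
  "'a measure \<Rightarrow> (nat \<Rightarrow> 'a \<Rightarrow> real ^ 'n::_ ^ 'n::_) \<Rightarrow> 'b measure \<Rightarrow> ('b \<Rightarrow> real ^ 'n::_ ^ 'n::_) \<Rightarrow>
   (nat \<Rightarrow> 'b \<Rightarrow> real ^ 'n::{finite,wellorder} ^ 'n::_) \<Rightarrow> bool" where
  "GL_random_walk M R N R0 X \<longleftrightarrow>
     prob_space M \<and> prob_space N \<and>
     prob_space.indep_vars N (\<lambda>_. pd_borel) (X(0 := R0)) UNIV \<and>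
     (\<forall>n\<ge>1. \<forall>k. orthogonal_matrix k \<longrightarrow>
        distr N pd_borel (\<lambda>\<omega>. transpose k ** X n \<omega> ** k) = distr N pd_borel (X n)) \<and>
     (\<forall>n. R n \<in> measurable M pd_borel) \<and>
     distr M (Pi\<^sub>M UNIV (\<lambda>_. pd_borel)) (\<lambda>\<omega> n. R n \<omega>) =
       distr N (Pi\<^sub>M UNIV (\<lambda>_. pd_borel)) (\<lambda>\<omega>. walk (R0 \<omega>) (\<lambda>n. X n \<omega>))"

end

theory Submission
  imports Defs
begin

text \<open>
  Let \<open>Z\<close> be independent of the walk with law \<open>B\<^bsup>II\<^esup>(\<alpha>, \<beta> - \<alpha>)\<close>. Two identities drive the proof: if \<open>X\<close> has law
  \<open>B\<^bsup>II\<^esup>(\<alpha>, \<beta>)\<close>, then \<open>X\<^bsup>1/2\<^esup> (I + Z) X\<^bsup>1/2\<^esup>\<close> has the law of \<open>Z\<close>, and if \<open>R\<^sub>0\<close> has law \<open>IW(\<beta>)\<close>, then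
  \<open>R\<^sub>0\<^bsup>1/2\<^esup> (I + Z) R\<^sub>0\<^bsup>1/2\<^esup>\<close> has law \<open>IW(\<beta> - \<alpha>)\<close>. Since the law of \<open>Z\<close> is orthogonally invariant, it follows
  by induction that \<open>A(n) + R(n)\<^bsup>1/2\<^esup> Z R(n)\<^bsup>1/2\<^esup>\<close> has law \<open>IW(\<beta> - \<alpha>)\<close> for every \<open>n\<close>. Its trace dominates that of
  the increasing sequence \<open>A(n)\<close>, which is therefore tight, hence almost surely convergent; then \<open>R(n)\<close>
  tends to \<open>0\<close> and the limit of \<open>A(n)\<close> has law \<open>IW(\<beta> - \<alpha>)\<close>.

  The identities are changes of variables in \<open>\<mu>\<close>. Invariance of \<open>\<mu>\<close> under congruence follows from
  uniqueness of translation invariant measures and the diagonal case; invariance under inversion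
  follows, without a Jacobian, because the image of \<open>\<mu>\<close> is again congruence invariant.
\<close>

text \<open>Both identities are instances of one formula,
  \<open>nn_integral_pd_mu_affine_recursion\<close>, whose factor \<open>\<psi>\<close> is free: a
  power of det (I + u) gives the beta identity, exp (- trace u) the inverse Wishart one. The
  delicate point is the constants. \<open>mv_gamma\<close> is a Bochner integral, equal to 0 where
  it diverges, and \<open>mv_beta\<close> is a quotient of its values. The hypotheses on the laws of
  R0 and X make \<open>inv_wishart \<beta>\<close> and \<open>beta_II \<alpha> \<beta>\<close>
  probabilities, which settles the parameters \<alpha> and \<beta>. At \<beta> - \<alpha> finiteness
  has to be proved: just above the critical exponent (d-1)/2 first, then by interpolation with
  \<beta>. That \<open>mv_beta\<close> at \<alpha>, \<beta> - \<alpha> is the mass of the beta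
  density follows from the inverse Wishart recursion for the constant function 1. Z is never
  constructed as a random variable: \<open>beta_avg\<close> integrates it out. All integrals take
  values in \<open>ennreal\<close>, so that Fubini and the substitutions precede any
  integrability.\<close>

type_synonym 'n sqmat = "((real, 'n) vec, 'n) vec"

section \<open>Spectral decomposition of symmetric matrices\<close>

lemma symmetric_matrix_inner:
  fixes A :: "real^'n^'n"
  assumes "transpose A = A"
  shows "u \<bullet> (A *v w) = (A *v u) \<bullet> w"
  by (metis assms dot_lmul_matrix transpose_matrix_vector)

text \<open>Induction on the dimension of an invariant subspace V. A maximiser v of the quadratic
  form on the unit sphere of V is an eigenvector, and the vectors of V orthogonal to v form an
  invariant subspace of dimension one less.\<close>

lemma orthonormal_eigenvectors:
  fixes A :: "real^'n^'n"
  assumes sym: "transpose A = A"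
  shows "subspace V \<Longrightarrow> (\<And>v. v \<in> V \<Longrightarrow> A *v v \<in> V) \<Longrightarrow>
    \<exists>B. B \<subseteq> V \<and> finite B \<and> card B = dim V \<and> pairwise orthogonal B \<and>
      (\<forall>v\<in>B. norm v = 1 \<and> (\<exists>c. A *v v = c *\<^sub>R v))"
proof (induction "dim V" arbitrary: V)
  case 0
  then show ?case by (intro exI[of _ "{}"]) auto
next
  case (Suc n)
  let ?S = "V \<inter> sphere 0 1"
  have "V \<noteq> {0}" using Suc.hyps(2) by auto
  then obtain u where u: "u \<in> V" "u \<noteq> 0"
    using subspace_0[OF Suc.prems(1)] by blast
  then have "u /\<^sub>R norm u \<in> ?S"
    using Suc.prems(1) by (auto simp: subspace_scale)
  moreover have "compact ?S"
    using closed_subspace[OF Suc.prems(1)] by (auto intro: closed_Int_compact)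
  moreover have "continuous_on ?S (\<lambda>v. v \<bullet> (A *v v))"
    by (intro continuous_intros)
  ultimately obtain v where v: "v \<in> ?S" and max: "\<And>w. w \<in> ?S \<Longrightarrow> w \<bullet> (A *v w) \<le> v \<bullet> (A *v v)"
    using continuous_attains_sup[of ?S "\<lambda>v. v \<bullet> (A *v v)"] by blast
  define l where "l = v \<bullet> (A *v v)"
  have vV: "v \<in> V" and nv: "norm v = 1" using v by auto
  have vv: "v \<bullet> v = 1" using nv by (simp add: norm_eq_1)
  have le: "w \<bullet> (A *v w) \<le> l * (w \<bullet> w)" if "w \<in> V" for w
  proof (cases "w = 0")
    case False
    have "w /\<^sub>R norm w \<in> ?S"
      using that False Suc.prems(1) by (auto simp: subspace_scale)
    from max[OF this] have "(w \<bullet> (A *v w)) / (norm w)\<^sup>2 \<le> l"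
      by (simp add: l_def matrix_vector_mult_scaleR divide_inverse power2_eq_square mult.commute mult.left_commute)
    then show ?thesis
      using False by (simp add: divide_le_eq power2_norm_eq_inner)
  qed simp
  have orth: "v \<bullet> (A *v w) = 0" if w: "w \<in> V" "v \<bullet> w = 0" for w
  proof -
    define b where "b = v \<bullet> (A *v w)"
    define c where "c = l * (w \<bullet> w) - w \<bullet> (A *v w)"
    \<comment> \<open>Maximality compared at v + t w: the term of first order in t is dominated by
      one of second order, for every t, which forces b = 0.\<close>
    have *: "2 * t * b \<le> t\<^sup>2 * c" for t
    proof -
      have "v + t *\<^sub>R w \<in> V"
        using vV w Suc.prems(1) by (simp add: subspace_add subspace_scale)
      from le[OF this] show ?thesis
        using w(2) vv symmetric_matrix_inner[OF sym, of w v]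
        by (simp add: b_def c_def l_def matrix_vector_right_distrib matrix_vector_mult_scaleR
            inner_add_left inner_add_right power2_eq_square inner_commute algebra_simps)
    qed
    have c0: "c \<ge> 0" using le[OF w(1)] by (simp add: c_def)
    have "b = 0"
    proof (rule ccontr)
      assume b: "b \<noteq> 0"
      \<comment> \<open>t = b / (c + 1) gives the contradiction; the summand 1 keeps the denominator
        positive also when c = 0.\<close>
      have "2 * (b / (c + 1)) * b \<le> (b / (c + 1))\<^sup>2 * c" by (rule *)
      then have "b\<^sup>2 / (c + 1) * 2 \<le> b\<^sup>2 / (c + 1) * (c / (c + 1))"
        by (simp add: power2_eq_square mult_ac)
      moreover have "b\<^sup>2 / (c + 1) > 0" using b c0 by simp
      ultimately have "2 \<le> c / (c + 1)" using mult_le_cancel_left_pos by blast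
      then show False using c0 by (simp add: field_simps)
    qed
    then show ?thesis by (simp add: b_def)
  qed
  have eig: "A *v v = l *\<^sub>R v"
  proof -
    let ?w = "A *v v - l *\<^sub>R v"
    have wV: "?w \<in> V" using vV Suc.prems by (simp add: subspace_diff subspace_scale)
    have vw: "v \<bullet> ?w = 0" using vv by (simp add: inner_diff_right l_def)
    \<comment> \<open>The residual \<open>?w\<close> is orthogonal to v by the choice of
      \<open>l\<close>; by \<open>orth\<close> and symmetry it is orthogonal to A v as well, hence
      to itself.\<close>
    have "(A *v v) \<bullet> ?w = 0"
      using orth[OF wV vw] symmetric_matrix_inner[OF sym, of v ?w] by simp
    then have "?w \<bullet> ?w = 0"
      using vw by (simp add: inner_diff_left)
    then show ?thesis by simp
  qed
  define W where "W = {w \<in> V. \<forall>x\<in>span {v}. orthogonal x w}"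
  have W_eq: "W = {w \<in> V. v \<bullet> w = 0}"
    unfolding W_def by (auto simp: orthogonal_def span_singleton)
  have subW: "subspace W"
    unfolding W_eq using Suc.prems(1)
    by (auto simp: subspace_def inner_add_right)
  have "dim W + dim (span {v}) = dim V"
    unfolding W_def using vV Suc.prems(1)
    by (intro dim_subspace_orthogonal_to_vectors) (auto simp: span_minimal)
  moreover have "dim (span {v}) = 1"
    using nv by (auto simp: dim_singleton)
  ultimately have dW: "n = dim W" using Suc.hyps(2) by simp
  have "A *v w \<in> W" if "w \<in> W" for w
    using that orth Suc.prems(2) unfolding W_eq by auto
  from Suc.hyps(1)[OF dW subW this] obtain B where B: "B \<subseteq> W" "finite B" "card B = dim W"
      "pairwise orthogonal B" "\<forall>v\<in>B. norm v = 1 \<and> (\<exists>c. A *v v = c *\<^sub>R v)" by blast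
  have "v \<notin> B" using B(1) vv unfolding W_eq by auto
  then have "card (insert v B) = dim V"
    using B dW Suc.hyps(2) by simp
  moreover have "pairwise orthogonal (insert v B)"
    using B(1,4) unfolding pairwise_insert W_eq by (auto simp: orthogonal_def inner_commute)
  ultimately show ?case
    using B vV nv eig unfolding W_eq by (intro exI[of _ "insert v B"]) auto
qed

definition diag_matrix :: "real^'n \<Rightarrow> real^'n^'n" where
  "diag_matrix e = (\<chi> i j. if i = j then e $ i else 0)"

lemma diag_matrix_mult: "diag_matrix e ** diag_matrix f = diag_matrix (\<chi> i. e $ i * f $ i)"
  by (simp add: diag_matrix_def matrix_matrix_mult_def vec_eq_iff mult_delta_left)

lemma transpose_diag_matrix: "transpose (diag_matrix e) = diag_matrix e"
  by (auto simp: diag_matrix_def transpose_def vec_eq_iff)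

lemma diag_matrix_mult_vec: "diag_matrix e *v v = (\<chi> i. e $ i * v $ i)"
  by (simp add: diag_matrix_def matrix_vector_mult_def vec_eq_iff mult_delta_left)

lemma det_diag_matrix: "det (diag_matrix e) = (\<Prod>i\<in>UNIV. e $ i)"
  by (subst det_diagonal) (auto simp: diag_matrix_def)

lemma symmetric_diagonalization:
  fixes A :: "real^'n^'n"
  assumes sym: "transpose A = A"
  obtains k e where "orthogonal_matrix k" "A = k ** diag_matrix e ** transpose k"
proof -
  obtain B where B: "finite B" "card B = dim (UNIV :: (real^'n) set)" "pairwise orthogonal B"
      "\<forall>v\<in>B. norm v = 1 \<and> (\<exists>c. A *v v = c *\<^sub>R v)"
    using orthonormal_eigenvectors[OF sym, of UNIV] by auto
  have "card B = CARD('n)" using B(2) by simp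
  then obtain f where f: "bij_betw f (UNIV :: 'n set) B"
    using B(1) finite_same_card_bij[of "UNIV :: 'n set" B] by auto
  define k where "k = (\<chi> i j. f j $ i)"
  have fB: "f j \<in> B" for j using f by (auto simp: bij_betw_def)
  have "\<forall>j. \<exists>c. A *v f j = c *\<^sub>R f j" using B(4) fB by blast
  then obtain e where e: "\<And>j. A *v f j = e j *\<^sub>R f j" by (metis choice)
  have "f i \<bullet> f j = (if i = j then 1 else 0)" for i j
  proof (cases "i = j")
    case True
    then show ?thesis using B(4) fB[of j] by (simp add: norm_eq_1)
  next
    case False
    then have "f i \<noteq> f j" using f by (auto simp: bij_betw_def inj_on_def)
    then show ?thesis using B(3) fB False by (simp add: pairwise_def orthogonal_def)
  qed
  then have "transpose k ** k = mat 1"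
    by (simp add: vec_eq_iff matrix_matrix_mult_def transpose_def k_def mat_def inner_vec_def)
  then have ok: "orthogonal_matrix k"
    by (simp add: orthogonal_matrix)
  have "A ** k = k ** diag_matrix (vec_lambda e)"
  proof -
    have "(A ** k) $ i $ j = (A *v f j) $ i" for i j
      by (simp add: matrix_matrix_mult_def matrix_vector_mult_def k_def)
    moreover have "(k ** diag_matrix (vec_lambda e)) $ i $ j = e j * f j $ i" for i j
      by (simp add: matrix_matrix_mult_def diag_matrix_def k_def mult_delta_right)
    ultimately show ?thesis using e by (simp add: vec_eq_iff)
  qed
  then have "A ** (k ** transpose k) = k ** diag_matrix (vec_lambda e) ** transpose k"
    by (simp add: matrix_mul_assoc)
  then show ?thesis using that[OF ok] ok by (simp add: orthogonal_matrix_def)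
qed

section \<open>Positive definite matrices\<close>

lemma
  fixes A :: "real^'n^'n"
  assumes "invertible A"
  shows matrix_inv_right: "A ** matrix_inv A = mat 1"
    and matrix_inv_left: "matrix_inv A ** A = mat 1"
  using assms unfolding invertible_def matrix_inv_def by (metis (mono_tags, lifting) someI_ex)+

lemma matrix_inv_eqI:
  fixes A B :: "real^'n^'n"
  assumes "A ** B = mat 1"
  shows "matrix_inv A = B"
proof -
  have "invertible A" using assms invertible_right_inverse by blast
  then have "matrix_inv A ** (A ** B) = B"
    by (simp add: matrix_mul_assoc matrix_inv_left)
  then show ?thesis using assms by simp
qed

lemma det_matrix_inv:
  fixes A :: "real^'n^'n"
  assumes "invertible A"
  shows "det (matrix_inv A) = inverse (det A)"
proof -
  have "det A * det (matrix_inv A) = 1"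
    by (simp flip: det_mul add: matrix_inv_right[OF assms])
  then show ?thesis by (metis inverse_unique)
qed

section \<open>The Frobenius norm and continuity of the matrix operations\<close>

lemma norm_matrix_eq_trace:
  fixes A :: "real^'n^'m"
  shows "(norm A)\<^sup>2 = trace (A ** transpose A)"
  by (simp add: power2_norm_eq_inner inner_vec_def trace_def matrix_matrix_mult_def transpose_def)

lemma norm_matrix_mult_le:
  fixes A :: "real^'n^'m" and B :: "real^'k^'n"
  shows "norm (A ** B) \<le> norm A * norm B"
proof -
  have sq: "(norm C)\<^sup>2 = (\<Sum>i\<in>UNIV. \<Sum>j\<in>UNIV. (C $ i $ j)\<^sup>2)" for C :: "real^'p^'q"
    unfolding power2_norm_eq_inner inner_vec_def by (simp add: power2_eq_square)
  have "(norm (A ** B))\<^sup>2 \<le> (\<Sum>i\<in>UNIV. \<Sum>j\<in>UNIV. (\<Sum>k\<in>UNIV. (A $ i $ k)\<^sup>2) * (\<Sum>k\<in>UNIV. (B $ k $ j)\<^sup>2))"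
    unfolding sq matrix_matrix_mult_def
    by (intro sum_mono) (simp add: Cauchy_Schwarz_ineq_sum)
  also have "\<dots> = (norm A)\<^sup>2 * (\<Sum>j\<in>UNIV. \<Sum>k\<in>UNIV. (B $ k $ j)\<^sup>2)"
    unfolding sq by (simp add: sum_product)
  also have "(\<Sum>j\<in>UNIV. \<Sum>k\<in>UNIV. (B $ k $ j)\<^sup>2) = (norm B)\<^sup>2"
    unfolding sq by (rule sum.swap)
  finally show ?thesis
    by (simp flip: power_mult_distrib)
qed

lemma matrix_mult_add_rdistrib: "(A + B) ** C = A ** C + B ** (C :: real^'k^'n)" for A B :: "real^'n^'m"
  by (simp add: matrix_matrix_mult_def vec_eq_iff sum.distrib algebra_simps)

lemma matrix_mult_diff_ldistrib: "C ** (A - B) = C ** A - C ** (B :: real^'k^'n)" for C :: "real^'n^'m"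
  by (simp add: matrix_matrix_mult_def vec_eq_iff sum_subtractf algebra_simps)

lemma matrix_mult_diff_rdistrib: "(A - B) ** C = A ** C - B ** (C :: real^'k^'n)" for A B :: "real^'n^'m"
  by (simp add: matrix_matrix_mult_def vec_eq_iff sum_subtractf algebra_simps)

lemma bounded_bilinear_matrix_mult:
  "bounded_bilinear ((**) :: real^'n^'m \<Rightarrow> real^'k^'n \<Rightarrow> real^'k^'m)"
proof
  show "\<exists>K. \<forall>A B. norm ((A :: real^'n^'m) ** (B :: real^'k^'n)) \<le> norm A * norm B * K"
    by (intro exI[of _ 1] allI) (simp add: norm_matrix_mult_le)
qed (simp_all add: matrix_add_ldistrib matrix_mult_add_rdistrib scalar_matrix_assoc matrix_scalar_ac
    flip: scalar_mult_eq_scaleR)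

lemmas continuous_on_matrix_mult [continuous_intros] =
  bounded_bilinear.continuous_on[OF bounded_bilinear_matrix_mult]

lemma continuous_on_transpose [continuous_intros]:
  fixes f :: "'a::topological_space \<Rightarrow> real^'n^'m"
  assumes "continuous_on S f" shows "continuous_on S (\<lambda>x. transpose (f x))"
  unfolding transpose_def using assms by (intro continuous_intros)

lemma continuous_on_trace [continuous_intros]:
  fixes f :: "'a::topological_space \<Rightarrow> real^'n^'n"
  assumes "continuous_on S f" shows "continuous_on S (\<lambda>x. trace (f x))"
  unfolding trace_def using assms by (intro continuous_intros)

lemma continuous_on_det [continuous_intros]:
  fixes f :: "'a::topological_space \<Rightarrow> real^'n^'n"
  assumes "continuous_on S f" shows "continuous_on S (\<lambda>x. det (f x))"
  unfolding det_def using assms by (intro continuous_intros)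

text \<open>Cramer's rule writes each entry of the inverse as a quotient of two determinants with
  nonvanishing denominator.\<close>

lemma continuous_on_matrix_inv [continuous_intros]:
  fixes f :: "'a::topological_space \<Rightarrow> real^'n^'n"
  assumes "continuous_on S f" "\<And>x. x \<in> S \<Longrightarrow> invertible (f x)"
  shows "continuous_on S (\<lambda>x. matrix_inv (f x))"
proof -
  define C where "C = (\<lambda>A :: real^'n^'n. \<chi> i j. det (\<chi> p q. if q = i then axis j 1 $ p else A $ p $ q) / det A)"
  have eq: "matrix_inv A = C A" if A: "invertible A" for A :: "real^'n^'n"
  proof -
    have "(matrix_inv A *v axis j 1) $ i = C A $ i $ j" for i j
    proof -
      have "A *v (matrix_inv A *v axis j 1) = axis j 1"
        by (simp add: matrix_vector_mul_assoc matrix_inv_right[OF A])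
      then show ?thesis
        using A by (subst (asm) cramer) (auto simp: C_def invertible_det_nz)
    qed
    then show ?thesis
      by (simp add: vec_eq_iff matrix_vector_mul_component inner_axis)
  qed
  have *: "continuous_on S (\<lambda>x. if q = i then axis j 1 $ p else f x $ p $ q)" for i j p q
    by (cases "q = i") (auto intro!: continuous_intros assms(1))
  have "continuous_on S (\<lambda>x. C (f x))"
    unfolding C_def using assms(2)
    by (intro continuous_on_vec_lambda continuous_on_divide continuous_on_det assms(1) *)
      (auto simp: invertible_det_nz)
  then show ?thesis
    by (rule continuous_on_eq) (simp add: eq assms)
qed

lemma trace_congruence: "trace (g ** x ** h) = trace (x ** (h ** (g :: real^'n^'n)))"
  by (metis matrix_mul_assoc trace_mul_sym)

section \<open>The cone of positive definite matrices\<close>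

lemma pd_symmetric: "x \<in> pd_mats \<Longrightarrow> transpose x = x"
  and pd_pos: "x \<in> pd_mats \<Longrightarrow> v \<noteq> 0 \<Longrightarrow> v \<bullet> (x *v v) > 0"
  by (auto simp: pd_mats_def)

lemma pd_nonneg: "x \<in> pd_mats \<Longrightarrow> v \<bullet> (x *v v) \<ge> 0"
  using pd_pos[of x v] by (cases "v = 0") auto

lemma pd_invertible: "x \<in> pd_mats \<Longrightarrow> invertible x"
  unfolding invertible_left_inverse matrix_left_invertible_ker
  by (metis inner_zero_right less_irrefl pd_pos)

lemmas pd_inv_right = matrix_inv_right[OF pd_invertible]
  and pd_inv_left = matrix_inv_left[OF pd_invertible]

lemma transpose_diff: "transpose (A - B) = transpose A - transpose (B :: real^'n^'m)"
  by (simp add: transpose_def vec_eq_iff)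

lemma transpose_add: "transpose (A + B) = transpose A + transpose (B :: real^'n^'m)"
  by (simp add: transpose_def vec_eq_iff)

lemma pd_add: "x \<in> pd_mats \<Longrightarrow> y \<in> pd_mats \<Longrightarrow> x + y \<in> pd_mats"
  by (auto simp: pd_mats_def transpose_add matrix_vector_mult_add_rdistrib inner_add_right intro: add_pos_pos)

lemma inner_congruence: "v \<bullet> ((g ** x ** transpose g) *v v) = (transpose g *v v) \<bullet> (x *v (transpose g *v v))"
  for g x :: "real^'n^'n"
  by (metis dot_lmul_matrix matrix_vector_mul_assoc transpose_matrix_vector)

lemma pd_congruence:
  fixes x g :: "real^'n::{finite,wellorder}^'n::_"
  assumes "x \<in> pd_mats" "invertible g"
  shows "g ** x ** transpose g \<in> pd_mats"
proof -
  have "transpose g *v v \<noteq> 0" if "v \<noteq> 0" for v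
    using transpose_invertible[OF assms(2)] that
    by (metis invertible_left_inverse matrix_left_invertible_ker)
  then show ?thesis
    using assms(1) unfolding pd_mats_def mem_Collect_eq inner_congruence
    by (auto simp: matrix_transpose_mul matrix_mul_assoc)
qed

lemma pd_congruence_pd: "s \<in> pd_mats \<Longrightarrow> x \<in> pd_mats \<Longrightarrow> s ** x ** s \<in> pd_mats"
  using pd_congruence[of x s] by (simp add: pd_invertible pd_symmetric)

lemma mat_1_pd: "mat 1 \<in> pd_mats"
  by (simp add: pd_mats_def)

lemma pd_inv: 
  assumes "x \<in> pd_mats" shows "matrix_inv x \<in> pd_mats"
proof -
  let ?i = "matrix_inv x"
  have "transpose ?i ** x = mat 1"
    by (metis assms matrix_transpose_mul pd_inv_right pd_symmetric transpose_mat)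
  then have sym: "transpose ?i = ?i"
    by (metis assms matrix_mul_assoc matrix_mul_lid matrix_mul_rid pd_inv_right)
  have "invertible ?i"
    using assms pd_inv_left pd_inv_right unfolding invertible_def by blast
  from pd_congruence[OF assms this] show ?thesis
    by (simp add: sym pd_inv_left[OF assms])
qed

lemma matrix_inv_matrix_inv: "x \<in> pd_mats \<Longrightarrow> matrix_inv (matrix_inv x) = x"
  by (simp add: matrix_inv_eqI pd_inv_left)

lemma diag_matrix_pd_iff: "diag_matrix e \<in> pd_mats \<longleftrightarrow> (\<forall>i. e $ i > 0)"
proof
  assume *: "diag_matrix e \<in> pd_mats"
  show "\<forall>i. e $ i > 0"
  proof
    fix i
    have "axis i 1 \<bullet> (diag_matrix e *v axis i 1) = e $ i"
      by (simp add: diag_matrix_mult_vec inner_axis')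
    then show "e $ i > 0" using pd_pos[OF *, of "axis i 1"] by (simp add: axis_eq_0_iff)
  qed
next
  assume *: "\<forall>i. e $ i > 0"
  have "v \<bullet> (diag_matrix e *v v) > 0" if v: "v \<noteq> 0" for v
  proof -
    obtain i where i: "v $ i \<noteq> 0" using v by (auto simp: vec_eq_iff)
    have "(\<Sum>i\<in>UNIV. e $ i * (v $ i)\<^sup>2) > 0"
      using * i by (intro sum_pos2[of UNIV i]) (auto simp: less_imp_le)
    then show ?thesis
      by (simp add: diag_matrix_mult_vec inner_vec_def power2_eq_square mult_ac)
  qed
  then show "diag_matrix e \<in> pd_mats" by (simp add: pd_mats_def transpose_diag_matrix)
qed

section \<open>Square roots, determinants and inverses in the cone\<close>

lemma pd_diagonalization:
  assumes "x \<in> pd_mats"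
  obtains k e where "orthogonal_matrix k" "x = k ** diag_matrix e ** transpose k" "\<And>i. e $ i > 0"
proof -
  obtain k e where ke: "orthogonal_matrix k" "x = k ** diag_matrix e ** transpose k"
    using symmetric_diagonalization[OF pd_symmetric[OF assms]] .
  have "transpose k ** x ** transpose (transpose k) \<in> pd_mats"
    using ke(1) assms by (intro pd_congruence) (auto simp: invertible_def orthogonal_matrix_def)
  moreover have "transpose k ** x ** transpose (transpose k) = diag_matrix e"
    using ke by (simp add: matrix_mul_assoc orthogonal_matrix_def) (simp flip: matrix_mul_assoc add: orthogonal_matrix_def)
  ultimately show ?thesis using that ke by (simp add: diag_matrix_pd_iff)
qed

lemma pd_sqrt_exists:
  assumes "x \<in> pd_mats"
  obtains y where "y \<in> pd_mats" "y ** y = x"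
proof -
  obtain k e where ke: "orthogonal_matrix k" "x = k ** diag_matrix e ** transpose k" "\<And>i. e $ i > 0"
    using pd_diagonalization[OF assms] by blast
  let ?d = "diag_matrix (\<chi> i. sqrt (e $ i))"
  have "k ** ?d ** transpose k \<in> pd_mats"
    using ke by (intro pd_congruence) (auto simp: diag_matrix_pd_iff invertible_def orthogonal_matrix_def)
  moreover have "?d ** ?d = diag_matrix e"
    using ke(3) by (simp add: diag_matrix_mult less_imp_le vec_lambda_eta)
  moreover have "k ** ?d ** transpose k ** (k ** ?d ** transpose k) = k ** (?d ** ((transpose k ** k) ** ?d)) ** transpose k"
    by (simp add: matrix_mul_assoc)
  ultimately have "k ** ?d ** transpose k \<in> pd_mats \<and> k ** ?d ** transpose k ** (k ** ?d ** transpose k) = x"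
    using ke by (simp add: orthogonal_matrix_def)
  then show ?thesis using that by blast
qed

lemma trace_congruence_eq_sum:
  fixes e y :: "real^'n^'n"
  shows "trace (transpose e ** y ** e) = (\<Sum>i\<in>UNIV. column i e \<bullet> (y *v column i e))"
proof -
  have "(transpose e ** (y ** e)) $ i $ i = column i e \<bullet> (y *v column i e)" for i
    by (simp add: matrix_matrix_mult_def transpose_def inner_vec_def column_def matrix_vector_mult_def)
  then show ?thesis by (simp add: trace_def flip: matrix_mul_assoc)
qed

text \<open>With e = y - z, the hypothesis gives y e + e z = 0. Multiplying by e and taking traces
  turns this into a sum of quadratic forms of y and z at the columns of e; all of them are
  non-negative, so every column vanishes.\<close>

lemma pd_sqrt_unique:
  assumes y: "y \<in> pd_mats" and z: "z \<in> pd_mats" and eq: "y ** y = z ** z"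
  shows "y = z"
proof -
  let ?e = "y - z"
  have te: "transpose ?e = ?e" using y z by (simp add: transpose_diff pd_symmetric)
  have "y ** ?e + ?e ** z = 0"
    using eq by (simp add: matrix_mult_diff_ldistrib matrix_mult_diff_rdistrib)
  then have "trace (?e ** (y ** ?e + ?e ** z)) = 0"
    by (simp add: trace_def matrix_matrix_mult_def)
  then have "trace (?e ** y ** ?e) + trace (?e ** ?e ** z) = 0"
    by (simp add: matrix_add_ldistrib trace_add matrix_mul_assoc)
  also have "trace (?e ** ?e ** z) = trace (?e ** z ** ?e)"
    by (metis matrix_mul_assoc trace_mul_sym)
  finally have 0: "(\<Sum>i\<in>UNIV. column i ?e \<bullet> (y *v column i ?e)) + (\<Sum>i\<in>UNIV. column i ?e \<bullet> (z *v column i ?e)) = 0"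
    using trace_congruence_eq_sum[of ?e y] trace_congruence_eq_sum[of ?e z] by (simp add: te)
  have "(\<Sum>i\<in>UNIV. column i ?e \<bullet> (y *v column i ?e)) = 0"
    using 0 sum_nonneg[of UNIV "\<lambda>i. column i ?e \<bullet> (y *v column i ?e)", OF pd_nonneg[OF y]]
      sum_nonneg[of UNIV "\<lambda>i. column i ?e \<bullet> (z *v column i ?e)", OF pd_nonneg[OF z]] by linarith
  then have "column i ?e \<bullet> (y *v column i ?e) = 0" for i
    using pd_nonneg[OF y] by (subst (asm) sum_nonneg_eq_0_iff) auto
  then have "column i ?e = 0" for i
    using pd_pos[OF y] by (metis less_irrefl)
  then show ?thesis by (simp add: column_def vec_eq_iff)
qed

lemma
  assumes "x \<in> pd_mats"
  shows pd_sqrt_pd: "pd_sqrt x \<in> pd_mats" and pd_sqrt_mult: "pd_sqrt x ** pd_sqrt x = x"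
proof -
  have "\<exists>!y. y \<in> pd_mats \<and> y ** y = x"
    by (metis assms pd_sqrt_exists pd_sqrt_unique)
  from theI'[OF this] show "pd_sqrt x \<in> pd_mats" "pd_sqrt x ** pd_sqrt x = x"
    by (simp_all add: pd_sqrt_def)
qed

lemma pd_sqrt_eqI: "y \<in> pd_mats \<Longrightarrow> y ** y = x \<Longrightarrow> pd_sqrt x = y"
  unfolding pd_sqrt_def by (rule the_equality) (auto intro: pd_sqrt_unique)

lemma pd_det_pos: 
  assumes "x \<in> pd_mats" shows "det x > 0"
proof -
  have "det x = det (pd_sqrt x) * det (pd_sqrt x)" using pd_sqrt_mult[OF assms] by (metis det_mul)
  moreover have "det x \<noteq> 0" using pd_invertible[OF assms] by (simp add: invertible_det_nz)
  ultimately show ?thesis by (metis mult_eq_0_iff not_real_square_gt_zero)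
qed

text \<open>Submultiplicativity bounds the norm of x by the squared Frobenius norm of its root,
  which is the trace of x. Bounds on traces, which are additive, thus become bounds on
  norms.\<close>

lemma pd_norm_le_trace:
  assumes "x \<in> pd_mats" shows "norm x \<le> trace x"
proof -
  have "norm x \<le> norm (pd_sqrt x) * norm (pd_sqrt x)"
    using norm_matrix_mult_le[of "pd_sqrt x" "pd_sqrt x"] by (simp add: pd_sqrt_mult assms)
  also have "\<dots> = trace x"
    using norm_matrix_eq_trace[of "pd_sqrt x"] assms
    by (simp add: power2_eq_square pd_symmetric pd_sqrt_pd pd_sqrt_mult)
  finally show ?thesis .
qed

lemma pd_trace_nonneg: "x \<in> pd_mats \<Longrightarrow> trace x \<ge> 0"
  using pd_norm_le_trace norm_ge_zero order_trans by blast

text \<open>With w = y - x, the difference of the inverses is itself the inverse of x + x w^(-1) x,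
  which is visibly positive definite.\<close>

lemma pd_inv_diff:
  assumes x: "x \<in> pd_mats" and y: "y \<in> pd_mats" and "y - x \<in> pd_mats"
  shows "matrix_inv x - matrix_inv y \<in> pd_mats"
proof -
  define w where "w = y - x"
  have w: "w \<in> pd_mats" and yw: "y = x + w" using assms by (auto simp: w_def)
  define a where "a = x + x ** matrix_inv w ** x"
  have a: "a \<in> pd_mats" unfolding a_def using x w by (intro pd_add pd_congruence_pd pd_inv)
  have "a = y ** matrix_inv w ** x"
    by (simp add: a_def yw matrix_mult_add_rdistrib pd_inv_right[OF w] add.commute)
  moreover have "y ** matrix_inv w ** x ** (matrix_inv x - matrix_inv y)
      = y ** matrix_inv w ** (mat 1 - x ** matrix_inv y)"
    by (simp add: matrix_mult_diff_ldistrib pd_inv_right[OF x] flip: matrix_mul_assoc)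
  moreover have "mat 1 - x ** matrix_inv y = w ** matrix_inv y"
    using pd_inv_right[OF y] by (simp add: w_def matrix_mult_diff_rdistrib)
  moreover have "y ** matrix_inv w ** (w ** matrix_inv y) = y ** (matrix_inv w ** w) ** matrix_inv y"
    by (simp add: matrix_mul_assoc)
  ultimately have "a ** (matrix_inv x - matrix_inv y) = mat 1"
    by (simp add: pd_inv_left[OF w] pd_inv_right[OF y])
  then show ?thesis using matrix_inv_eqI pd_inv[OF a] by metis
qed

text \<open>Under the substitution u = x^(-1), the domain y - x > 0 of the later convolution becomes
  u - y^(-1) > 0.\<close>

lemma pd_inv_diff_iff:
  assumes "x \<in> pd_mats" "y \<in> pd_mats"
  shows "y - matrix_inv x \<in> pd_mats \<longleftrightarrow> x - matrix_inv y \<in> pd_mats"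
  using pd_inv_diff[of "matrix_inv x" y] pd_inv_diff[of "matrix_inv y" x] assms
  by (auto simp: pd_inv matrix_inv_matrix_inv)

text \<open>Determinant of the factorization y - x^(-1) = y (x - y^(-1)) x^(-1).\<close>

lemma det_inv_diff:
  assumes "x \<in> pd_mats" "y \<in> pd_mats"
  shows "det (y - matrix_inv x) = det y * det (x - matrix_inv y) / det x"
proof -
  have "y ** (x - matrix_inv y) ** matrix_inv x = y - matrix_inv x"
    using assms by (simp add: matrix_mult_diff_ldistrib matrix_mult_diff_rdistrib pd_inv_right
        flip: matrix_mul_assoc)
  then have "det (y - matrix_inv x) = det (y ** (x - matrix_inv y) ** matrix_inv x)" by simp
  then show ?thesis using assms by (simp add: det_mul det_matrix_inv pd_invertible divide_inverse)
qed

section \<open>Measurability and the Lebesgue measure on symmetric matrices\<close>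

lemma borel_measurable_matrix:
  fixes f :: "'a \<Rightarrow> real^'n^'m"
  assumes "\<And>i j. (\<lambda>x. f x $ i $ j) \<in> borel_measurable M"
  shows "f \<in> borel_measurable M"
  using assms by (auto simp: borel_measurable_euclidean_space[of f] Basis_vec_def inner_axis)

lemma borel_measurable_matrix_mult [measurable (raw)]:
  fixes f :: "'a \<Rightarrow> real^'n^'m" and g :: "'a \<Rightarrow> real^'k^'n"
  assumes "f \<in> borel_measurable M" "g \<in> borel_measurable M"
  shows "(\<lambda>x. f x ** g x) \<in> borel_measurable M"
  using assms by (rule borel_measurable_continuous_Pair) (intro continuous_intros)

lemma borel_measurable_transpose [measurable (raw)]:
  fixes f :: "'a \<Rightarrow> real^'n^'m"
  assumes "f \<in> borel_measurable M"
  shows "(\<lambda>x. transpose (f x)) \<in> borel_measurable M"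
  by (rule measurable_compose[OF assms borel_measurable_continuous_onI]) (intro continuous_intros)

lemma borel_measurable_trace [measurable (raw)]:
  fixes f :: "'a \<Rightarrow> real^'n^'n"
  assumes "f \<in> borel_measurable M"
  shows "(\<lambda>x. trace (f x)) \<in> borel_measurable M"
  by (rule measurable_compose[OF assms borel_measurable_continuous_onI]) (intro continuous_intros)

lemma borel_measurable_det [measurable (raw)]:
  fixes f :: "'a \<Rightarrow> real^'n^'n"
  assumes "f \<in> borel_measurable M"
  shows "(\<lambda>x. det (f x)) \<in> borel_measurable M"
  by (rule measurable_compose[OF assms borel_measurable_continuous_onI]) (intro continuous_intros)

section \<open>Compact exhaustion of the cone; measurability of inversion and square root\<close>

lemma continuous_on_matrix_vector_mult [continuous_intros]:
  fixes f :: "'a::topological_space \<Rightarrow> real^'n^'m"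
  assumes "continuous_on S f"
  shows "continuous_on S (\<lambda>x. f x *v v)"
  unfolding matrix_vector_mult_def using assms by (intro continuous_intros)

text \<open>A compact exhaustion of the open cone: the lower bound 1/(n+1) on the quadratic form
  makes the condition closed, and the norm bound makes the set bounded.\<close>

definition pd_level :: "nat \<Rightarrow> 'n::{finite,wellorder} sqmat set" where
  "pd_level n = {x. transpose x = x \<and> (\<forall>v. v \<bullet> (x *v v) \<ge> inverse (real (Suc n)) * (v \<bullet> v)) \<and> norm x \<le> real n}"

lemma compact_pd_level: "compact (pd_level n)"
proof -
  have "closed (pd_level n)"
    unfolding pd_level_def Collect_conj_eq
    by (intro closed_Int closed_Collect_eq closed_Collect_all closed_Collect_le continuous_intros)
  moreover have "bounded (pd_level n)"
    by (rule boundedI[of _ "real n"]) (simp add: pd_level_def)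
  ultimately show ?thesis by (simp add: compact_eq_bounded_closed)
qed

lemma pd_level_subset: "(pd_level n :: 'n::{finite,wellorder} sqmat set) \<subseteq> pd_mats"
proof
  fix x :: "'n sqmat" assume x: "x \<in> pd_level n"
  have "v \<bullet> (x *v v) > 0" if "v \<noteq> 0" for v
  proof -
    have "0 < inverse (real (Suc n)) * (v \<bullet> v)" using that by simp
    also have "\<dots> \<le> v \<bullet> (x *v v)" using x by (simp add: pd_level_def)
    finally show ?thesis .
  qed
  then show "x \<in> pd_mats" using x by (simp add: pd_mats_def pd_level_def)
qed

text \<open>The quadratic form is continuous and positive on the compact product of C with the unit
  sphere, so it has a positive minimum there, which serves all matrices of C at once.\<close>

lemma compact_subset_pd_level:
  fixes C :: "'n::{finite,wellorder} sqmat set"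
  assumes C: "compact C" "C \<subseteq> pd_mats"
  obtains n where "C \<subseteq> pd_level n"
proof (cases "C = {}")
  case False
  let ?S = "C \<times> sphere (0 :: real ^ 'n::_) 1"
  let ?q = "\<lambda>p. snd p \<bullet> (fst p *v snd p)"
  have "continuous_on ?S ?q"
    unfolding matrix_vector_mult_def by (intro continuous_intros)
  moreover have "compact ?S" "?S \<noteq> {}" using C False by (auto intro: compact_Times)
  ultimately have "\<exists>p\<in>?S. \<forall>q\<in>?S. ?q p \<le> ?q q"
    by (intro continuous_attains_inf)
  then obtain p where p: "p \<in> ?S" "\<forall>q\<in>?S. ?q p \<le> ?q q" by (rule bexE)
  define c where "c = ?q p"
  have c: "c > 0" using p(1) C(2) unfolding c_def by (intro pd_pos) auto
  have le: "c * (v \<bullet> v) \<le> v \<bullet> (x *v v)" if x: "x \<in> C" for x v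
  proof (cases "v = 0")
    case False
    then have "(x, v /\<^sub>R norm v) \<in> ?S" using x by simp
    from bspec[OF p(2) this] have "c \<le> (v \<bullet> (x *v v)) / (norm v)\<^sup>2"
      by (simp add: c_def matrix_vector_mult_scaleR divide_inverse power2_eq_square mult.commute mult.left_commute)
    then show ?thesis using False by (simp add: le_divide_eq power2_norm_eq_inner)
  qed simp
  obtain n where n: "inverse (real (Suc n)) < c" using reals_Archimedean[OF c] by blast
  obtain b where b: "\<And>x. x \<in> C \<Longrightarrow> norm x \<le> b"
    using compact_imp_bounded[OF C(1)] by (auto simp: bounded_iff)
  obtain m where m: "b \<le> real m" using real_arch_simple by blast
  have "C \<subseteq> pd_level (max n m)"
  proof
    fix x assume x: "x \<in> C"
    have "inverse (real (Suc (max n m))) \<le> inverse (real (Suc n))"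
      by (intro le_imp_inverse_le) auto
    then have "inverse (real (Suc (max n m))) \<le> c" using n by linarith
    then have "inverse (real (Suc (max n m))) * (v \<bullet> v) \<le> v \<bullet> (x *v v)" for v
      using le[OF x, of v] by (meson inner_ge_zero mult_right_mono order_trans)
    moreover have "norm x \<le> real (max n m)" using b[OF x] m by simp
    ultimately show "x \<in> pd_level (max n m)" using x C(2) by (auto simp: pd_level_def pd_symmetric subset_iff)
  qed
  then show ?thesis using that by blast
qed (use that in auto)

lemma pd_level_Union: "(\<Union>n. pd_level n) = (pd_mats :: 'n::{finite,wellorder} sqmat set)"
proof
  show "(\<Union>n. pd_level n) \<subseteq> (pd_mats :: 'n sqmat set)" using pd_level_subset by blast
  show "(pd_mats :: 'n sqmat set) \<subseteq> (\<Union>n. pd_level n)"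
  proof
    fix x :: "'n sqmat" assume "x \<in> pd_mats"
    then show "x \<in> (\<Union>n. pd_level n)" using compact_subset_pd_level[of "{x}"] by auto
  qed
qed

lemma pd_mats_borel [measurable]: "pd_mats \<in> sets borel"
proof -
  have "(\<Union>n. pd_level n) \<in> sets borel"
    by (intro sets.countable_UN) (auto intro!: borel_compact compact_pd_level)
  then show ?thesis by (simp add: pd_level_Union)
qed

lemma space_pd_borel [simp]: "space pd_borel = pd_mats"
  by (simp add: pd_borel_def space_restrict_space)

lemma measurable_pd_borel_iff: "f \<in> measurable M pd_borel \<longleftrightarrow> f \<in> borel_measurable M \<and> f \<in> space M \<rightarrow> pd_mats"
  unfolding pd_borel_def by (rule measurable_restrict_space2_iff)

lemma measurable_pd_borelD [measurable_dest]: "f \<in> measurable M pd_borel \<Longrightarrow> f \<in> borel_measurable M"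
  by (simp add: measurable_pd_borel_iff)

lemma id_measurable_pd_borel [measurable]: "(\<lambda>x. x) \<in> borel_measurable pd_borel"
  by (intro measurable_pd_borelD) simp

lemma sets_pd_borel_iff: "A \<in> sets pd_borel \<longleftrightarrow> A \<in> sets borel \<and> A \<subseteq> pd_mats"
  unfolding pd_borel_def by (subst sets_restrict_space_iff) auto

lemma matrix_inv_measurable [measurable]:
  "matrix_inv \<in> measurable pd_borel (pd_borel :: 'n::{finite,wellorder} sqmat measure)"
proof -
  have "continuous_on pd_mats (\<lambda>x :: 'n sqmat. matrix_inv x)" by (intro continuous_intros pd_invertible)
  then show ?thesis
    by (auto simp: measurable_pd_borel_iff pd_inv)
      (simp add: borel_measurable_continuous_on_restrict pd_borel_def)
qed

text \<open>The root inverts the continuous squaring map: the preimage of a closed set C consists of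
  the squares of the elements of C in the cone, hence is a countable union of continuous images of
  compact sets.\<close>

lemma pd_sqrt_measurable [measurable]:
  "pd_sqrt \<in> measurable pd_borel (pd_borel :: 'n::{finite,wellorder} sqmat measure)"
proof -
  have *: "pd_sqrt -` C \<inter> pd_mats \<in> sets borel" if "closed C" for C :: "'n sqmat set"
  proof -
    have "pd_sqrt -` C \<inter> pd_mats = (\<Union>n. (\<lambda>y. y ** y) ` (C \<inter> pd_level n))"
    proof (intro set_eqI iffI)
      fix x assume "x \<in> pd_sqrt -` C \<inter> pd_mats"
      then have x: "pd_sqrt x \<in> C" "x \<in> pd_mats" by auto
      obtain n where "pd_sqrt x \<in> pd_level n" using pd_sqrt_pd[OF x(2)] pd_level_Union by blast
      then show "x \<in> (\<Union>n. (\<lambda>y. y ** y) ` (C \<inter> pd_level n))"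
        using x pd_sqrt_mult[OF x(2)] by force
    next
      fix x assume "x \<in> (\<Union>n. (\<lambda>y. y ** y) ` (C \<inter> pd_level n))"
      then obtain n y where y: "y \<in> C" "y \<in> pd_level n" "x = y ** y" by blast
      then have yp: "y \<in> pd_mats" using pd_level_subset by blast
      then show "x \<in> pd_sqrt -` C \<inter> pd_mats"
        using y pd_congruence_pd[OF yp mat_1_pd] by (simp add: pd_sqrt_eqI)
    qed
    moreover have "compact ((\<lambda>y. y ** y) ` (C \<inter> pd_level n))" for n :: nat
      by (intro compact_continuous_image continuous_intros closed_Int_compact that compact_pd_level)
    then have "(\<Union>n. (\<lambda>y. y ** y) ` (C \<inter> pd_level n)) \<in> sets borel"
      by (intro sets.countable_UN) (auto simp del: image_Int intro!: borel_compact)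
    ultimately show ?thesis by simp
  qed
  have "pd_sqrt \<in> borel_measurable (pd_borel :: 'n sqmat measure)"
  proof (rule borel_measurableI)
    fix S :: "'n sqmat set" assume "open S"
    then have "pd_sqrt -` (- S) \<inter> pd_mats \<in> sets borel" by (intro *) auto
    moreover have "pd_sqrt -` S \<inter> pd_mats = pd_mats - (pd_sqrt -` (- S) \<inter> pd_mats)" by auto
    ultimately show "pd_sqrt -` S \<inter> space pd_borel \<in> sets pd_borel"
      by (auto simp: sets_pd_borel_iff)
  qed
  then show ?thesis by (auto simp: measurable_pd_borel_iff pd_sqrt_pd)
qed

section \<open>Lebesgue measure in the upper triangular coordinates and its affine
  substitutions\<close>

lemma nn_integral_PiM_affine:
  fixes c t :: "'i \<Rightarrow> real"
  assumes I: "finite I" and c: "\<And>i. i \<in> I \<Longrightarrow> c i \<noteq> 0"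
    and f: "f \<in> borel_measurable (Pi\<^sub>M I (\<lambda>_. lborel))"
  shows "(\<integral>\<^sup>+u. f u \<partial>Pi\<^sub>M I (\<lambda>_. lborel)) =
    ennreal (\<Prod>i\<in>I. \<bar>c i\<bar>) * (\<integral>\<^sup>+u. f (\<lambda>i\<in>I. t i + c i * u i) \<partial>Pi\<^sub>M I (\<lambda>_. lborel))"
proof -
  interpret product_sigma_finite "\<lambda>_ :: 'i. lborel :: real measure" by standard
  let ?L = "Pi\<^sub>M I (\<lambda>_. lborel :: real measure)"
  let ?T = "\<lambda>u. \<lambda>i\<in>I. t i + c i * u i"
  have T[measurable]: "?T \<in> measurable ?L ?L" by measurable
  have "density (distr ?L ?L ?T) (\<lambda>_. ennreal (\<Prod>i\<in>I. \<bar>c i\<bar>)) = ?L"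
  proof (rule PiM_eqI[OF I])
    fix A :: "'i \<Rightarrow> real set" assume A: "\<And>i. i \<in> I \<Longrightarrow> A i \<in> sets lborel"
    have AP: "Pi\<^sub>E I A \<in> sets ?L" using A I by (intro sets_PiM_I_finite) auto
    have "emeasure (density (distr ?L ?L ?T) (\<lambda>_. ennreal (\<Prod>i\<in>I. \<bar>c i\<bar>))) (Pi\<^sub>E I A) =
      ennreal (\<Prod>i\<in>I. \<bar>c i\<bar>) * emeasure ?L (?T -` Pi\<^sub>E I A \<inter> space ?L)"
      using AP by (simp add: emeasure_density emeasure_distr nn_integral_cmult)
    also have "?T -` Pi\<^sub>E I A \<inter> space ?L = Pi\<^sub>E I (\<lambda>i. (\<lambda>x. t i + c i * x) -` A i)"
      by (auto simp: space_PiM PiE_iff extensional_def)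
    also have "emeasure ?L \<dots> = (\<Prod>i\<in>I. emeasure lborel ((\<lambda>x. t i + c i * x) -` A i))"
      using A I by (intro emeasure_PiM) (auto intro!: measurable_sets_borel[of _ borel])
    also have "ennreal (\<Prod>i\<in>I. \<bar>c i\<bar>) * \<dots> = (\<Prod>i\<in>I. ennreal \<bar>c i\<bar> * emeasure lborel ((\<lambda>x. t i + c i * x) -` A i))"
      by (simp add: prod.distrib prod_ennreal)
    also have "\<dots> = (\<Prod>i\<in>I. emeasure lborel (A i))"
    proof (intro prod.cong refl)
      fix i assume i: "i \<in> I"
      have "emeasure lborel (A i) = emeasure (density (distr lborel borel (\<lambda>x. t i + c i * x)) (\<lambda>_. ennreal \<bar>c i\<bar>)) (A i)"
        using lborel_real_affine[OF c[OF i], of "t i"] by simp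
      also have "\<dots> = ennreal \<bar>c i\<bar> * emeasure lborel ((\<lambda>x. t i + c i * x) -` A i)"
        using A[OF i] by (simp add: emeasure_density emeasure_distr nn_integral_cmult)
      finally show "ennreal \<bar>c i\<bar> * emeasure lborel ((\<lambda>x. t i + c i * x) -` A i) = emeasure lborel (A i)" ..
    qed
    finally show "emeasure (density (distr ?L ?L ?T) (\<lambda>_. ennreal (\<Prod>i\<in>I. \<bar>c i\<bar>))) (Pi\<^sub>E I A) = (\<Prod>i\<in>I. emeasure lborel (A i))" .
  qed simp
  then have "(\<integral>\<^sup>+u. f u \<partial>?L) = (\<integral>\<^sup>+u. f u \<partial>density (distr ?L ?L ?T) (\<lambda>_. ennreal (\<Prod>i\<in>I. \<bar>c i\<bar>)))"
    by simp
  also have "\<dots> = ennreal (\<Prod>i\<in>I. \<bar>c i\<bar>) * (\<integral>\<^sup>+u. f (?T u) \<partial>?L)"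
    using f by (simp add: nn_integral_density nn_integral_distr nn_integral_cmult)
  finally show ?thesis .
qed

definition sym_of :: "('n \<times> 'n \<Rightarrow> real) \<Rightarrow> 'n::{finite,wellorder} sqmat" where
  "sym_of u = (\<chi> i j. if i \<le> j then u (i, j) else u (j, i))"

definition upper_idx :: "('n::wellorder \<times> 'n) set" where
  "upper_idx = {(i, j). i \<le> j}"

abbreviation lborel_upper :: "('n::{finite,wellorder} \<times> 'n \<Rightarrow> real) measure" where
  "lborel_upper \<equiv> Pi\<^sub>M upper_idx (\<lambda>_. lborel)"

lemma finite_upper_idx [simp]: "finite (upper_idx :: ('n::{finite,wellorder} \<times> 'n) set)"
  by (rule finite_subset[OF subset_UNIV]) simp

lemma sym_of_measurable [measurable]:
  "sym_of \<in> borel_measurable (lborel_upper :: ('n::{finite,wellorder} \<times> 'n \<Rightarrow> real) measure)"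
proof (rule borel_measurable_matrix)
  fix i j :: "'n::_"
  show "(\<lambda>u. sym_of u $ i $ j) \<in> borel_measurable lborel_upper"
    unfolding sym_of_def
    by (cases "i \<le> j") (auto simp: upper_idx_def intro!: measurable_component_singleton[where M="\<lambda>_. lborel", simplified])
qed

lemma sym_lebesgue_eq: "sym_lebesgue = distr lborel_upper borel sym_of"
  by (simp add: sym_lebesgue_def sym_of_def[abs_def] upper_idx_def)

lemma sets_sym_lebesgue [measurable_cong, simp]: "sets sym_lebesgue = sets borel"
  and space_sym_lebesgue [simp]: "space sym_lebesgue = UNIV"
  by (simp_all add: sym_lebesgue_eq)

lemma transpose_sym_of: "transpose (sym_of u) = sym_of u"
  by (auto simp: transpose_def sym_of_def vec_eq_iff)

lemma nn_integral_sym_lebesgue: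
  "f \<in> borel_measurable borel \<Longrightarrow> (\<integral>\<^sup>+x. f x \<partial>sym_lebesgue) = (\<integral>\<^sup>+u. f (sym_of u) \<partial>lborel_upper)"
  by (simp add: sym_lebesgue_eq nn_integral_distr)

lemma AE_sym_lebesgue: "AE x in sym_lebesgue. transpose x = x"
  unfolding sym_lebesgue_eq by (subst AE_distr_iff) (auto simp: transpose_sym_of)

lemma symmetric_eq_sym_of:
  assumes "transpose s = s"
  shows "s = sym_of (\<lambda>(i, j). s $ i $ j)"
proof -
  have "s $ i $ j = s $ j $ i" for i j using assms by (metis transpose_def vec_lambda_beta)
  then show ?thesis by (simp add: sym_of_def vec_eq_iff)
qed

lemma sym_of_restrict: "sym_of (restrict u upper_idx) = sym_of u"
  by (auto simp: sym_of_def vec_eq_iff upper_idx_def not_le)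

lemma nn_integral_sym_lebesgue_translate:
  fixes f :: "'n::{finite,wellorder} sqmat \<Rightarrow> ennreal"
  assumes f[measurable]: "f \<in> borel_measurable borel" and s: "transpose s = s"
  shows "(\<integral>\<^sup>+x. f (x + s) \<partial>sym_lebesgue) = (\<integral>\<^sup>+x. f x \<partial>sym_lebesgue)"
proof -
  have "sym_of (\<lambda>i\<in>upper_idx. s $ fst i $ snd i + 1 * u i) = sym_of u + s" for u :: "'n::_ \<times> 'n \<Rightarrow> real"
    unfolding sym_of_restrict
    by (subst (2) symmetric_eq_sym_of[OF s]) (simp add: sym_of_def vec_eq_iff)
  then show ?thesis
    using nn_integral_PiM_affine[of upper_idx "\<lambda>_. 1" "\<lambda>u. f (sym_of u)" "\<lambda>i. s $ fst i $ snd i"]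
    by (simp add: nn_integral_sym_lebesgue)
qed

text \<open>Every index occurs d + 1 times. Reflecting the second factor into the lower triangle
  makes the two factors cover the full square once, which gives the power d, and the diagonal a
  second time, which gives one more.\<close>

lemma prod_upper_idx:
  fixes e :: "'n::{finite,wellorder} \<Rightarrow> real"
  shows "(\<Prod>(i, j)\<in>upper_idx. e i * e j) = (\<Prod>i\<in>UNIV. e i) ^ (CARD('n) + 1)"
proof -
  let ?lo = "{(i, j). j < (i::'n)}" and ?di = "{(i, j). i = (j :: 'n)}"
  have "(\<Prod>(i, j)\<in>upper_idx. e i * e j) = (\<Prod>(i, j)\<in>upper_idx. e i) * (\<Prod>(i, j)\<in>upper_idx. e j)"
    by (simp add: prod.distrib case_prod_beta)
  also have "(\<Prod>(i, j)\<in>upper_idx. e j) = (\<Prod>(i, j)\<in>?lo \<union> ?di. e i)"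
    by (rule prod.reindex_bij_witness[where i="\<lambda>(i, j). (j, i)" and j="\<lambda>(i, j). (j, i)"])
      (auto simp: upper_idx_def)
  also have "\<dots> = (\<Prod>(i, j)\<in>?lo. e i) * (\<Prod>(i, j)\<in>?di. e i)"
    by (intro prod.union_disjoint finite) auto
  also have "(\<Prod>(i, j)\<in>?di. e i) = (\<Prod>i\<in>UNIV. e i)"
    by (rule prod.reindex_bij_witness[where i="\<lambda>i. (i, i)" and j=fst]) auto
  also have "(\<Prod>(i, j)\<in>upper_idx. e i) * ((\<Prod>(i, j)\<in>?lo. e i) * (\<Prod>i\<in>UNIV. e i)) =
      (\<Prod>(i, j)\<in>upper_idx \<union> ?lo. e i) * (\<Prod>i\<in>UNIV. e i)"
    by (subst prod.union_disjoint) (auto simp: upper_idx_def mult.assoc)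
  also have "upper_idx \<union> ?lo = UNIV \<times> UNIV" by (auto simp: upper_idx_def)
  also have "(\<Prod>(i, j)\<in>UNIV \<times> (UNIV :: 'n set). e i) = (\<Prod>i\<in>UNIV. \<Prod>j\<in>(UNIV :: 'n set). e i)"
    by (rule prod.cartesian_product[symmetric])
  also have "\<dots> = (\<Prod>i\<in>UNIV. e i) ^ CARD('n)"
    by (simp add: prod_power_distrib)
  finally show ?thesis by simp
qed

text \<open>The entry (i, j) is scaled by e_i e_j, so the Jacobian is the product computed in
  \<open>prod_upper_idx\<close>.\<close>

lemma nn_integral_sym_lebesgue_diag:
  fixes e :: "real ^ 'n::{finite,wellorder}" and f :: "'n::{finite,wellorder} sqmat \<Rightarrow> ennreal"
  assumes f[measurable]: "f \<in> borel_measurable borel" and e: "\<And>i. e $ i > 0"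
  shows "(\<integral>\<^sup>+x. f x \<partial>sym_lebesgue) =
    ennreal (det (diag_matrix e) ^ (CARD('n) + 1)) * (\<integral>\<^sup>+x. f (diag_matrix e ** x ** diag_matrix e) \<partial>sym_lebesgue)"
proof -
  have ent: "(diag_matrix e ** x ** diag_matrix e) $ i $ j = e $ i * x $ i $ j * e $ j" for x i j
    by (simp add: matrix_matrix_mult_def diag_matrix_def mult_delta_left mult_delta_right)
  have "sym_of (\<lambda>i\<in>upper_idx. 0 + (e $ fst i * e $ snd i) * u i) = diag_matrix e ** sym_of u ** diag_matrix e" for u
    unfolding sym_of_restrict by (simp add: sym_of_def vec_eq_iff ent mult_ac)
  moreover have "(\<Prod>i\<in>upper_idx. \<bar>e $ fst i * e $ snd i\<bar>) = det (diag_matrix e) ^ (CARD('n) + 1)"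
    using prod_upper_idx[of "\<lambda>i. e $ i"] e
    by (simp add: det_diag_matrix case_prod_beta abs_mult less_imp_le)
  ultimately show ?thesis
    using nn_integral_PiM_affine[of upper_idx "\<lambda>i. e $ fst i * e $ snd i" "\<lambda>u. f (sym_of u)" "\<lambda>_. 0"] e
    by (simp add: nn_integral_sym_lebesgue less_imp_neq[symmetric] del: power_Suc)
qed

section \<open>Congruence invariance\<close>

lemma emeasure_sym_lebesgue_cball_finite:
  "emeasure sym_lebesgue (cball (0 :: 'n::{finite,wellorder} sqmat) r) < \<infinity>"
proof -
  interpret product_sigma_finite "\<lambda>_ :: 'n::_ \<times> 'n. lborel :: real measure" by standard
  let ?Q = "Pi\<^sub>E (upper_idx :: ('n::_ \<times> 'n) set) (\<lambda>_. {-r..r})"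
  have "(sym_of -` cball (0 :: 'n sqmat) r \<inter> space lborel_upper) \<subseteq> ?Q"
  proof
    fix u assume u: "u \<in> sym_of -` cball (0 :: 'n sqmat) r \<inter> space lborel_upper"
    have "u p \<in> {-r..r}" if pu: "p \<in> upper_idx" for p
    proof -
      obtain i j where p: "p = (i, j)" "i \<le> j" using pu by (auto simp: upper_idx_def)
      have "\<bar>(sym_of u :: 'n sqmat) $ i $ j\<bar> \<le> norm (sym_of u :: 'n sqmat)"
        by (rule order_trans[OF component_le_norm_cart Finite_Cartesian_Product.norm_nth_le])
      also have "\<dots> \<le> r" using u by (simp add: dist_norm)
      finally show ?thesis using p by (simp add: sym_of_def abs_le_iff)
    qed
    then show "u \<in> ?Q" using u by (auto simp: space_PiM PiE_iff)
  qed
  then have "emeasure sym_lebesgue (cball (0 :: 'n sqmat) r) \<le> emeasure lborel_upper ?Q"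
    by (simp add: sym_lebesgue_eq emeasure_distr emeasure_mono sets_PiM_I_finite)
  also have "\<dots> = (\<Prod>i\<in>(upper_idx :: ('n::_ \<times> 'n) set). emeasure lborel {-r..r})" by (intro emeasure_PiM) auto
  also have "\<dots> < \<infinity>" by (simp add: less_top[symmetric] power_eq_top_ennreal emeasure_lborel_Icc_eq)
  finally show ?thesis .
qed

lemma emeasure_sym_lebesgue_cball_pos:
  assumes "r > 0"
  shows "emeasure sym_lebesgue (cball (0 :: 'n::{finite,wellorder} sqmat) r) > 0"
proof -
  interpret product_sigma_finite "\<lambda>_ :: 'n::_ \<times> 'n. lborel :: real measure" by standard
  \<comment> \<open>The norm is at most the sum of the absolute values of the d^2 entries, so the
    cube of half-width r / d^2 lies in the ball.\<close>
  define q where "q = r / (real CARD('n) * real CARD('n))"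
  have q: "q > 0" using assms by (simp add: q_def)
  let ?Q = "Pi\<^sub>E (upper_idx :: ('n::_ \<times> 'n) set) (\<lambda>_. {-q..q})"
  have "?Q \<subseteq> sym_of -` cball (0 :: 'n sqmat) r \<inter> space lborel_upper"
  proof
    fix u assume u: "u \<in> ?Q"
    have "\<bar>(sym_of u :: 'n sqmat) $ i $ j\<bar> \<le> q" for i j
    proof -
      have "(min i j, max i j) \<in> upper_idx" using linear[of i j] by (auto simp: upper_idx_def min_def max_def)
      from PiE_mem[OF u this] show ?thesis
        by (cases "i \<le> j") (auto simp: sym_of_def abs_le_iff min_def max_def)
    qed
    then have *: "norm ((sym_of u :: 'n sqmat) $ i) \<le> real CARD('n) * q" for i
      by (intro order_trans[OF norm_le_l1_cart]) (auto intro!: sum_bounded_above[THEN order_trans])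
    have "norm (sym_of u :: 'n sqmat) \<le> (\<Sum>i\<in>UNIV. norm ((sym_of u :: 'n sqmat) $ i))"
      unfolding norm_vec_def by (rule L2_set_le_sum) simp
    also have "\<dots> \<le> real CARD('n) * (real CARD('n) * q)"
      using sum_bounded_above[of UNIV "\<lambda>i. norm ((sym_of u :: 'n sqmat) $ i)", OF *] by simp
    also have "\<dots> = r" by (simp add: q_def)
    finally show "u \<in> sym_of -` cball (0 :: 'n sqmat) r \<inter> space lborel_upper"
      using u by (simp add: space_PiM dist_norm PiE_iff)
  qed
  then have "emeasure lborel_upper ?Q \<le> emeasure sym_lebesgue (cball (0 :: 'n sqmat) r)"
    by (simp add: sym_lebesgue_eq emeasure_distr emeasure_mono)
  moreover have "emeasure lborel_upper ?Q = (\<Prod>i\<in>(upper_idx :: ('n::_ \<times> 'n) set). emeasure lborel {-q..q})" by (intro emeasure_PiM) auto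
  moreover have "\<dots> > 0" using q by (simp add: ennreal_power)
  ultimately show ?thesis by simp
qed

lemma sigma_finite_cball:
  fixes N :: "'a::euclidean_space measure"
  assumes "sets N = sets borel" "\<And>r. emeasure N (cball 0 r) < \<infinity>"
  shows "sigma_finite_measure N"
proof
  have "x \<in> (\<Union>n. cball (0::'a) (real n))" for x
    using real_arch_simple[of "norm x"] by (auto simp: dist_norm)
  then show "\<exists>A. countable A \<and> A \<subseteq> sets N \<and> \<Union>A = space N \<and> (\<forall>a\<in>A. emeasure N a \<noteq> \<infinity>)"
    using assms by (intro exI[of _ "range (\<lambda>n. cball 0 (real n))"])
      (auto simp: sets_eq_imp_space_eq less_top)
qed

lemma sigma_finite_sym_lebesgue: "sigma_finite_measure sym_lebesgue"
  by (rule sigma_finite_cball[OF sets_sym_lebesgue emeasure_sym_lebesgue_cball_finite])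

text \<open>Uniqueness of Haar measure on the additive group of symmetric matrices. The double
  integral of f(x) h(x + y) is evaluated once by translating y, using the invariance of N, and once
  by translating x, using that of \<open>sym_lebesgue\<close>; f is the indicator of the unit ball,
  which is unchanged under a change of sign. The conclusion is cross-multiplied to avoid a quotient
  in \<open>ennreal\<close>.\<close>

lemma sym_lebesgue_unique:
  fixes N :: "'n::{finite,wellorder} sqmat measure"
  assumes sets_N[measurable_cong]: "sets N = sets borel"
    and sym: "AE x in N. transpose x = x"
    and fin: "\<And>r. emeasure N (cball 0 r) < \<infinity>"
    and trans: "\<And>f s. f \<in> borel_measurable borel \<Longrightarrow> transpose s = s \<Longrightarrow> (\<integral>\<^sup>+x. f (x + s) \<partial>N) = (\<integral>\<^sup>+x. f x \<partial>N)"
    and h[measurable]: "h \<in> borel_measurable borel"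
  shows "emeasure N (cball 0 1) * (\<integral>\<^sup>+x. h x \<partial>sym_lebesgue) =
    emeasure sym_lebesgue (cball (0 :: 'n sqmat) 1) * (\<integral>\<^sup>+x. h x \<partial>N)"
proof -
  interpret L: sigma_finite_measure "sym_lebesgue :: 'n sqmat measure" by (rule sigma_finite_sym_lebesgue)
  interpret N: sigma_finite_measure N by (rule sigma_finite_cball[OF sets_N fin])
  interpret P: pair_sigma_finite "sym_lebesgue :: 'n sqmat measure" N ..
  define f :: "'n sqmat \<Rightarrow> ennreal" where "f = indicator (cball 0 1)"
  have f[measurable]: "f \<in> borel_measurable borel" unfolding f_def by (rule borel_measurable_indicator) simp
  have f_int: "(\<integral>\<^sup>+x. f x \<partial>sym_lebesgue) = emeasure sym_lebesgue (cball (0 :: 'n sqmat) 1)"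
    unfolding f_def by (rule nn_integral_indicator) simp
  have fm: "f \<in> borel_measurable sym_lebesgue" by (subst measurable_cong_sets[OF sets_sym_lebesgue refl]) (rule f)
  have hm: "(\<lambda>y. h (y + x)) \<in> borel_measurable N" for x
    by (subst measurable_cong_sets[OF sets_N refl]) measurable
  have fm2: "(\<lambda>y. f (x - y)) \<in> borel_measurable N" for x
    by (subst measurable_cong_sets[OF sets_N refl]) measurable
  have f_minus: "f (- x) = f x" for x by (simp add: f_def indicator_def dist_norm)
  have "emeasure sym_lebesgue (cball (0 :: 'n sqmat) 1) * (\<integral>\<^sup>+x. h x \<partial>N)
      = (\<integral>\<^sup>+x. f x * (\<integral>\<^sup>+y. h y \<partial>N) \<partial>sym_lebesgue)"
    by (simp add: nn_integral_multc[OF fm] f_int)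
  also have "\<dots> = (\<integral>\<^sup>+x. (\<integral>\<^sup>+y. f x * h (y + x) \<partial>N) \<partial>sym_lebesgue)"
    using AE_sym_lebesgue by (intro nn_integral_cong_AE, eventually_elim) (simp add: nn_integral_cmult[OF hm] trans)
  also have "\<dots> = (\<integral>\<^sup>+y. (\<integral>\<^sup>+x. f x * h (y + x) \<partial>sym_lebesgue) \<partial>N)"
    by (rule P.Fubini'[symmetric]) measurable
  also have "\<dots> = (\<integral>\<^sup>+y. (\<integral>\<^sup>+x. f (x - y) * h x \<partial>sym_lebesgue) \<partial>N)"
    using sym
  proof (intro nn_integral_cong_AE, eventually_elim)
    fix y :: "'n sqmat" assume "transpose y = y"
    then show "(\<integral>\<^sup>+x. f x * h (y + x) \<partial>sym_lebesgue) = (\<integral>\<^sup>+x. f (x - y) * h x \<partial>sym_lebesgue)"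
      using nn_integral_sym_lebesgue_translate[of "\<lambda>x. f (x - y) * h x" y] by (simp add: add.commute)
  qed
  also have "\<dots> = (\<integral>\<^sup>+x. (\<integral>\<^sup>+y. f (x - y) * h x \<partial>N) \<partial>sym_lebesgue)"
    by (rule P.Fubini') measurable
  also have "\<dots> = (\<integral>\<^sup>+x. emeasure N (cball 0 1) * h x \<partial>sym_lebesgue)"
    using AE_sym_lebesgue
  proof (intro nn_integral_cong_AE, eventually_elim)
    fix x :: "'n sqmat" assume "transpose x = x"
    then have "(\<integral>\<^sup>+y. f (x - y) \<partial>N) = (\<integral>\<^sup>+y. f (- y) \<partial>N)"
      using trans[of "\<lambda>y. f (x - y)" x] by simp
    also have "\<dots> = emeasure N (cball 0 1)" by (simp only: f_minus) (simp add: f_def sets_N)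
    finally show "(\<integral>\<^sup>+y. f (x - y) * h x \<partial>N) = emeasure N (cball 0 1) * h x"
      by (simp add: nn_integral_multc[OF fm2])
  qed
  also have "\<dots> = emeasure N (cball 0 1) * (\<integral>\<^sup>+x. h x \<partial>sym_lebesgue)"
    by (rule nn_integral_cmult) (subst measurable_cong_sets[OF sets_sym_lebesgue refl], rule h)
  finally show ?thesis ..
qed

text \<open>The image of \<open>sym_lebesgue\<close> under the congruence is again translation
  invariant and finite on balls, hence a multiple of it. The factor stays open here: for orthogonal
  g it is found by testing on a ball, while positive diagonal matrices are treated directly.\<close>

lemma sym_lebesgue_congruence_ex:
  fixes g :: "'n::{finite,wellorder} sqmat"
  assumes g: "invertible g"
  obtains c :: ennreal where "\<And>h. h \<in> borel_measurable borel \<Longrightarrow>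
    (\<integral>\<^sup>+x. h (g ** x ** transpose g) \<partial>sym_lebesgue) = c * (\<integral>\<^sup>+x. h x \<partial>sym_lebesgue)"
proof -
  let ?L = "sym_lebesgue :: 'n sqmat measure"
  let ?i = "matrix_inv g"
  define N where "N = distr ?L borel (\<lambda>x. g ** x ** transpose g)"
  have ig: "?i ** g = mat 1" "g ** ?i = mat 1" using g by (simp_all add: matrix_inv_left matrix_inv_right)
  have tig: "transpose g ** transpose ?i = mat 1" "transpose ?i ** transpose g = mat 1"
    using ig by (simp_all flip: matrix_transpose_mul)
  have gm[measurable]: "(\<lambda>x. g ** x ** transpose g) \<in> measurable ?L borel"
    by (subst measurable_cong_sets[OF sets_sym_lebesgue refl]) measurable
  have setsN: "sets N = sets borel" by (simp add: N_def)
  have intN: "(\<integral>\<^sup>+x. h x \<partial>N) = (\<integral>\<^sup>+x. h (g ** x ** transpose g) \<partial>?L)" if "h \<in> borel_measurable borel" for h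
    using that unfolding N_def by (subst nn_integral_distr) auto
  have symN: "AE x in N. transpose x = x"
    unfolding N_def using AE_sym_lebesgue
    by (subst AE_distr_iff) (auto elim!: eventually_mono simp: matrix_transpose_mul matrix_mul_assoc)
  have finN: "emeasure N (cball 0 r) < \<infinity>" for r
  proof -
    have "norm x \<le> norm ?i * r * norm (transpose ?i)" if "norm (g ** x ** transpose g) \<le> r" for x
    proof -
      have "x = ?i ** (g ** x ** transpose g) ** transpose ?i"
        by (simp add: matrix_mul_assoc ig) (simp add: tig flip: matrix_mul_assoc)
      then have "norm x = norm (?i ** (g ** x ** transpose g) ** transpose ?i)" by simp
      also have "\<dots> \<le> norm ?i * norm (g ** x ** transpose g) * norm (transpose ?i)"
        by (meson norm_matrix_mult_le mult_right_mono norm_ge_zero order_trans)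
      also have "\<dots> \<le> norm ?i * r * norm (transpose ?i)"
        using that by (intro mult_right_mono mult_left_mono) auto
      finally show ?thesis .
    qed
    then have "(\<lambda>x. g ** x ** transpose g) -` cball 0 r \<subseteq> cball 0 (norm ?i * r * norm (transpose ?i))"
      by (auto simp: dist_norm)
    then have "emeasure N (cball 0 r) \<le> emeasure ?L (cball 0 (norm ?i * r * norm (transpose ?i)))"
      by (simp add: N_def emeasure_distr emeasure_mono)
    then show ?thesis using emeasure_sym_lebesgue_cball_finite by (rule le_less_trans)
  qed
  have transN: "(\<integral>\<^sup>+x. f (x + s) \<partial>N) = (\<integral>\<^sup>+x. f x \<partial>N)"
    if [measurable]: "f \<in> borel_measurable borel" and s: "transpose s = s" for f s
  proof -
    \<comment> \<open>A translation of the image by s comes from a translation by g^(-1) s g^(-T)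
      before the map.\<close>
    have "g ** (x + ?i ** s ** transpose ?i) ** transpose g = g ** x ** transpose g + s" for x
      by (simp add: matrix_add_ldistrib matrix_mult_add_rdistrib matrix_mul_assoc ig)
        (simp add: tig flip: matrix_mul_assoc)
    then show ?thesis
      using nn_integral_sym_lebesgue_translate[of "\<lambda>x. f (g ** x ** transpose g)" "?i ** s ** transpose ?i"] s
      by (simp add: intN matrix_transpose_mul matrix_mul_assoc)
  qed
  let ?b = "emeasure ?L (cball 0 1)"
  have b: "?b \<noteq> 0" "?b \<noteq> \<infinity>"
    using emeasure_sym_lebesgue_cball_pos[where 'n='n, of 1] emeasure_sym_lebesgue_cball_finite[where 'n='n, of 1]
    by (auto simp: less_top)
  show ?thesis
  proof
    fix h :: "'n sqmat \<Rightarrow> ennreal" assume h: "h \<in> borel_measurable borel"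
    have "emeasure N (cball 0 1) * (\<integral>\<^sup>+x. h x \<partial>?L) = ?b * (\<integral>\<^sup>+x. h x \<partial>N)"
      by (rule sym_lebesgue_unique[OF setsN symN finN transN h])
    then have "(\<integral>\<^sup>+x. h x \<partial>N) = emeasure N (cball 0 1) / ?b * (\<integral>\<^sup>+x. h x \<partial>?L)"
    proof -
      assume *: "emeasure N (cball 0 1) * (\<integral>\<^sup>+x. h x \<partial>?L) = ?b * (\<integral>\<^sup>+x. h x \<partial>N)"
      have "emeasure N (cball 0 1) / ?b * (\<integral>\<^sup>+x. h x \<partial>?L) = (emeasure N (cball 0 1) * (\<integral>\<^sup>+x. h x \<partial>?L)) / ?b"
        by (simp add: ennreal_times_divide mult.commute)
      also have "\<dots> = (\<integral>\<^sup>+x. h x \<partial>N) * ?b / ?b"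
        by (subst *) (simp add: mult.commute)
      also have "\<dots> = (\<integral>\<^sup>+x. h x \<partial>N)" using b by (simp add: ennreal_mult_divide_eq)
      finally show ?thesis ..
    qed
    then show "(\<integral>\<^sup>+x. h (g ** x ** transpose g) \<partial>?L) = emeasure N (cball 0 1) / ?b * (\<integral>\<^sup>+x. h x \<partial>?L)"
      by (simp add: intN h)
  qed
qed

lemma norm_orthogonal_congruence:
  fixes k x :: "real^'n^'n"
  assumes "orthogonal_matrix k"
  shows "norm (k ** x ** transpose k) = norm x"
proof -
  have k: "transpose k ** k = mat 1" using assms by (simp add: orthogonal_matrix_def)
  have "k ** x ** transpose k ** transpose (k ** x ** transpose k) = k ** x ** (transpose k ** k) ** transpose x ** transpose k"
    by (simp add: matrix_transpose_mul matrix_mul_assoc)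
  also have "\<dots> = k ** (x ** transpose x) ** transpose k" by (simp add: k matrix_mul_assoc)
  finally have "(norm (k ** x ** transpose k))\<^sup>2 = (norm x)\<^sup>2"
    by (simp add: norm_matrix_eq_trace trace_congruence k)
  then show ?thesis by simp
qed

text \<open>The unit ball of the Frobenius norm is invariant under orthogonal congruence and has
  positive finite measure, so the factor from \<open>sym_lebesgue_congruence_ex\<close> is
  1.\<close>

lemma nn_integral_sym_lebesgue_orthogonal:
  fixes k :: "'n::{finite,wellorder} sqmat"
  assumes k: "orthogonal_matrix k" and h: "h \<in> borel_measurable borel"
  shows "(\<integral>\<^sup>+x. h (k ** x ** transpose k) \<partial>sym_lebesgue) = (\<integral>\<^sup>+x. h x \<partial>sym_lebesgue)"
proof -
  let ?L = "sym_lebesgue :: 'n sqmat measure"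
  have "invertible k" using k by (auto simp: orthogonal_matrix_def invertible_def)
  then obtain c :: ennreal where c: "\<And>h. h \<in> borel_measurable borel \<Longrightarrow>
    (\<integral>\<^sup>+x. h (k ** x ** transpose k) \<partial>?L) = c * (\<integral>\<^sup>+x. h x \<partial>?L)"
    using sym_lebesgue_congruence_ex by blast
  let ?b = "indicator (cball 0 1) :: 'n sqmat \<Rightarrow> ennreal"
  have "?b \<in> borel_measurable borel" by (rule borel_measurable_indicator) simp
  moreover have "?b (k ** x ** transpose k) = ?b x" for x
    by (simp add: indicator_def dist_norm norm_orthogonal_congruence[OF k])
  ultimately have "(\<integral>\<^sup>+x. ?b x \<partial>?L) = c * (\<integral>\<^sup>+x. ?b x \<partial>?L)"
    using c[of ?b] by simp
  then have "emeasure ?L (cball 0 1) = c * emeasure ?L (cball 0 1)"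
    by simp
  then have "c * emeasure ?L (cball 0 1) / emeasure ?L (cball 0 1) = emeasure ?L (cball 0 1) / emeasure ?L (cball 0 1)"
    by simp
  then have "c = 1"
    using emeasure_sym_lebesgue_cball_pos[where 'n='n, of 1] emeasure_sym_lebesgue_cball_finite[where 'n='n, of 1]
    by (simp add: ennreal_mult_divide_eq ennreal_divide_self)
  then show ?thesis using c[OF h] by simp
qed

text \<open>In the spectral decomposition of s the orthogonal factors preserve the measure, and the
  diagonal factor contributes its explicit Jacobian and has the determinant of s.\<close>

lemma nn_integral_sym_lebesgue_congruence:
  fixes s :: "'n::{finite,wellorder} sqmat"
  assumes s: "s \<in> pd_mats" and h[measurable]: "h \<in> borel_measurable borel"
  shows "(\<integral>\<^sup>+x. h x \<partial>sym_lebesgue) = ennreal (det s ^ (CARD('n) + 1)) * (\<integral>\<^sup>+x. h (s ** x ** s) \<partial>sym_lebesgue)"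
proof -
  obtain k e where ke: "orthogonal_matrix k" "s = k ** diag_matrix e ** transpose k" "\<And>i. e $ i > 0"
    using pd_diagonalization[OF s] by blast
  let ?d = "diag_matrix e"
  have tk: "orthogonal_matrix (transpose k)" using ke(1) by simp
  have "det k * det (transpose k) = 1"
    using ke(1) by (metis det_I det_mul orthogonal_matrix_def)
  then have det: "det s = det ?d" by (simp add: ke(2) det_mul mult.commute mult.left_commute)
  have "(\<integral>\<^sup>+x. h (s ** x ** s) \<partial>sym_lebesgue) =
    (\<integral>\<^sup>+x. h (k ** (?d ** (transpose k ** x ** transpose (transpose k)) ** ?d) ** transpose k) \<partial>sym_lebesgue)"
    by (simp add: ke(2) matrix_mul_assoc)
  also have "\<dots> = (\<integral>\<^sup>+x. h (k ** (?d ** x ** ?d) ** transpose k) \<partial>sym_lebesgue)"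
    by (rule nn_integral_sym_lebesgue_orthogonal[OF tk]) measurable
  finally have "ennreal (det s ^ (CARD('n) + 1)) * (\<integral>\<^sup>+x. h (s ** x ** s) \<partial>sym_lebesgue)
     = (\<integral>\<^sup>+x. h (k ** x ** transpose k) \<partial>sym_lebesgue)"
    using nn_integral_sym_lebesgue_diag[of "\<lambda>x. h (k ** x ** transpose k)" e] ke(3)
    by (simp add: det del: power_Suc)
  also have "\<dots> = (\<integral>\<^sup>+x. h x \<partial>sym_lebesgue)"
    by (rule nn_integral_sym_lebesgue_orthogonal[OF ke(1) h])
  finally show ?thesis ..
qed

section \<open>The measure \<open>pd_mu\<close> and its invariance under congruence\<close>

lemma sets_pd_mu [measurable_cong, simp]: "sets pd_mu = sets pd_borel"
  unfolding pd_mu_def pd_borel_def sets_density by (rule sets_restrict_space_cong) simp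

lemma space_pd_mu [simp]: "space pd_mu = pd_mats"
  using sets_eq_imp_space_eq[OF sets_pd_mu] by simp

lemma borel_measurable_pd_borel_iff:
  fixes f :: "_ \<Rightarrow> ennreal"
  shows "f \<in> borel_measurable pd_borel \<longleftrightarrow> (\<lambda>x. f x * indicator pd_mats x) \<in> borel_measurable borel"
  unfolding pd_borel_def by (rule borel_measurable_restrict_space_iff_ennreal) simp

text \<open>The density of \<open>pd_mu\<close> extended by 0 off the cone, so that integrals over
  the cone become integrals over all matrices and may be translated freely.\<close>

definition pd_weight :: "'n::{finite,wellorder} sqmat \<Rightarrow> ennreal" where
  "pd_weight x = ennreal (det x powr (- (real CARD('n) + 1) / 2)) * indicator pd_mats x"

lemma pd_weight_measurable [measurable]: "pd_weight \<in> borel_measurable borel"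
  unfolding pd_weight_def[abs_def] by measurable

lemma nn_integral_pd_mu:
  fixes f :: "'n::{finite,wellorder} sqmat \<Rightarrow> ennreal"
  assumes f[measurable]: "f \<in> borel_measurable pd_borel"
  shows "(\<integral>\<^sup>+x. f x \<partial>pd_mu) = (\<integral>\<^sup>+x. pd_weight x * f x \<partial>sym_lebesgue)"
proof -
  have s[measurable_cong]: "sets (restrict_space sym_lebesgue pd_mats) = sets (pd_borel :: 'n sqmat measure)"
    unfolding pd_borel_def by (rule sets_restrict_space_cong) simp
  show ?thesis
    unfolding pd_mu_def
    by (subst nn_integral_density) (auto simp: nn_integral_restrict_space pd_weight_def mult_ac)
qed

lemma pd_weight_mult_measurable [measurable]:
  fixes f :: "'n::{finite,wellorder} sqmat \<Rightarrow> ennreal"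
  shows   "f \<in> borel_measurable pd_borel \<Longrightarrow> (\<lambda>x. pd_weight x * f x) \<in> borel_measurable borel"
proof -
  assume "f \<in> borel_measurable pd_borel"
  then have [measurable]: "(\<lambda>x. f x * indicator pd_mats x) \<in> borel_measurable borel"
    by (simp add: borel_measurable_pd_borel_iff)
  have "pd_weight x * f x = ennreal (det x powr (- (real CARD('n) + 1) / 2)) * (f x * indicator pd_mats x)" for x
    by (simp add: pd_weight_def mult_ac)
  then show ?thesis by simp
qed

lemma pd_congruence_iff:
  assumes s: "s \<in> pd_mats" shows "s ** x ** s \<in> pd_mats \<longleftrightarrow> x \<in> pd_mats"
proof
  assume "s ** x ** s \<in> pd_mats"
  from pd_congruence_pd[OF pd_inv[OF s] this] show "x \<in> pd_mats"
    by (simp add: matrix_mul_assoc pd_inv_left[OF s]) (simp add: pd_inv_right[OF s] flip: matrix_mul_assoc)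
qed (use s pd_congruence_pd in blast)

text \<open>The exponent (d+1)/2 of the reference measure is made for this: the density at s x s
  contributes det s to the power -(d+1), which cancels the Jacobian.\<close>

lemma nn_integral_pd_mu_congruence:
  fixes f :: "'n::{finite,wellorder} sqmat \<Rightarrow> ennreal"
  assumes s: "s \<in> pd_mats" and f: "f \<in> borel_measurable pd_borel"
  shows "(\<integral>\<^sup>+x. f (s ** x ** s) \<partial>pd_mu) = (\<integral>\<^sup>+x. f x \<partial>pd_mu)"
proof -
  have "(\<lambda>x. s ** x ** s) \<in> measurable pd_borel pd_borel"
    using s by (auto simp: measurable_pd_borel_iff pd_congruence_iff)
  from measurable_compose[OF this f] have fs: "(\<lambda>x. f (s ** x ** s)) \<in> borel_measurable pd_borel" .
  have w: "ennreal (det s ^ (CARD('n) + 1)) * pd_weight (s ** x ** s) = pd_weight x" for x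
  proof (cases "x \<in> pd_mats")
    case True
    have [simp]: "det s > 0" "det x > 0" using s True by (simp_all add: pd_det_pos)
    have "det (s ** x ** s) powr (- (real CARD('n) + 1) / 2) =
        (det s * det s) powr (- (real CARD('n) + 1) / 2) * det x powr (- (real CARD('n) + 1) / 2)"
      by (simp add: det_mul powr_mult mult_ac flip: powr_mult)
    also have "(det s * det s) powr (- (real CARD('n) + 1) / 2) = det s powr (- (real CARD('n) + 1))"
      by (simp add: powr_mult flip: powr_add)
    finally have "det s ^ (CARD('n) + 1) * det (s ** x ** s) powr (- (real CARD('n) + 1) / 2) =
      (det s powr (real (CARD('n) + 1)) * det s powr (- (real CARD('n) + 1))) * det x powr (- (real CARD('n) + 1) / 2)"
      by (subst powr_realpow) auto
    also have "det s powr (real (CARD('n) + 1)) * det s powr (- (real CARD('n) + 1)) = 1"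
      by (subst powr_add[symmetric]) (simp add: less_imp_neq[OF \<open>det s > 0\<close>, symmetric])
    finally show ?thesis
      using True s ennreal_mult'[of "det s ^ (CARD('n) + 1)" "det (s ** x ** s) powr (- (real CARD('n) + 1) / 2)"]
      by (simp add: pd_weight_def pd_congruence_iff less_imp_le)
  next
    case False
    then show ?thesis using s by (simp add: pd_weight_def pd_congruence_iff)
  qed
  have "(\<integral>\<^sup>+x. f x \<partial>pd_mu) = (\<integral>\<^sup>+x. pd_weight x * f x \<partial>sym_lebesgue)"
    by (rule nn_integral_pd_mu[OF f])
  also have "\<dots> = ennreal (det s ^ (CARD('n) + 1)) * (\<integral>\<^sup>+x. pd_weight (s ** x ** s) * f (s ** x ** s) \<partial>sym_lebesgue)"
    using f by (intro nn_integral_sym_lebesgue_congruence[OF s]) measurable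
  also have "\<dots> = (\<integral>\<^sup>+x. ennreal (det s ^ (CARD('n) + 1)) * (pd_weight (s ** x ** s) * f (s ** x ** s)) \<partial>sym_lebesgue)"
  proof (rule nn_integral_cmult[symmetric])
    have "(\<lambda>x. s ** x ** s) \<in> borel_measurable borel" by measurable
    from measurable_compose[OF this pd_weight_mult_measurable[OF f]]
    show "(\<lambda>x. pd_weight (s ** x ** s) * f (s ** x ** s)) \<in> borel_measurable sym_lebesgue"
      by (subst measurable_cong_sets[OF sets_sym_lebesgue refl])
  qed
  also have "\<dots> = (\<integral>\<^sup>+x. pd_weight x * f (s ** x ** s) \<partial>sym_lebesgue)"
    by (simp only: mult.assoc[symmetric] w)
  also have "\<dots> = (\<integral>\<^sup>+x. f (s ** x ** s) \<partial>pd_mu)"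
    by (rule nn_integral_pd_mu[OF fs, symmetric])
  finally show ?thesis ..
qed

lemma pd_orthogonal_congruence_iff:
  assumes k: "orthogonal_matrix k" shows "k ** x ** transpose k \<in> pd_mats \<longleftrightarrow> x \<in> pd_mats"
proof
  have i: "invertible k" "invertible (transpose k)" using k by (auto simp: orthogonal_matrix_def invertible_def)
  { assume "k ** x ** transpose k \<in> pd_mats"
    from pd_congruence[OF this i(2)] show "x \<in> pd_mats"
      using k by (simp add: matrix_mul_assoc orthogonal_matrix_def)
        (simp add: orthogonal_matrix_def flip: matrix_mul_assoc) }
  show "x \<in> pd_mats \<Longrightarrow> k ** x ** transpose k \<in> pd_mats" using pd_congruence i by blast
qed

lemma det_orthogonal_congruence:
  fixes k :: "real^'n^'n"
  assumes "orthogonal_matrix k" shows "det (k ** x ** transpose k) = det x"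
proof -
  have "det k * det (transpose k) = 1"
    using assms by (metis det_I det_mul orthogonal_matrix_def)
  then show ?thesis by (simp add: det_mul mult.commute mult.left_commute)
qed

lemma nn_integral_pd_mu_orthogonal:
  fixes f :: "'n::{finite,wellorder} sqmat \<Rightarrow> ennreal"
  assumes k: "orthogonal_matrix k" and f: "f \<in> borel_measurable pd_borel"
  shows "(\<integral>\<^sup>+x. f (k ** x ** transpose k) \<partial>pd_mu) = (\<integral>\<^sup>+x. f x \<partial>pd_mu)"
proof -
  have "(\<lambda>x. k ** x ** transpose k) \<in> measurable pd_borel pd_borel"
    using k by (auto simp: measurable_pd_borel_iff pd_orthogonal_congruence_iff)
  from measurable_compose[OF this f] have fs: "(\<lambda>x. f (k ** x ** transpose k)) \<in> borel_measurable pd_borel" .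
  have w: "pd_weight (k ** x ** transpose k) = pd_weight x" for x
    using k by (simp add: pd_weight_def pd_orthogonal_congruence_iff det_orthogonal_congruence indicator_def)
  show ?thesis
    using nn_integral_sym_lebesgue_orthogonal[OF k, of "\<lambda>x. pd_weight x * f x"] f fs
    by (simp add: nn_integral_pd_mu w)
qed

section \<open>Inversion invariance\<close>

lemma matrix_inv_borel_measurable [measurable]: "matrix_inv \<in> borel_measurable pd_borel"
  and pd_sqrt_borel_measurable [measurable]: "pd_sqrt \<in> borel_measurable pd_borel"
  using matrix_inv_measurable pd_sqrt_measurable by (simp_all add: measurable_pd_borel_iff)

lemma emeasure_pd_mu_compact_finite:
  fixes C :: "'n::{finite,wellorder} sqmat set"
  assumes C: "compact C" "C \<subseteq> pd_mats"
  shows "emeasure pd_mu C < \<infinity>"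
proof (cases "C = {}")
  case False
  let ?w = "\<lambda>x :: 'n sqmat. det x powr (- (real CARD('n) + 1) / 2)"
  have "det x \<noteq> 0" if "x \<in> C" for x
    using pd_det_pos[OF subsetD[OF C(2) that]] by simp
  then have "continuous_on C ?w"
    by (intro continuous_on_powr continuous_on_det continuous_on_id continuous_on_const) auto
  then have "\<exists>x0\<in>C. \<forall>x\<in>C. ?w x \<le> ?w x0"
    by (rule continuous_attains_sup[OF C(1) False])
  then obtain x0 where x0: "\<forall>x\<in>C. ?w x \<le> ?w x0" by (rule bexE)
  have "\<exists>r. \<forall>x\<in>C. norm x \<le> r" using compact_imp_bounded[OF C(1)] by (simp add: bounded_iff)
  then obtain r where r: "C \<subseteq> cball 0 r" by (auto simp: dist_norm subset_iff)
  have Cm: "C \<in> sets pd_borel" using C by (simp add: sets_pd_borel_iff borel_compact)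
  have "emeasure pd_mu C = (\<integral>\<^sup>+x. indicator C x \<partial>pd_mu)" using Cm by simp
  also have "\<dots> = (\<integral>\<^sup>+x. pd_weight x * indicator C x \<partial>sym_lebesgue)"
    using Cm by (intro nn_integral_pd_mu borel_measurable_indicator)
  also have "\<dots> \<le> (\<integral>\<^sup>+x. ennreal (?w x0) * indicator (cball 0 r) (x :: 'n sqmat) \<partial>sym_lebesgue)"
  proof (rule nn_integral_mono)
    fix x :: "'n sqmat"
    show "pd_weight x * indicator C x \<le> ennreal (?w x0) * indicator (cball 0 r) x"
      using x0 r C(2) by (cases "x \<in> C") (auto simp: pd_weight_def subset_iff intro!: ennreal_leI)
  qed
  also have "\<dots> = ennreal (?w x0) * emeasure sym_lebesgue (cball (0 :: 'n sqmat) r)"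
    by (rule nn_integral_cmult_indicator) simp
  also have "\<dots> < \<infinity>"
    using emeasure_sym_lebesgue_cball_finite[where 'n='n, of r] by (simp add: ennreal_mult_less_top)
  finally show ?thesis .
qed simp

lemma sigma_finite_pd_mu: "sigma_finite_measure pd_mu"
proof
  show "\<exists>A. countable A \<and> A \<subseteq> sets pd_mu \<and> \<Union>A = space pd_mu \<and> (\<forall>a\<in>A. emeasure pd_mu a \<noteq> \<infinity>)"
    using emeasure_pd_mu_compact_finite[OF compact_pd_level pd_level_subset]
    by (intro exI[of _ "range pd_level"])
      (auto simp: sets_pd_borel_iff borel_compact compact_pd_level pd_level_Union less_top
        dest: pd_level_subset[THEN subsetD])
qed

interpretation pd_mu: sigma_finite_measure pd_mu by (rule sigma_finite_pd_mu)
interpretation pd_mu: pair_sigma_finite pd_mu pd_mu ..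

text \<open>For symmetric a, the squared distance to the identity is tr (a^2) - 2 tr a + tr I, and
  the two Gram matrices of g have equal traces and equal traces of squares.\<close>

lemma norm_gram_diff:
  fixes g :: "real^'n^'n"
  shows "norm (g ** transpose g - mat 1) = norm (transpose g ** g - mat 1)"
proof -
  have *: "(norm (a - mat 1))\<^sup>2 = trace (a ** a) - 2 * trace a + trace (mat 1 :: real^'n^'n)"
    if "transpose a = a" for a :: "real^'n^'n"
  proof -
    have "(a - mat 1) ** transpose (a - mat 1) = (a ** a - a) - (a - mat 1)"
      unfolding transpose_diff that transpose_mat matrix_mult_diff_ldistrib matrix_mult_diff_rdistrib
        matrix_mul_lid matrix_mul_rid by (rule refl)
    then show ?thesis unfolding norm_matrix_eq_trace by (simp only: trace_sub)
  qed
  have "trace (g ** transpose g ** (g ** transpose g)) = trace (transpose g ** g ** (transpose g ** g))"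
    by (metis matrix_mul_assoc trace_mul_sym)
  moreover have "trace (g ** transpose g) = trace (transpose g ** g)" by (rule trace_mul_sym)
  ultimately have "(norm (g ** transpose g - mat 1))\<^sup>2 = (norm (transpose g ** g - mat 1))\<^sup>2"
    by (simp add: * matrix_transpose_mul)
  then show ?thesis by simp
qed

lemma matrix_inv_congruence:
  assumes "s \<in> pd_mats" "x \<in> pd_mats"
  shows "matrix_inv (s ** x ** s) = matrix_inv s ** matrix_inv x ** matrix_inv s"
proof (rule matrix_inv_eqI)
  have "s ** x ** s ** (matrix_inv s ** matrix_inv x ** matrix_inv s)
    = s ** x ** (s ** matrix_inv s) ** matrix_inv x ** matrix_inv s"
    by (simp add: matrix_mul_assoc)
  also have "\<dots> = s ** (x ** matrix_inv x) ** matrix_inv s"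
    by (simp only: pd_inv_right[OF assms(1)] matrix_mul_rid matrix_mul_assoc)
  also have "\<dots> = mat 1" by (simp only: pd_inv_right[OF assms(1)] pd_inv_right[OF assms(2)] matrix_mul_rid)
  finally show "s ** x ** s ** (matrix_inv s ** matrix_inv x ** matrix_inv s) = mat 1" .
qed

lemma pd_inv_sqrt_mult: 
  assumes "x \<in> pd_mats"
  shows "matrix_inv (pd_sqrt x) ** matrix_inv (pd_sqrt x) = matrix_inv x"
  using matrix_inv_congruence[OF pd_sqrt_pd[OF assms] mat_1_pd] assms
  by (simp add: pd_sqrt_mult matrix_inv_eqI)

text \<open>A test set near the identity, described through the inverse because the comparison with
  the image of \<mu> under inversion evaluates the inverse of the second variable. Its measure is a
  common factor of both sides, cancelled once it is known to be positive and finite.\<close>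

definition inv_nbhd :: "real \<Rightarrow> 'n::{finite,wellorder} sqmat set" where
  "inv_nbhd e = {z \<in> pd_mats. norm (matrix_inv z - mat 1) \<le> e}"

lemma inv_nbhd_measurable [measurable]: "inv_nbhd e \<in> sets pd_borel"
proof -
  have "{z \<in> space pd_borel. norm (matrix_inv z - mat 1) \<le> e} \<in> sets pd_borel" by measurable
  then show ?thesis by (simp add: inv_nbhd_def)
qed

lemma norm_matrix_vector_mult_le:
  fixes A :: "real^'n^'m"
  shows "norm (A *v v) \<le> norm A * norm v"
proof -
  have "norm (A *v v) \<le> L2_set (\<lambda>i. norm (A $ i) * norm v) UNIV"
    unfolding norm_vec_def[of "A *v v"]
    by (intro L2_set_mono) (simp_all add: matrix_vector_mul_component Cauchy_Schwarz_ineq2)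
  also have "\<dots> = norm A * norm v"
    unfolding norm_vec_def[of A] by (simp add: L2_set_left_distrib)
  finally show ?thesis .
qed

lemma symmetric_nbhd_pd:
  fixes y :: "'n::{finite,wellorder} sqmat"
  assumes "transpose y = y" "norm (y - mat 1) < 1"
  shows "y \<in> pd_mats"
proof -
  have "v \<bullet> (y *v v) > 0" if "v \<noteq> 0" for v
  proof -
    have "\<bar>v \<bullet> ((y - mat 1) *v v)\<bar> \<le> norm v * norm ((y - mat 1) *v v)"
      by (rule Cauchy_Schwarz_ineq2)
    also have "\<dots> \<le> norm v * (norm (y - mat 1) * norm v)"
      by (intro mult_left_mono norm_matrix_vector_mult_le) simp
    also have "\<dots> = norm (y - mat 1) * (v \<bullet> v)"
      by (simp add: power2_norm_eq_inner[symmetric] power2_eq_square)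
    also have "\<dots> < v \<bullet> v" using assms(2) that by simp
    finally have "\<bar>v \<bullet> ((y - mat 1) *v v)\<bar> < v \<bullet> v" .
    then show ?thesis
      by (simp add: matrix_vector_mult_diff_rdistrib inner_diff_right abs_less_iff)
  qed
  then show ?thesis using assms(1) by (simp add: pd_mats_def)
qed

definition id_nbhd :: "real \<Rightarrow> 'n::{finite,wellorder} sqmat set" where
  "id_nbhd e = {y. transpose y = y \<and> norm (y - mat 1) \<le> e}"

lemma id_nbhd_compact: "compact (id_nbhd e)"
proof -
  have "closed (id_nbhd e)"
    unfolding id_nbhd_def Collect_conj_eq
    by (intro closed_Int closed_Collect_eq closed_Collect_le continuous_intros)
  moreover have "id_nbhd e \<subseteq> cball (mat 1) e"
    by (auto simp: id_nbhd_def dist_norm norm_minus_commute)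
  ultimately show ?thesis
    by (meson bounded_cball bounded_subset compact_eq_bounded_closed)
qed

lemma id_nbhd_subset: "e < 1 \<Longrightarrow> id_nbhd e \<subseteq> pd_mats"
  by (auto simp: id_nbhd_def intro!: symmetric_nbhd_pd)

text \<open>The density of \<open>pd_mu\<close> is positive on the cone, so the set would also be
  null for \<open>sym_lebesgue\<close>; but among symmetric matrices it is a ball around 0
  translated to the identity.\<close>

lemma emeasure_pd_mu_id_nbhd_pos:
  assumes e: "0 < e" "e < 1"
  shows "emeasure pd_mu (id_nbhd e :: 'n::{finite,wellorder} sqmat set) \<noteq> 0"
proof
  let ?L = "sym_lebesgue :: 'n sqmat measure"
  let ?E = "id_nbhd e :: 'n sqmat set"
  have Eb[measurable]: "?E \<in> sets borel" by (rule borel_compact[OF id_nbhd_compact])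
  have Em: "?E \<in> sets pd_borel" using id_nbhd_subset[OF e(2)] Eb by (simp add: sets_pd_borel_iff)
  have ind[measurable]: "indicator ?E \<in> borel_measurable pd_borel" by (rule borel_measurable_indicator[OF Em])
  assume "emeasure pd_mu ?E = 0"
  then have "(\<integral>\<^sup>+x. indicator ?E x \<partial>pd_mu) = 0" using Em by simp
  then have "(\<integral>\<^sup>+x. pd_weight x * indicator ?E x \<partial>?L) = 0" by (simp only: nn_integral_pd_mu[OF ind])
  moreover have m: "(\<lambda>x. pd_weight x * indicator ?E x) \<in> borel_measurable ?L"
    by (subst measurable_cong_sets[OF sets_sym_lebesgue refl]) measurable
  ultimately have "AE x in ?L. pd_weight x * indicator ?E x = 0"
    by (simp only: nn_integral_0_iff_AE)
  then have "AE x in ?L. x \<notin> ?E"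
  proof (rule AE_mp, intro AE_I2 impI notI)
    fix x assume x: "pd_weight x * indicator ?E x = 0" "x \<in> ?E"
    then have "x \<in> pd_mats" using id_nbhd_subset[OF e(2)] by blast
    then show False using x pd_det_pos[of x] by (simp add: pd_weight_def)
  qed
  moreover have "indicator ?E \<in> borel_measurable ?L" by (rule borel_measurable_indicator) (simp add: Eb)
  ultimately have z: "(\<integral>\<^sup>+x. indicator ?E x \<partial>?L) = 0"
    by (subst nn_integral_0_iff_AE) (auto elim!: eventually_mono)
  have "emeasure ?L (cball 0 e) = (\<integral>\<^sup>+x. indicator (cball 0 e) x \<partial>?L)" by simp
  also have "\<dots> = (\<integral>\<^sup>+x. indicator ?E (x + mat 1) \<partial>?L)"
    using AE_sym_lebesgue
    by (intro nn_integral_cong_AE, eventually_elim)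
      (auto simp: indicator_def id_nbhd_def dist_norm transpose_add)
  also have "\<dots> = (\<integral>\<^sup>+x. indicator ?E x \<partial>?L)"
    by (rule nn_integral_sym_lebesgue_translate) auto
  finally show False using z emeasure_sym_lebesgue_cball_pos[OF e(1), where 'n='n] by simp
qed

lemma inv_nbhd_eq: "e < 1 \<Longrightarrow> inv_nbhd e = matrix_inv ` id_nbhd e"
proof (intro set_eqI iffI)
  fix z :: "'n::{finite,wellorder} sqmat" assume e: "e < 1"
  { assume "z \<in> inv_nbhd e"
    then have "matrix_inv z \<in> id_nbhd e" "z = matrix_inv (matrix_inv z)"
      by (simp_all add: inv_nbhd_def id_nbhd_def pd_symmetric pd_inv matrix_inv_matrix_inv)
    then show "z \<in> matrix_inv ` id_nbhd e" by blast }
  { assume "z \<in> matrix_inv ` id_nbhd e"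
    then obtain y where y: "y \<in> id_nbhd e" "z = matrix_inv y" by blast
    then have "y \<in> pd_mats" using id_nbhd_subset[OF e] by blast
    then show "z \<in> inv_nbhd e" using y by (simp add: inv_nbhd_def id_nbhd_def pd_inv matrix_inv_matrix_inv) }
qed

text \<open>Finite because the set is the image of a compact subset of the cone under inversion;
  nonzero because, by continuity of inversion at the identity, it contains some
  \<open>id_nbhd r\<close>.\<close>

lemma emeasure_inv_nbhd:
  assumes e: "0 < e" "e < 1"
  shows "emeasure pd_mu (inv_nbhd e :: 'n::{finite,wellorder} sqmat set) \<noteq> 0"
    and "emeasure pd_mu (inv_nbhd e :: 'n sqmat set) \<noteq> \<top>"
proof -
  let ?E = "inv_nbhd e :: 'n sqmat set"
  have cont: "continuous_on pd_mats (\<lambda>x :: 'n sqmat. matrix_inv x)"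
    by (intro continuous_intros pd_invertible)
  have "compact ?E"
    unfolding inv_nbhd_eq[OF e(2)]
    by (intro compact_continuous_image id_nbhd_compact continuous_on_subset[OF cont] id_nbhd_subset e)
  moreover have "?E \<subseteq> pd_mats" by (auto simp: inv_nbhd_def)
  ultimately show "emeasure pd_mu ?E \<noteq> \<top>" using emeasure_pd_mu_compact_finite by fastforce
  have "matrix_inv (mat 1) = (mat 1 :: 'n sqmat)" by (rule matrix_inv_eqI) simp
  then obtain d where d: "d > 0" "\<And>x :: 'n sqmat. x \<in> pd_mats \<Longrightarrow> dist x (mat 1) < d \<Longrightarrow> dist (matrix_inv x) (mat 1) < e"
    using cont[unfolded continuous_on_iff, rule_format, OF mat_1_pd e(1)] by auto
  define r where "r = min (d / 2) (1 / 2)"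
  have r: "0 < r" "r < 1" "r < d" using d(1) by (auto simp: r_def min_def)
  have "id_nbhd r \<subseteq> ?E"
  proof
    fix x :: "'n sqmat" assume x: "x \<in> id_nbhd r"
    then have xp: "x \<in> pd_mats" using id_nbhd_subset[OF r(2)] by blast
    then have "dist (matrix_inv x) (mat 1) < e" using x r(3) by (intro d) (auto simp: id_nbhd_def dist_norm)
    then show "x \<in> ?E" using xp by (simp add: inv_nbhd_def dist_norm)
  qed
  then have "emeasure pd_mu (id_nbhd r :: 'n sqmat set) \<le> emeasure pd_mu ?E"
    by (rule emeasure_mono) simp
  then show "emeasure pd_mu ?E \<noteq> 0" using emeasure_pd_mu_id_nbhd_pos[OF r(1,2), where 'n='n] by auto
qed

lemma sqrt_congruence_inverse: "x \<in> pd_mats \<Longrightarrow> matrix_inv (pd_sqrt x) ** x ** matrix_inv (pd_sqrt x) = mat 1"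
  using pd_sqrt_mult[of x] pd_inv_left[OF pd_sqrt_pd, of x] pd_inv_right[OF pd_sqrt_pd, of x]
  by (metis matrix_mul_assoc matrix_mul_rid)

lemma sqrt_conj_cancel:
  assumes "x \<in> pd_mats"
  shows "pd_sqrt x ** (matrix_inv (pd_sqrt x) ** y ** matrix_inv (pd_sqrt x)) ** pd_sqrt x = y"
    and "matrix_inv (pd_sqrt x) ** (pd_sqrt x ** y ** pd_sqrt x) ** matrix_inv (pd_sqrt x) = y"
  using pd_inv_left[OF pd_sqrt_pd, of x] pd_inv_right[OF pd_sqrt_pd, of x] assms
  by (metis matrix_mul_assoc matrix_mul_lid matrix_mul_rid)+

lemma trace_eq_norm_sqrt: "x \<in> pd_mats \<Longrightarrow> trace x = (norm (pd_sqrt x))\<^sup>2"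
  by (simp add: norm_matrix_eq_trace pd_symmetric pd_sqrt_pd pd_sqrt_mult)

lemma norm_sqrt_congruence_le:
  assumes "x \<in> pd_mats" shows "norm (pd_sqrt x ** y ** pd_sqrt x) \<le> trace x * norm y"
proof -
  have "norm (pd_sqrt x ** y ** pd_sqrt x) \<le> norm (pd_sqrt x) * norm y * norm (pd_sqrt x)"
    by (meson norm_matrix_mult_le mult_right_mono norm_ge_zero order_trans)
  then show ?thesis by (simp add: trace_eq_norm_sqrt[OF assms] power2_eq_square mult_ac)
qed

text \<open>Let \<open>\<nu>\<close> be the image of \<open>\<mu>\<close> under inversion. Both measures are congruence invariant, so integrating
  over pairs \<open>(x, y)\<close> with \<open>x \<in> K\<close> and \<open>x\<^bsup>-1/2\<^esup> y x\<^bsup>-1/2\<^esup>\<close> within \<open>e\<close> of \<open>I\<close> in either order compares \<open>\<mu>(K)\<close> with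
  the \<open>\<nu>\<close>-measure of a neighbourhood of \<open>K\<close>. The Frobenius distance to \<open>I\<close> is the same for
  \<open>x\<^bsup>-1/2\<^esup> y x\<^bsup>-1/2\<^esup>\<close> and \<open>y\<^bsup>1/2\<^esup> x\<^bsup>-1\<^esup> y\<^bsup>1/2\<^esup>\<close>.\<close>

lemma emeasure_pd_mu_le_inverse_nbhd:
  fixes K :: "'n::{finite,wellorder} sqmat set"
  assumes K: "compact K" "K \<subseteq> pd_mats" and tr: "\<And>x. x \<in> K \<Longrightarrow> trace x \<le> C" and e: "0 < e" "e < 1"
  shows "emeasure pd_mu K \<le> emeasure pd_mu {z \<in> pd_mats. infdist (matrix_inv z) K \<le> C * e}"
proof -
  let ?mu = "pd_mu :: 'n sqmat measure"
  let ?D = "{z \<in> pd_mats. infdist (matrix_inv z) K \<le> C * e}"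
  let ?H = "inv_nbhd e :: 'n sqmat set"
  let ?q = "\<lambda>x z. norm (matrix_inv (pd_sqrt x) ** matrix_inv z ** matrix_inv (pd_sqrt x) - mat 1)"
  let ?h = "\<lambda>x z. indicator {..e} (?q x z) :: ennreal"
  have Km[measurable]: "K \<in> sets pd_borel" using K by (simp add: sets_pd_borel_iff borel_compact)
  have Dm[measurable]: "?D \<in> sets pd_borel"
  proof -
    have [measurable]: "(\<lambda>z. infdist (matrix_inv z) K) \<in> borel_measurable pd_borel"
      by (rule measurable_compose[OF matrix_inv_borel_measurable borel_measurable_continuous_onI])
        (intro continuous_intros)
    have "{z \<in> space pd_borel. infdist (matrix_inv z) K \<le> C * e} \<in> sets pd_borel" by measurable
    then show ?thesis by simp
  qed
  have ind_H: "indicator {..e} (norm (matrix_inv z - mat 1)) = (indicator ?H z :: ennreal)" if "z \<in> pd_mats" for z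
    using that by (simp add: inv_nbhd_def indicator_def)
  have m: "(\<lambda>z. indicator ?H z :: ennreal) \<in> borel_measurable pd_borel" by measurable
  have 1: "(\<integral>\<^sup>+z. ?h x z \<partial>?mu) = emeasure ?mu ?H" if x: "x \<in> pd_mats" for x
  proof -
    have "?h x z = indicator ?H (pd_sqrt x ** z ** pd_sqrt x)" if z: "z \<in> pd_mats" for z
      using ind_H[of "pd_sqrt x ** z ** pd_sqrt x"] x z
      by (simp add: matrix_inv_congruence pd_sqrt_pd pd_congruence_pd)
    then have "(\<integral>\<^sup>+z. ?h x z \<partial>?mu) = (\<integral>\<^sup>+z. indicator ?H (pd_sqrt x ** z ** pd_sqrt x) \<partial>?mu)"
      by (intro nn_integral_cong) simp
    also have "\<dots> = (\<integral>\<^sup>+z. indicator ?H z \<partial>?mu)"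
      by (rule nn_integral_pd_mu_congruence[OF pd_sqrt_pd[OF x] m])
    finally show ?thesis by simp
  qed
  \<comment> \<open>Both matrices are Gram products of g = x^(-1/2) z^(-1/2), taken in the two
    orders, so \<open>norm_gram_diff\<close> applies.\<close>
  have sym: "?q x z = norm (matrix_inv (pd_sqrt z ** x ** pd_sqrt z) - mat 1)" if x: "x \<in> pd_mats" and z: "z \<in> pd_mats" for x z
  proof -
    let ?a = "matrix_inv (pd_sqrt x)" and ?b = "matrix_inv (pd_sqrt z)"
    have t: "transpose ?a = ?a" "transpose ?b = ?b" using x z by (simp_all add: pd_symmetric pd_inv pd_sqrt_pd)
    have "?a ** ?b ** transpose (?a ** ?b) = ?a ** (?b ** ?b) ** ?a"
      by (simp add: matrix_transpose_mul t matrix_mul_assoc)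
    then have "?a ** ?b ** transpose (?a ** ?b) = ?a ** matrix_inv z ** ?a"
      by (simp add: pd_inv_sqrt_mult z)
    moreover have "transpose (?a ** ?b) ** (?a ** ?b) = ?b ** (?a ** ?a) ** ?b"
      by (simp add: matrix_transpose_mul t matrix_mul_assoc)
    then have "transpose (?a ** ?b) ** (?a ** ?b) = matrix_inv (pd_sqrt z ** x ** pd_sqrt z)"
      by (simp add: pd_inv_sqrt_mult x z matrix_inv_congruence pd_sqrt_pd)
    ultimately show ?thesis using norm_gram_diff[of "?a ** ?b"] by simp
  qed
  have 2: "(\<integral>\<^sup>+x. ?h x z \<partial>?mu) = emeasure ?mu ?H" if z: "z \<in> pd_mats" for z
  proof -
    have "?h x z = indicator ?H (pd_sqrt z ** x ** pd_sqrt z)" if x: "x \<in> pd_mats" for x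
      using ind_H[of "pd_sqrt z ** x ** pd_sqrt z"] x z
      by (simp add: sym pd_sqrt_pd pd_congruence_pd)
    then have "(\<integral>\<^sup>+x. ?h x z \<partial>?mu) = (\<integral>\<^sup>+x. indicator ?H (pd_sqrt z ** x ** pd_sqrt z) \<partial>?mu)"
      by (intro nn_integral_cong) simp
    also have "\<dots> = (\<integral>\<^sup>+x. indicator ?H x \<partial>?mu)"
      by (rule nn_integral_pd_mu_congruence[OF pd_sqrt_pd[OF z] m])
    finally show ?thesis by simp
  qed
  \<comment> \<open>If x is in K and x^(-1/2) z^(-1) x^(-1/2) is within e of I, then conjugating
    back by x^(1/2) puts z^(-1) within e times the trace of x, hence within C e, of x.\<close>
  have le: "indicator K x * ?h x z \<le> indicator ?D z * ?h x z" if x: "x \<in> pd_mats" and z: "z \<in> pd_mats" for x z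
  proof (cases "x \<in> K \<and> ?q x z \<le> e")
    case True
    let ?a = "matrix_inv (pd_sqrt x)"
    have "pd_sqrt x ** (?a ** matrix_inv z ** ?a - mat 1) ** pd_sqrt x = matrix_inv z - x"
      by (simp only: matrix_mult_diff_ldistrib matrix_mult_diff_rdistrib sqrt_conj_cancel[OF x]
          matrix_mul_rid pd_sqrt_mult[OF x])
    then have "norm (matrix_inv z - x) \<le> trace x * ?q x z"
      using norm_sqrt_congruence_le[OF x] by metis
    also have "\<dots> \<le> C * e"
      using True tr[of x] pd_trace_nonneg[OF x] by (intro mult_mono) auto
    finally have "infdist (matrix_inv z) K \<le> C * e"
      using infdist_le[of x K "matrix_inv z"] True by (simp add: dist_norm)
    then show ?thesis using True z by simp
  next
    case False
    then show ?thesis by (auto simp: indicator_def)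
  qed
  have meas[measurable]: "(\<lambda>(x, z). ?h x z) \<in> borel_measurable (?mu \<Otimes>\<^sub>M ?mu)"
    by measurable
  have "emeasure ?mu K * emeasure ?mu ?H = (\<integral>\<^sup>+x. indicator K x * emeasure ?mu ?H \<partial>?mu)"
    by (simp add: nn_integral_multc)
  also have "\<dots> = (\<integral>\<^sup>+x. (\<integral>\<^sup>+z. indicator K x * ?h x z \<partial>?mu) \<partial>?mu)"
    by (intro nn_integral_cong) (simp add: 1 nn_integral_cmult)
  also have "\<dots> \<le> (\<integral>\<^sup>+x. (\<integral>\<^sup>+z. indicator ?D z * ?h x z \<partial>?mu) \<partial>?mu)"
    by (intro nn_integral_mono le) auto
  also have "\<dots> = (\<integral>\<^sup>+z. (\<integral>\<^sup>+x. indicator ?D z * ?h x z \<partial>?mu) \<partial>?mu)"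
    by (rule pd_mu.Fubini'[symmetric]) measurable
  also have "\<dots> = (\<integral>\<^sup>+z. indicator ?D z * emeasure ?mu ?H \<partial>?mu)"
    by (intro nn_integral_cong) (simp add: 2 nn_integral_cmult)
  also have "\<dots> = emeasure ?mu ?D * emeasure ?mu ?H"
    by (simp add: nn_integral_multc)
  finally have "emeasure ?mu ?H * emeasure ?mu K \<le> emeasure ?mu ?H * emeasure ?mu ?D"
    by (simp add: mult.commute)
  then show ?thesis
    using emeasure_inv_nbhd[OF e, where 'n='n] by (simp add: ennreal_mult_le_mult_iff)
qed

text \<open>On K the quadratic form is at least 1/(n+1); a perturbation by half of this leaves
  1/(2n+2), the bound of level 2n+1. Small neighbourhoods of K thus stay in one compact subset of
  the cone.\<close>

lemma infdist_pd_level: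
  fixes K :: "'n::{finite,wellorder} sqmat set"
  assumes K: "compact K" "K \<noteq> {}" "K \<subseteq> pd_level n"
    and y: "y \<in> pd_mats" "infdist y K \<le> 1 / (2 * real (Suc n))"
  shows "y \<in> pd_level (2 * n + 1)"
proof -
  obtain x where x: "x \<in> K" "infdist y K = dist y x"
    using infdist_attains_inf[OF compact_imp_closed[OF K(1)] K(2)] by blast
  define d where "d = norm (y - x)"
  have d: "d \<le> 1 / (2 * real (Suc n))" using y(2) x(2) by (simp add: d_def dist_norm)
  have xl: "x \<in> pd_level n" using x K by blast
  have "inverse (real (Suc (2 * n + 1))) * (v \<bullet> v) \<le> v \<bullet> (y *v v)" for v
  proof -
    have "\<bar>v \<bullet> ((y - x) *v v)\<bar> \<le> norm v * norm ((y - x) *v v)"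
      by (rule Cauchy_Schwarz_ineq2)
    also have "\<dots> \<le> norm v * (norm (y - x) * norm v)"
      by (intro mult_left_mono norm_matrix_vector_mult_le) simp
    also have "\<dots> = d * (v \<bullet> v)"
      by (simp add: d_def power2_norm_eq_inner[symmetric] power2_eq_square)
    also have "\<dots> \<le> 1 / (2 * real (Suc n)) * (v \<bullet> v)"
      by (intro mult_right_mono d) simp
    finally have 1: "\<bar>v \<bullet> ((y - x) *v v)\<bar> \<le> 1 / (2 * real (Suc n)) * (v \<bullet> v)" .
    have 2: "inverse (real (Suc n)) * (v \<bullet> v) \<le> v \<bullet> (x *v v)" using xl by (simp add: pd_level_def)
    have 3: "v \<bullet> (y *v v) = v \<bullet> (x *v v) + v \<bullet> ((y - x) *v v)"
      by (simp add: matrix_vector_mult_diff_rdistrib inner_diff_right)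
    have "inverse (real (Suc (2 * n + 1))) = inverse (real (Suc n)) - 1 / (2 * real (Suc n))"
      by (simp add: field_simps)
    then have "inverse (real (Suc (2 * n + 1))) * (v \<bullet> v)
        = inverse (real (Suc n)) * (v \<bullet> v) - 1 / (2 * real (Suc n)) * (v \<bullet> v)"
      by (simp only: left_diff_distrib)
    then show ?thesis using 1 2 3 by linarith
  qed
  moreover have "norm y \<le> real (2 * n + 1)"
  proof -
    have "1 / (2 * real (Suc n)) \<le> 1" by (simp add: field_simps)
    then have "d \<le> 1" using d by linarith
    moreover have "norm y \<le> norm x + d" unfolding d_def by (metis add.commute diff_add_cancel norm_triangle_ineq)
    ultimately show ?thesis using xl by (simp add: pd_level_def)
  qed
  ultimately show ?thesis using y(1) by (simp add: pd_level_def pd_symmetric)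
qed

text \<open>The limit e to 0 in \<open>emeasure_pd_mu_le_inverse_nbhd\<close>: the neighbourhoods
  decrease to the preimage of K because K is closed. The finite measure required by continuity from
  above comes from \<open>infdist_pd_level\<close>.\<close>

lemma emeasure_pd_mu_le_inverse:
  fixes K :: "'n::{finite,wellorder} sqmat set"
  assumes K: "compact K" "K \<subseteq> pd_mats"
  shows "emeasure pd_mu K \<le> emeasure pd_mu {z \<in> pd_mats. matrix_inv z \<in> K}"
proof (cases "K = {}")
  case False
  let ?mu = "pd_mu :: 'n sqmat measure"
  obtain n where n: "K \<subseteq> pd_level n" using compact_subset_pd_level[OF K] by blast
  have "continuous_on K (\<lambda>x. trace x)" by (intro continuous_intros)
  then have "\<exists>x0\<in>K. \<forall>x\<in>K. trace x \<le> trace x0" by (rule continuous_attains_sup[OF K(1) False])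
  then obtain x0 where x0: "x0 \<in> K" "\<forall>x\<in>K. trace x \<le> trace x0" by (rule bexE)
  define C where "C = trace x0 + 1"
  have C: "C > 0" using pd_trace_nonneg[of x0] x0 K by (auto simp: C_def)
  have tr: "trace x \<le> C" if "x \<in> K" for x using x0 that by (auto simp: C_def intro: order_trans)
  \<comment> \<open>Chosen so that C c is at most the radius 1/(2(n+1)) allowed by
    \<open>infdist_pd_level\<close> and so that c < 1.\<close>
  define c where "c = 1 / (2 * real (Suc n) * (C + 1))"
  define e where "e k = inverse (real (Suc k)) * c" for k
  have c0: "c > 0" using C by (auto simp: c_def)
  have "1 * 1 < 2 * real (Suc n) * (C + 1)" using C by (intro mult_strict_mono) auto
  then have c1: "c < 1" using C by (simp add: c_def del: of_nat_Suc)
  have c2: "C * c \<le> 1 / (2 * real (Suc n))"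
  proof -
    have "C * c = (C / (C + 1)) * (1 / (2 * real (Suc n)))" by (simp add: c_def mult.commute)
    also have "\<dots> \<le> 1 * (1 / (2 * real (Suc n)))" using C by (intro mult_right_mono) auto
    finally show ?thesis by simp
  qed
  have e_c: "e k \<le> c" for k
  proof -
    have "inverse (real (Suc k)) \<le> 1" by (simp add: field_simps)
    then show ?thesis using mult_right_mono[of "inverse (real (Suc k))" 1 c] c0 by (simp add: e_def)
  qed
  have e: "0 < e k" "e k < 1" "C * e k \<le> 1 / (2 * real (Suc n))" for k
  proof -
    show "0 < e k" using c0 by (simp add: e_def)
    show "e k < 1" using e_c[of k] c1 by simp
    show "C * e k \<le> 1 / (2 * real (Suc n))"
      using mult_left_mono[OF e_c[of k], of C] C c2 by linarith
  qed
  have e_dec: "e l \<le> e k" if "k \<le> l" for k l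
    unfolding e_def using c0 that by (intro mult_right_mono le_imp_inverse_le) auto
  have "e \<longlonglongrightarrow> 0 * c"
    unfolding e_def by (intro tendsto_mult LIMSEQ_inverse_real_of_nat tendsto_const)
  then have e_lim: "e \<longlonglongrightarrow> 0" by simp
  define D where "D k = {z \<in> pd_mats. infdist (matrix_inv z) K \<le> C * e k}" for k
  have Dm: "D k \<in> sets ?mu" for k
  proof -
    have [measurable]: "(\<lambda>z. infdist (matrix_inv z) K) \<in> borel_measurable pd_borel"
      by (rule measurable_compose[OF matrix_inv_borel_measurable borel_measurable_continuous_onI])
        (intro continuous_intros)
    have "{z \<in> space pd_borel. infdist (matrix_inv z) K \<le> C * e k} \<in> sets pd_borel" by measurable
    then show ?thesis by (simp add: D_def)
  qed
  have dec: "decseq D"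
  proof (rule antimonoI)
    fix k l :: nat assume "k \<le> l"
    then have "C * e l \<le> C * e k" using C e_dec by (simp add: mult_left_mono)
    then show "D l \<subseteq> D k" by (auto simp: D_def)
  qed
  have fin: "emeasure ?mu (D k) \<noteq> \<infinity>" for k
  proof -
    let ?Q = "matrix_inv ` (pd_level (2 * n + 1) :: 'n sqmat set)"
    have "D k \<subseteq> ?Q"
    proof
      fix z assume z: "z \<in> D k"
      then have zp: "z \<in> pd_mats" by (simp add: D_def)
      have "infdist (matrix_inv z) K \<le> 1 / (2 * real (Suc n))" using z e(3)[of k] by (simp add: D_def)
      then have "matrix_inv z \<in> pd_level (2 * n + 1)"
        by (rule infdist_pd_level[OF K(1) False n pd_inv[OF zp]])
      then show "z \<in> ?Q" using matrix_inv_matrix_inv[OF zp] by force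
    qed
    moreover have Q: "compact ?Q" "?Q \<subseteq> pd_mats"
      using pd_level_subset by (auto intro!: compact_continuous_image compact_pd_level continuous_intros pd_invertible pd_inv)
    ultimately have "emeasure ?mu (D k) \<le> emeasure ?mu ?Q"
      by (intro emeasure_mono) (auto simp: sets_pd_borel_iff borel_compact)
    then show ?thesis using emeasure_pd_mu_compact_finite[OF Q] by auto
  qed
  have "(\<Inter>k. D k) = {z \<in> pd_mats. matrix_inv z \<in> K}"
  proof (intro set_eqI iffI)
    fix z assume "z \<in> (\<Inter>k. D k)"
    then have z: "z \<in> pd_mats" "\<And>k. infdist (matrix_inv z) K \<le> C * e k" by (auto simp: D_def)
    have "(\<lambda>k. C * e k) \<longlonglongrightarrow> C * 0" by (intro tendsto_intros e_lim)
    then have "infdist (matrix_inv z) K \<le> C * 0"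
      using z(2) by (intro LIMSEQ_le_const) auto
    then have "infdist (matrix_inv z) K = 0" using infdist_nonneg[of "matrix_inv z" K] by simp
    then show "z \<in> {z \<in> pd_mats. matrix_inv z \<in> K}"
      using z(1) in_closed_iff_infdist_zero[OF compact_imp_closed[OF K(1)] False] by simp
  qed (use C e(1) in \<open>auto simp: D_def intro!: mult_nonneg_nonneg less_imp_le\<close>)
  then have "(\<lambda>k. emeasure ?mu (D k)) \<longlonglongrightarrow> emeasure ?mu {z \<in> pd_mats. matrix_inv z \<in> K}"
    using Lim_emeasure_decseq[of D ?mu] Dm dec fin by auto
  moreover have "emeasure ?mu K \<le> emeasure ?mu (D k)" for k
    unfolding D_def by (rule emeasure_pd_mu_le_inverse_nbhd[OF K tr e(1,2)])
  ultimately show ?thesis by (intro LIMSEQ_le_const) auto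
qed simp

text \<open>Inversion is an involution, so the inequality for the image of K under inversion is the
  reverse inequality for K.\<close>

lemma emeasure_pd_mu_inverse_compact:
  fixes K :: "'n::{finite,wellorder} sqmat set"
  assumes K: "compact K" "K \<subseteq> pd_mats"
  shows "emeasure pd_mu {z \<in> pd_mats. matrix_inv z \<in> K} = emeasure pd_mu K"
proof (rule antisym)
  have eq: "{z \<in> pd_mats. matrix_inv z \<in> K} = matrix_inv ` K"
    using K(2) by (force simp: matrix_inv_matrix_inv pd_inv)
  have K': "compact (matrix_inv ` K)" "matrix_inv ` K \<subseteq> pd_mats"
    using K by (auto intro!: compact_continuous_image continuous_intros pd_invertible pd_inv)
  have "{z \<in> pd_mats. matrix_inv z \<in> matrix_inv ` K} = K"
    using K(2) by (auto simp: subset_iff) (metis matrix_inv_matrix_inv)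
  then show "emeasure pd_mu {z \<in> pd_mats. matrix_inv z \<in> K} \<le> emeasure pd_mu K"
    using emeasure_pd_mu_le_inverse[OF K'] by (simp add: eq)
qed (rule emeasure_pd_mu_le_inverse[OF K])

text \<open>The compact subsets of the cone are stable under intersection and have finite
  \<open>pd_mu\<close>, so they can decide equality of measures. A closed set meets the cone in a
  countable union of them.\<close>

lemma pd_borel_eq_sigma_compact:
  fixes A :: "'n::{finite,wellorder} sqmat set"
  shows "sets (pd_borel :: 'n sqmat measure) = sigma_sets pd_mats {K. compact K \<and> K \<subseteq> pd_mats}"
    (is "?B = sigma_sets ?P ?E")
proof
  show "sigma_sets ?P ?E \<subseteq> ?B"
  proof
    fix A assume "A \<in> sigma_sets ?P ?E"
    then show "A \<in> ?B"
      by induction (auto simp: sets_pd_borel_iff borel_compact)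
  qed
  show "?B \<subseteq> sigma_sets ?P ?E"
  proof
    fix A assume A: "A \<in> ?B"
    then have "A \<in> sigma_sets UNIV (Collect closed)" "A \<subseteq> ?P"
      by (simp_all add: sets_pd_borel_iff borel_eq_closed)
    from this(1) have "A \<inter> ?P \<in> sigma_sets ?P ?E"
    proof induction
      case (Basic C)
      have "C \<inter> ?P = (\<Union>n. C \<inter> pd_level n)" using pd_level_Union by blast
      moreover have "C \<inter> pd_level n \<in> ?E" for n
        using Basic pd_level_subset compact_pd_level by (auto intro: closed_Int_compact)
      then have "(\<Union>n. C \<inter> pd_level n) \<in> sigma_sets ?P ?E"
        by (intro sigma_sets.Union sigma_sets.Basic)
      ultimately show ?case by (simp only:)
    next
      case Empty
      then show ?case by (auto intro: sigma_sets.Empty)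
    next
      case (Compl A)
      have "(UNIV - A) \<inter> ?P = ?P - (A \<inter> ?P)" by auto
      then show ?case using sigma_sets.Compl[OF Compl.IH] by simp
    next
      case (Union A)
      have "(\<Union>i. A i) \<inter> ?P = (\<Union>i. A i \<inter> ?P)" by auto
      moreover have "(\<Union>i. A i \<inter> ?P) \<in> sigma_sets ?P ?E"
        by (intro sigma_sets.Union Union.IH)
      ultimately show ?case by (simp only:)
    qed
    then show "A \<in> sigma_sets ?P ?E" using \<open>A \<subseteq> ?P\<close> by (simp add: Int_absorb2)
  qed
qed

lemma distr_pd_mu_inverse:
  "distr pd_mu pd_borel matrix_inv = (pd_mu :: 'n::{finite,wellorder} sqmat measure)"
proof (rule measure_eqI_generator_eq)
  let ?E = "{K :: 'n sqmat set. compact K \<and> K \<subseteq> pd_mats}"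
  let ?mu = "pd_mu :: 'n sqmat measure"
  show "Int_stable ?E" by (auto simp: Int_stable_def compact_Int)
  show "?E \<subseteq> Pow pd_mats" by auto
  show "sets (distr ?mu pd_borel matrix_inv) = sigma_sets pd_mats ?E" "sets ?mu = sigma_sets pd_mats ?E"
    by (simp_all add: pd_borel_eq_sigma_compact)
  have im: "matrix_inv \<in> measurable ?mu pd_borel" by measurable
  have vi: "matrix_inv -` K \<inter> pd_mats = {z \<in> pd_mats. matrix_inv z \<in> K}" for K :: "'n sqmat set" by auto
  have *: "emeasure (distr ?mu pd_borel matrix_inv) K = emeasure ?mu K" if "K \<in> ?E" for K
    using that emeasure_pd_mu_inverse_compact[of K]
    by (subst emeasure_distr[OF im]) (auto simp: sets_pd_borel_iff borel_compact vi)
  then show "\<And>X. X \<in> ?E \<Longrightarrow> emeasure (distr ?mu pd_borel matrix_inv) X = emeasure ?mu X" .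
  have lev: "pd_level i \<in> ?E" for i using compact_pd_level pd_level_subset by blast
  then show "range pd_level \<subseteq> ?E" by blast
  show "(\<Union>i. pd_level i) = (pd_mats :: 'n sqmat set)" by (rule pd_level_Union)
  show "emeasure (distr ?mu pd_borel matrix_inv) (pd_level i) \<noteq> \<infinity>" for i
  proof -
    have "emeasure ?mu (pd_level i) < \<infinity>"
      by (rule emeasure_pd_mu_compact_finite[OF compact_pd_level pd_level_subset])
    then show ?thesis by (simp add: *[OF lev])
  qed
qed

lemma nn_integral_pd_mu_inverse:
  fixes f :: "'n::{finite,wellorder} sqmat \<Rightarrow> ennreal"
  assumes f: "f \<in> borel_measurable pd_borel"
  shows "(\<integral>\<^sup>+x. f (matrix_inv x) \<partial>pd_mu) = (\<integral>\<^sup>+x. f x \<partial>pd_mu)"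
proof -
  have im: "matrix_inv \<in> measurable (pd_mu :: 'n sqmat measure) pd_borel" by measurable
  have "(\<integral>\<^sup>+x. f x \<partial>pd_mu) = (\<integral>\<^sup>+x. f x \<partial>distr pd_mu pd_borel matrix_inv)"
    by (simp only: distr_pd_mu_inverse)
  also have "\<dots> = (\<integral>\<^sup>+x. f (matrix_inv x) \<partial>pd_mu)" by (rule nn_integral_distr[OF im]) (simp add: f)
  finally show ?thesis ..
qed

section \<open>Finiteness of the multivariate gamma function\<close>

text \<open>The value \<open>\<top>\<close> at \<open>0\<close> lets \<open>nn_integral_pole_affine_le\<close> hold for a vanishing coefficient \<open>q\<close> as well.\<close>

definition pole :: "real \<Rightarrow> real \<Rightarrow> ennreal" where
  "pole s x = (if x = 0 then \<top> else ennreal (\<bar>x\<bar> powr - s))"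

lemma pole_measurable [measurable]: "pole s \<in> borel_measurable borel"
  unfolding pole_def[abs_def] by measurable

lemma pole_mult: "pole s (x * y) = pole s x * pole s y"
  by (auto simp: pole_def abs_mult powr_mult ennreal_mult ennreal_mult_eq_top_iff ennreal_top_mult ennreal_mult_top)

lemma nn_integral_abs_finite:
  fixes g :: "real \<Rightarrow> ennreal"
  assumes [measurable]: "g \<in> borel_measurable borel"
    and fin: "(\<integral>\<^sup>+t. g t * indicator {0..} t \<partial>lborel) < \<infinity>"
  shows "(\<integral>\<^sup>+t. g \<bar>t\<bar> \<partial>lborel) < \<infinity>"
proof -
  let ?h = "\<lambda>t. g t * indicator {0..} t"
  have "(\<integral>\<^sup>+t. g \<bar>t\<bar> \<partial>lborel) \<le> (\<integral>\<^sup>+t. ?h t + ?h (0 + (-1) * t) \<partial>lborel)"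
    by (intro nn_integral_mono) (auto simp: indicator_def abs_if)
  also have "\<dots> = (\<integral>\<^sup>+t. ?h t \<partial>lborel) + (\<integral>\<^sup>+t. ?h (0 + (-1) * t) \<partial>lborel)"
    by (intro nn_integral_add) measurable
  also have "(\<integral>\<^sup>+t. ?h (0 + (-1) * t) \<partial>lborel) = (\<integral>\<^sup>+t. ?h t \<partial>lborel)"
    using nn_integral_real_affine[of ?h "-1" 0] by simp
  finally have le: "(\<integral>\<^sup>+t. g \<bar>t\<bar> \<partial>lborel) \<le> (\<integral>\<^sup>+t. ?h t \<partial>lborel) + (\<integral>\<^sup>+t. ?h t \<partial>lborel)" .
  have "(\<integral>\<^sup>+t. ?h t \<partial>lborel) + (\<integral>\<^sup>+t. ?h t \<partial>lborel) < \<infinity>"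
    using fin unfolding infinity_ennreal_def ennreal_add_less_top by simp
  then show ?thesis by (rule le_less_trans[OF le])
qed

lemma nn_integral_pole_finite:
  assumes "s < 1"
  shows "(\<integral>\<^sup>+t. pole s t * indicator {-1..1} t \<partial>lborel) < \<infinity>"
proof -
  have "(\<integral>\<^sup>+t. (pole s t * indicator {..1} t) * indicator {0..} t \<partial>lborel) =
      (\<integral>\<^sup>+t. ennreal (t powr - s) * indicator {0..1} t \<partial>lborel)"
    using AE_lborel_singleton[of "0 :: real"]
    by (intro nn_integral_cong_AE, eventually_elim) (auto simp: pole_def indicator_def)
  also have "\<dots> = ennreal (1 powr (- s + 1) / (- s + 1))"
    using assms by (intro nn_integral_has_integral_lebesgue' has_integral_powr_from_0) auto
  finally have "(\<integral>\<^sup>+t. pole s \<bar>t\<bar> * indicator {..1} \<bar>t\<bar> \<partial>lborel) < \<infinity>"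
    by (intro nn_integral_abs_finite) auto
  also have "(\<integral>\<^sup>+t. pole s \<bar>t\<bar> * indicator {..1} \<bar>t\<bar> \<partial>lborel) = (\<integral>\<^sup>+t. pole s t * indicator {-1..1} t \<partial>lborel)"
    by (intro nn_integral_cong) (auto simp: pole_def indicator_def)
  finally show ?thesis .
qed

lemma nn_integral_exp_abs_finite:
  assumes "c > 0"
  shows "(\<integral>\<^sup>+t. ennreal (exp (- (c * \<bar>t\<bar>))) \<partial>lborel) < \<infinity>"
proof -
  have "(\<integral>\<^sup>+t. ennreal (exp (- t)) * indicator {0..} t \<partial>lborel) = ennreal (fact 0)"
    using nn_intergal_power_times_exp_Ici[of 0] by simp
  then have "(\<integral>\<^sup>+t. ennreal (exp (- \<bar>t\<bar>)) \<partial>lborel) < \<infinity>"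
    by (intro nn_integral_abs_finite) auto
  also have "(\<integral>\<^sup>+t. ennreal (exp (- \<bar>t\<bar>)) \<partial>lborel) = ennreal c * (\<integral>\<^sup>+t. ennreal (exp (- (c * \<bar>t\<bar>))) \<partial>lborel)"
    using nn_integral_real_affine[of "\<lambda>t. ennreal (exp (- \<bar>t\<bar>))" c 0] assms by (simp add: abs_mult)
  finally show ?thesis using assms by (auto simp: ennreal_mult_less_top)
qed

text \<open>The first summand pays for the unit interval on either side of the pole, where |t|^(-s)
  is integrable for s < 1, the second for the rest of the line.\<close>

definition pole_const :: "real \<Rightarrow> real \<Rightarrow> ennreal" where
  "pole_const s c = (\<integral>\<^sup>+t. pole s t * indicator {-1..1} t \<partial>lborel) + (\<integral>\<^sup>+t. ennreal (exp (- (c * \<bar>t\<bar>))) \<partial>lborel)"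

lemma pole_const_finite: "s < 1 \<Longrightarrow> c > 0 \<Longrightarrow> pole_const s c < \<infinity>"
  using nn_integral_pole_finite[of s] nn_integral_exp_abs_finite[of c] by (simp add: pole_const_def)

text \<open>The bound is uniform in r. Factoring out q leaves a translated pole; within distance 1
  of it the exponential is at most 1 and translation invariance removes the shift, elsewhere the
  pole factor is at most 1. For q = 0 the right side is \<top>, since the constant is
  nonzero.\<close>

lemma nn_integral_pole_affine_le:
  assumes s: "0 < s" "s < 1" and c: "c > 0"
  shows "(\<integral>\<^sup>+t. pole s (t * q + r) * ennreal (exp (- (c * \<bar>t\<bar>))) \<partial>lborel) \<le> pole_const s c * pole s q"
proof (cases "q = 0")
  case True
  have "pole_const s c \<noteq> 0"
  proof
    assume "pole_const s c = 0"
    then have "(\<integral>\<^sup>+t. ennreal (exp (- (c * \<bar>t\<bar>))) \<partial>lborel) = 0" by (simp add: pole_const_def)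
    then have "AE t in lborel. ennreal (exp (- (c * \<bar>t\<bar>))) = 0"
      by (subst (asm) nn_integral_0_iff_AE) auto
    then have "AE t in (lborel :: real measure). False" by eventually_elim simp
    then show False using AE_iff_null[of lborel "\<lambda>t :: real. False"] by (auto simp: null_sets_def)
  qed
  then show ?thesis using True by (simp add: pole_def ennreal_mult_top)
next
  case False
  define b where "b = r / q"
  have eq: "pole s (t * q + r) = pole s q * pole s (b + 1 * t)" for t
  proof -
    have "t * q + r = q * (b + 1 * t)" using False by (simp add: b_def field_simps)
    then show ?thesis by (simp only: pole_mult)
  qed
  have "(\<integral>\<^sup>+t. pole s (t * q + r) * ennreal (exp (- (c * \<bar>t\<bar>))) \<partial>lborel) =
      pole s q * (\<integral>\<^sup>+t. pole s (b + 1 * t) * ennreal (exp (- (c * \<bar>t\<bar>))) \<partial>lborel)"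
    unfolding eq mult.assoc by (rule nn_integral_cmult) measurable
  also have "(\<integral>\<^sup>+t. pole s (b + 1 * t) * ennreal (exp (- (c * \<bar>t\<bar>))) \<partial>lborel) \<le>
    (\<integral>\<^sup>+t. pole s (b + 1 * t) * indicator {-1..1} (b + 1 * t) + ennreal (exp (- (c * \<bar>t\<bar>))) \<partial>lborel)"
  proof (rule nn_integral_mono)
    fix t :: real
    show "pole s (b + 1 * t) * ennreal (exp (- (c * \<bar>t\<bar>))) \<le>
      pole s (b + 1 * t) * indicator {-1..1} (b + 1 * t) + ennreal (exp (- (c * \<bar>t\<bar>)))"
    proof (cases "b + 1 * t \<in> {-1..1}")
      case True
      have "pole s (b + 1 * t) * ennreal (exp (- (c * \<bar>t\<bar>))) \<le> pole s (b + 1 * t) * 1"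
        using c by (intro mult_left_mono) auto
      also have "\<dots> \<le> pole s (b + 1 * t) * indicator {-1..1} (b + 1 * t) + ennreal (exp (- (c * \<bar>t\<bar>)))"
        using True by simp
      finally show ?thesis .
    next
      case False
      then have 1: "\<bar>b + 1 * t\<bar> \<ge> 1" by auto
      have "\<bar>b + 1 * t\<bar> powr - s \<le> \<bar>b + 1 * t\<bar> powr 0" using 1 s by (intro powr_mono) auto
      then have "pole s (b + 1 * t) \<le> 1" using 1 by (auto simp: pole_def)
      then have "pole s (b + 1 * t) * ennreal (exp (- (c * \<bar>t\<bar>))) \<le> 1 * ennreal (exp (- (c * \<bar>t\<bar>)))"
        by (intro mult_right_mono) auto
      also have "\<dots> \<le> pole s (b + 1 * t) * indicator {-1..1} (b + 1 * t) + ennreal (exp (- (c * \<bar>t\<bar>)))"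
        by simp
      finally show ?thesis .
    qed
  qed
  also have "\<dots> = (\<integral>\<^sup>+t. pole s (b + 1 * t) * indicator {-1..1} (b + 1 * t) \<partial>lborel) + (\<integral>\<^sup>+t. ennreal (exp (- (c * \<bar>t\<bar>))) \<partial>lborel)"
    by (intro nn_integral_add) measurable
  also have "(\<integral>\<^sup>+t. pole s (b + 1 * t) * indicator {-1..1} (b + 1 * t) \<partial>lborel) = (\<integral>\<^sup>+t. pole s t * indicator {-1..1} t \<partial>lborel)"
    using nn_integral_real_affine[of "\<lambda>t. pole s t * indicator {-1..1} t" 1 b] by simp
  finally show ?thesis by (simp add: pole_const_def mult.commute mult_right_mono)
qed

text \<open>Rows outside S are unit vectors, so the determinant is the principal minor of A on S
  with a variable diagonal. Every minor is thereby a determinant of full size, and the minor on S is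
  the coefficient of the new variable once an index is added to S.\<close>

definition diag_rows :: "'n set \<Rightarrow> real^'n^'n \<Rightarrow> ('n \<times> 'n \<Rightarrow> real) \<Rightarrow> real^'n^'n" where
  "diag_rows S A t = (\<chi> i. if i \<in> S then (\<chi> j. if j = i then t (i, i) else A $ i $ j) else axis i 1)"

text \<open>The determinant is affine in each diagonal entry, so the diagonal entries can be integrated
  out one at a time.\<close>

lemma nn_integral_pole_det_le:
  fixes A :: "real^'n^'n"
  assumes s: "0 < s" "s < 1" and c: "c > 0"
  shows "(\<integral>\<^sup>+t. pole s (det (diag_rows S A t)) * (\<Prod>p\<in>(\<lambda>i. (i, i)) ` S. ennreal (exp (- (c * \<bar>t p\<bar>))))
     \<partial>Pi\<^sub>M ((\<lambda>i. (i, i)) ` S) (\<lambda>_. lborel)) \<le> pole_const s c ^ card S"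
  using finite[of S]
proof (induction S)
  case empty
  have "diag_rows {} A t = mat 1" for t by (simp add: diag_rows_def mat_def axis_def vec_eq_iff)
  interpret product_sigma_finite "\<lambda>_ :: 'n \<times> 'n. lborel :: real measure" by standard
  show ?case by (simp add: \<open>\<And>t. diag_rows {} A t = mat 1\<close> nn_integral_empty pole_def PiM_empty)
next
  case (insert i S)
  interpret product_sigma_finite "\<lambda>_ :: 'n \<times> 'n. lborel :: real measure" by standard
  let ?D = "(\<lambda>i. (i, i)) ` S" and ?p = "(i, i)"
  let ?e = "\<lambda>x :: real. ennreal (exp (- (c * \<bar>x\<bar>)))"
  let ?f = "\<lambda>t. pole s (det (diag_rows (insert i S) A t)) * (\<Prod>p\<in>insert ?p ?D. ?e (t p))"
  have p: "?p \<notin> ?D" using insert by auto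
  \<comment> \<open>The part of the determinant that is constant in the new diagonal entry y:
    linearity in row i splits that row into y times a unit vector and the row with 0 on the
    diagonal.\<close>
  define r where "r t = det (\<chi> k. if k = i then (\<chi> j. if j = i then 0 else A $ i $ j) else diag_rows S A t $ k)" for t
  have det: "det (diag_rows (insert i S) A (t(?p := y))) = y * det (diag_rows S A t) + r t" for t y
  proof -
    have "diag_rows (insert i S) A (t(?p := y)) =
       (\<chi> k. if k = i then y *s axis i 1 + (\<chi> j. if j = i then 0 else A $ i $ j) else diag_rows S A t $ k)"
      using insert(2) by (auto simp: diag_rows_def vec_eq_iff axis_def)
    also have "det \<dots> = det (\<chi> k. if k = i then y *s axis i 1 else diag_rows S A t $ k) + r t"
      unfolding r_def by (rule det_row_add)
    also have "det (\<chi> k. if k = i then y *s axis i 1 else diag_rows S A t $ k) =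
        y * det (\<chi> k. if k = i then axis i 1 else diag_rows S A t $ k)"
      by (rule det_row_mul)
    also have "(\<chi> k. if k = i then axis i 1 else diag_rows S A t $ k) = diag_rows S A t"
      using insert(2) by (auto simp: diag_rows_def vec_eq_iff)
    finally show ?thesis .
  qed
  have dm: "(\<lambda>t. diag_rows T A t) \<in> borel_measurable (Pi\<^sub>M ((\<lambda>i. (i, i)) ` T) (\<lambda>_. lborel))" for T
  proof (rule borel_measurable_matrix)
    fix k l
    show "(\<lambda>t. diag_rows T A t $ k $ l) \<in> borel_measurable (Pi\<^sub>M ((\<lambda>i. (i, i)) ` T) (\<lambda>_. lborel))"
      by (cases "k \<in> T"; cases "l = k") (auto simp: diag_rows_def intro!: measurable_component_singleton[where M="\<lambda>_. lborel", simplified])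
  qed
  have em: "(\<lambda>t. \<Prod>p\<in>J. ?e (t p)) \<in> borel_measurable (Pi\<^sub>M J (\<lambda>_. lborel))" for J :: "('n \<times> 'n) set"
    by measurable
  have fm: "?f \<in> borel_measurable (Pi\<^sub>M (insert ?p ?D) (\<lambda>_. lborel))"
    using dm[of "insert i S"] em[of "insert ?p ?D"]
    by (intro borel_measurable_times_ennreal measurable_compose[OF _ pole_measurable] borel_measurable_det) auto
  have im: "(\<lambda>t. pole s (det (diag_rows S A t)) * (\<Prod>p\<in>?D. ?e (t p))) \<in> borel_measurable (Pi\<^sub>M ?D (\<lambda>_. lborel))"
    using dm[of S] em[of ?D]
    by (intro borel_measurable_times_ennreal measurable_compose[OF _ pole_measurable] borel_measurable_det) auto
  have "(\<integral>\<^sup>+t. ?f t \<partial>Pi\<^sub>M (insert ?p ?D) (\<lambda>_. lborel)) =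
     (\<integral>\<^sup>+t. (\<integral>\<^sup>+y. ?f (t(?p := y)) \<partial>lborel) \<partial>Pi\<^sub>M ?D (\<lambda>_. lborel))"
    using fm by (rule product_nn_integral_insert[rotated 2]) (use p in auto)
  also have "\<dots> \<le> (\<integral>\<^sup>+t. pole_const s c * (pole s (det (diag_rows S A t)) * (\<Prod>p\<in>?D. ?e (t p))) \<partial>Pi\<^sub>M ?D (\<lambda>_. lborel))"
  proof (rule nn_integral_mono)
    fix t :: "'n \<times> 'n \<Rightarrow> real"
    have pr: "(\<Prod>q\<in>insert ?p ?D. ?e ((t(?p := y)) q)) = ?e y * (\<Prod>q\<in>?D. ?e (t q))" for y
    proof -
      have "(\<Prod>q\<in>?D. ?e ((t(?p := y)) q)) = (\<Prod>q\<in>?D. ?e (t q))"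
        using p by (intro prod.cong) auto
      then show ?thesis using p by (subst prod.insert) auto
    qed
    have "(\<integral>\<^sup>+y. ?f (t(?p := y)) \<partial>lborel) =
        (\<integral>\<^sup>+y. (pole s (y * det (diag_rows S A t) + r t) * ?e y) * (\<Prod>q\<in>?D. ?e (t q)) \<partial>lborel)"
      by (simp only: det pr mult.assoc)
    also have "\<dots> = (\<integral>\<^sup>+y. pole s (y * det (diag_rows S A t) + r t) * ?e y \<partial>lborel) * (\<Prod>q\<in>?D. ?e (t q))"
      by (rule nn_integral_multc) measurable
    also have "\<dots> \<le> (pole_const s c * pole s (det (diag_rows S A t))) * (\<Prod>q\<in>?D. ?e (t q))"
      by (intro mult_right_mono nn_integral_pole_affine_le s c) simp
    finally show "(\<integral>\<^sup>+y. ?f (t(?p := y)) \<partial>lborel) \<le> pole_const s c * (pole s (det (diag_rows S A t)) * (\<Prod>p\<in>?D. ?e (t p)))"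
      by (simp only: mult.assoc)
  qed
  also have "\<dots> = pole_const s c * (\<integral>\<^sup>+t. pole s (det (diag_rows S A t)) * (\<Prod>p\<in>?D. ?e (t p)) \<partial>Pi\<^sub>M ?D (\<lambda>_. lborel))"
    using im by (rule nn_integral_cmult)
  also have "\<dots> \<le> pole_const s c * pole_const s c ^ card S"
    by (intro mult_left_mono insert.IH) simp
  finally show ?case using insert by simp
qed

definition pd_gamma :: "'n::{finite,wellorder} itself \<Rightarrow> real \<Rightarrow> ennreal" where
  "pd_gamma _ a = (\<integral>\<^sup>+x. ennreal (det x powr a * exp (- trace x)) \<partial>(pd_mu :: 'n sqmat measure))"

text \<open>In coordinates the integrand is det^(-s) exp (- trace) with s = (d+1)/2 - p strictly
  between 0 and 1. It is enlarged to |det|^(-s) on all symmetric matrices, with the exponential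
  dominated by a product over the entries; then the diagonal entries can be integrated for fixed
  off-diagonal ones.\<close>

lemma pd_gamma_finite_near_pole:
  assumes p: "(real CARD('n) - 1) / 2 < p" "p < (real CARD('n) + 1) / 2"
  shows "pd_gamma TYPE('n::{finite,wellorder}) p < \<infinity>"
proof -
  interpret product_sigma_finite "\<lambda>_ :: 'n::_ \<times> 'n. lborel :: real measure" by standard
  define s where "s = (real CARD('n) + 1) / 2 - p"
  have s: "0 < s" "s < 1" using p by (simp_all add: s_def field_simps)
  define I :: "('n \<times> 'n) set" where "I = upper_idx"
  define D :: "('n \<times> 'n) set" where "D = (\<lambda>i. (i, i)) ` UNIV"
  \<comment> \<open>Each entry is bounded by the norm, hence by the trace; averaging over the
    \<open>card I\<close> coordinates bounds c times the sum of their absolute values by the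
    trace.\<close>
  define c where "c = 1 / real (card I)"
  have fI: "finite I" by (simp add: I_def)
  have DI: "D \<subseteq> I" by (auto simp: D_def I_def upper_idx_def)
  then have cI: "card I > 0" using fI by (auto simp: card_gt_0_iff D_def)
  then have c: "c > 0" by (simp add: c_def)
  let ?e = "\<lambda>x :: real. ennreal (exp (- (c * \<bar>x\<bar>)))"
  let ?f = "\<lambda>u. pole s (det (sym_of u :: 'n sqmat)) * (\<Prod>p\<in>I. ?e (u p))"
  have fm: "?f \<in> borel_measurable (Pi\<^sub>M I (\<lambda>_. lborel))"
    unfolding I_def by measurable
  have "pd_gamma TYPE('n) p = (\<integral>\<^sup>+x. pd_weight x * ennreal (det x powr p * exp (- trace x)) \<partial>(sym_lebesgue :: 'n sqmat measure))"
    unfolding pd_gamma_def by (rule nn_integral_pd_mu) measurable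
  also have "\<dots> = (\<integral>\<^sup>+u. pd_weight (sym_of u :: 'n sqmat) *
      ennreal (det (sym_of u :: 'n sqmat) powr p * exp (- trace (sym_of u :: 'n sqmat))) \<partial>lborel_upper)"
    by (rule nn_integral_sym_lebesgue) measurable
  also have "\<dots> \<le> (\<integral>\<^sup>+u. ?f u \<partial>Pi\<^sub>M I (\<lambda>_. lborel))"
    unfolding I_def[symmetric]
  proof (rule nn_integral_mono)
    fix u :: "'n \<times> 'n \<Rightarrow> real"
    let ?x = "sym_of u :: 'n sqmat"
    show "pd_weight ?x * ennreal (det ?x powr p * exp (- trace ?x)) \<le> ?f u"
    proof (cases "?x \<in> pd_mats")
      case True
      have dp: "det ?x > 0" using True by (rule pd_det_pos)
      have "\<bar>u q\<bar> \<le> trace ?x" if q: "q \<in> I" for q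
      proof -
        obtain i j where ij: "q = (i, j)" "i \<le> j" using q by (auto simp: I_def upper_idx_def)
        then have "u q = ?x $ i $ j" by (simp add: sym_of_def)
        also have "\<bar>\<dots>\<bar> \<le> norm ?x"
          by (rule order_trans[OF component_le_norm_cart Finite_Cartesian_Product.norm_nth_le])
        also have "\<dots> \<le> trace ?x" by (rule pd_norm_le_trace[OF True])
        finally show ?thesis .
      qed
      then have "(\<Sum>q\<in>I. \<bar>u q\<bar>) \<le> real (card I) * trace ?x"
        by (intro sum_bounded_above[THEN order_trans]) auto
      then have "c * (\<Sum>q\<in>I. \<bar>u q\<bar>) \<le> trace ?x"
        using cI by (simp add: c_def divide_le_eq mult.commute)
      then have "exp (- trace ?x) \<le> (\<Prod>q\<in>I. exp (- (c * \<bar>u q\<bar>)))"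
        using fI by (simp add: exp_sum[symmetric] sum_negf sum_distrib_left)
      then have le: "ennreal (exp (- trace ?x)) \<le> ennreal (\<Prod>q\<in>I. exp (- (c * \<bar>u q\<bar>)))"
        by (rule ennreal_leI)
      have "- s = - (real CARD('n) + 1) / 2 + p" by (simp add: s_def minus_divide_left)
      then have ex: "det ?x powr (- (real CARD('n) + 1) / 2) * (det ?x powr p * exp (- trace ?x)) = det ?x powr - s * exp (- trace ?x)"
        by (simp only: powr_add mult.assoc)
      have w: "pd_weight ?x = ennreal (det ?x powr (- (real CARD('n) + 1) / 2))"
        unfolding pd_weight_def using True by simp
      have "pd_weight ?x * ennreal (det ?x powr p * exp (- trace ?x)) =
          ennreal (det ?x powr (- (real CARD('n) + 1) / 2) * (det ?x powr p * exp (- trace ?x)))"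
        unfolding w by (rule ennreal_mult[symmetric]) auto
      also have "\<dots> = ennreal (det ?x powr - s) * ennreal (exp (- trace ?x))"
        unfolding ex by (rule ennreal_mult) auto
      also have "\<dots> \<le> ennreal (det ?x powr - s) * ennreal (\<Prod>q\<in>I. exp (- (c * \<bar>u q\<bar>)))"
        by (rule mult_left_mono[OF le]) simp
      also have "\<dots> = ?f u" using dp by (simp add: pole_def prod_ennreal)
      finally show ?thesis .
    qed (simp add: pd_weight_def)
  qed
  \<comment> \<open>The diagonal coordinates \<open>D\<close> are split off, to be the variables of
    the inner integral.\<close>
  also have "\<dots> = (\<integral>\<^sup>+u. ?f u \<partial>Pi\<^sub>M ((I - D) \<union> D) (\<lambda>_. lborel))"
    using DI by (simp add: Un_absorb2)
  also have "\<dots> = (\<integral>\<^sup>+x. (\<integral>\<^sup>+y. ?f (merge (I - D) D (x, y)) \<partial>Pi\<^sub>M D (\<lambda>_. lborel)) \<partial>Pi\<^sub>M (I - D) (\<lambda>_. lborel))"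
    using fm fI DI by (intro product_nn_integral_fold) (auto simp: Un_absorb2 intro: finite_subset)
  also have "\<dots> \<le> (\<integral>\<^sup>+x. (\<Prod>p\<in>I-D. ?e (x p)) * pole_const s c ^ CARD('n) \<partial>Pi\<^sub>M (I - D) (\<lambda>_. lborel))"
  proof (rule nn_integral_mono)
    fix x :: "'n \<times> 'n \<Rightarrow> real"
    let ?A = "sym_of x :: 'n sqmat"
    have mr: "sym_of (merge (I - D) D (x, y)) = diag_rows UNIV ?A y" for y
      by (auto simp: sym_of_def diag_rows_def vec_eq_iff merge_def D_def I_def upper_idx_def image_iff)
    have pr: "(\<Prod>p\<in>I. ?e (merge (I - D) D (x, y) p)) = (\<Prod>p\<in>I-D. ?e (x p)) * (\<Prod>p\<in>D. ?e (y p))" for y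
    proof -
      have "(\<Prod>p\<in>I. ?e (merge (I - D) D (x, y) p)) =
        (\<Prod>p\<in>I-D. ?e (merge (I - D) D (x, y) p)) * (\<Prod>p\<in>D. ?e (merge (I - D) D (x, y) p))"
        using DI fI by (rule prod.subset_diff)
      then show ?thesis by (simp add: merge_def)
    qed
    have "(\<integral>\<^sup>+y. ?f (merge (I - D) D (x, y)) \<partial>Pi\<^sub>M D (\<lambda>_. lborel)) =
       (\<integral>\<^sup>+y. (\<Prod>p\<in>I-D. ?e (x p)) * (pole s (det (diag_rows UNIV ?A y)) * (\<Prod>p\<in>D. ?e (y p))) \<partial>Pi\<^sub>M D (\<lambda>_. lborel))"
      by (simp only: mr pr mult_ac)
    also have "\<dots> = (\<Prod>p\<in>I-D. ?e (x p)) * (\<integral>\<^sup>+y. pole s (det (diag_rows UNIV ?A y)) * (\<Prod>p\<in>D. ?e (y p)) \<partial>Pi\<^sub>M D (\<lambda>_. lborel))"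
    proof (rule nn_integral_cmult)
      have "(\<lambda>y. diag_rows UNIV ?A y) \<in> borel_measurable (Pi\<^sub>M D (\<lambda>_. lborel))"
      proof (rule borel_measurable_matrix)
        fix k l
        show "(\<lambda>t. diag_rows UNIV ?A t $ k $ l) \<in> borel_measurable (Pi\<^sub>M D (\<lambda>_. lborel))"
          unfolding D_def
          by (cases "l = k") (auto simp: diag_rows_def intro!: measurable_component_singleton[where M="\<lambda>_. lborel", simplified])
      qed
      then show "(\<lambda>y. pole s (det (diag_rows UNIV ?A y)) * (\<Prod>p\<in>D. ?e (y p))) \<in> borel_measurable (Pi\<^sub>M D (\<lambda>_. lborel))"
        by (intro borel_measurable_times_ennreal measurable_compose[OF _ pole_measurable] borel_measurable_det) auto
    qed
    also have "\<dots> \<le> (\<Prod>p\<in>I-D. ?e (x p)) * pole_const s c ^ CARD('n)"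
      unfolding D_def by (intro mult_left_mono nn_integral_pole_det_le s c) simp
    finally show "(\<integral>\<^sup>+y. ?f (merge (I - D) D (x, y)) \<partial>Pi\<^sub>M D (\<lambda>_. lborel)) \<le> (\<Prod>p\<in>I-D. ?e (x p)) * pole_const s c ^ CARD('n)" .
  qed
  also have "\<dots> = (\<integral>\<^sup>+x. (\<Prod>p\<in>I-D. ?e (x p)) \<partial>Pi\<^sub>M (I - D) (\<lambda>_. lborel)) * pole_const s c ^ CARD('n)"
    by (rule nn_integral_multc) measurable
  also have "(\<integral>\<^sup>+x. (\<Prod>p\<in>I-D. ?e (x p)) \<partial>Pi\<^sub>M (I - D) (\<lambda>_. lborel)) = (\<Prod>p\<in>I-D. (\<integral>\<^sup>+x. ?e x \<partial>lborel))"
    using fI by (intro product_nn_integral_prod) auto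
  also have "(\<Prod>p\<in>I-D. (\<integral>\<^sup>+x. ?e x \<partial>lborel)) * pole_const s c ^ CARD('n) < \<infinity>"
    using nn_integral_exp_abs_finite[OF c] pole_const_finite[OF s(2) c]
    by (simp add: ennreal_mult_less_top less_top[symmetric] power_eq_top_ennreal ennreal_mult_eq_top_iff)
  finally show ?thesis .
qed

text \<open>Interpolation between exponents: det^a \<le> det^p + det^b for p \<le> a < b, with p in
  the window of \<open>pd_gamma_finite_near_pole\<close>. In the application b is \<beta> and a is
  \<beta> - \<alpha>.\<close>

lemma pd_gamma_finite:
  assumes a: "(real CARD('n) - 1) / 2 < a" "a < b" and b: "pd_gamma TYPE('n::{finite,wellorder}) b < \<infinity>"
  shows "pd_gamma TYPE('n) a < \<infinity>"
proof -
  \<comment> \<open>d/2 is the midpoint of the window, and the minimum ensures p \<le> a.\<close>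
  define p where "p = min a (real CARD('n) / 2)"
  have p: "(real CARD('n) - 1) / 2 < p" "p < (real CARD('n) + 1) / 2" "p \<le> a"
    using a by (auto simp: p_def min_def)
  let ?g = "\<lambda>r (x :: 'n sqmat). ennreal (det x powr r * exp (- trace x))"
  have "pd_gamma TYPE('n) a \<le> (\<integral>\<^sup>+x. ?g p x + ?g b x \<partial>pd_mu)"
    unfolding pd_gamma_def
  proof (rule nn_integral_mono)
    fix x :: "'n sqmat" assume "x \<in> space pd_mu"
    then have x: "det x > 0" by (simp add: pd_det_pos)
    have "det x powr a \<le> det x powr p + det x powr b"
    proof (cases "det x \<ge> 1")
      case True
      then have "det x powr a \<le> det x powr b" using a by (intro powr_mono) auto
      then show ?thesis by (simp add: add_increasing)
    next
      case False
      then have "det x powr a \<le> det x powr p" using x p by (intro powr_mono') auto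
      then show ?thesis by (simp add: add_increasing2)
    qed
    then have "det x powr a * exp (- trace x) \<le> det x powr p * exp (- trace x) + det x powr b * exp (- trace x)"
      by (simp flip: distrib_right)
    then show "?g a x \<le> ?g p x + ?g b x" by (simp flip: ennreal_plus add: ennreal_leI)
  qed
  also have "\<dots> = pd_gamma TYPE('n) p + pd_gamma TYPE('n) b"
    unfolding pd_gamma_def by (intro nn_integral_add) measurable
  also have "\<dots> < \<infinity>" using pd_gamma_finite_near_pole[OF p(1,2)] b by simp
  finally show ?thesis .
qed

section \<open>Beta and inverse Wishart identities\<close>

definition pd_pow :: "real \<Rightarrow> 'n::{finite,wellorder} sqmat \<Rightarrow> ennreal" where
  "pd_pow a x = ennreal (det x powr a)"

lemma pd_pow_measurable [measurable (raw)]: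
  "f \<in> borel_measurable M \<Longrightarrow> (\<lambda>x. pd_pow a (f x)) \<in> borel_measurable M"
proof -
  assume "f \<in> borel_measurable M"
  then have "(\<lambda>x. det (f x)) \<in> borel_measurable M" by (rule borel_measurable_det)
  then have "(\<lambda>x. det (f x) powr a) \<in> borel_measurable M" by (rule powr_real_measurable) simp
  then show ?thesis unfolding pd_pow_def by (rule measurable_compose[OF _ measurable_ennreal])
qed

lemma pd_pow_add: "pd_pow a x * pd_pow b x = pd_pow (a + b) x"
  by (simp add: pd_pow_def powr_add ennreal_mult)

lemma pd_pow_0: "x \<in> pd_mats \<Longrightarrow> pd_pow 0 x = 1"
  using pd_det_pos[of x] by (simp add: pd_pow_def)

lemma pd_pow_prod: 
  assumes "det x = det y * det z" "y \<in> pd_mats" "z \<in> pd_mats"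
  shows "pd_pow a x = pd_pow a y * pd_pow a z"
  using assms by (simp add: pd_pow_def powr_mult pd_det_pos less_imp_le ennreal_mult)

lemma pd_pow_inv: "x \<in> pd_mats \<Longrightarrow> pd_pow a (matrix_inv x) = pd_pow (- a) x"
  using pd_det_pos[of x]
  by (simp add: pd_pow_def det_matrix_inv pd_invertible powr_minus inverse_powr)

lemma pd_weight_eq: "x \<in> pd_mats \<Longrightarrow> pd_weight (x :: 'n::{finite,wellorder} sqmat) = pd_pow (- (real CARD('n) + 1) / 2) x"
  by (simp add: pd_weight_def pd_pow_def)

lemma pd_weight_outside: "x \<notin> pd_mats \<Longrightarrow> pd_weight x = 0"
  by (simp add: pd_weight_def)

lemma pd_add_measurable [measurable (raw)]:
  "f \<in> measurable M pd_borel \<Longrightarrow> g \<in> measurable M pd_borel \<Longrightarrow> (\<lambda>x. f x + g x) \<in> measurable M pd_borel"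
  by (auto simp: measurable_pd_borel_iff pd_add Pi_iff)

lemma det_sqrt_congruence:
  assumes "x \<in> pd_mats" shows "det (pd_sqrt x ** z ** pd_sqrt x) = det x * det z"
proof -
  have "det x = det (pd_sqrt x) * det (pd_sqrt x)" using pd_sqrt_mult[OF assms] by (metis det_mul)
  then show ?thesis by (simp add: det_mul mult_ac)
qed

lemma sqrt_congruence_add_1:
  assumes "x \<in> pd_mats" shows "pd_sqrt x ** (mat 1 + z) ** pd_sqrt x = x + pd_sqrt x ** z ** pd_sqrt x"
  by (simp add: matrix_add_ldistrib matrix_mult_add_rdistrib pd_sqrt_mult[OF assms])

text \<open>The substitutions are \<open>w = x\<^bsup>1/2\<^esup> z x\<^bsup>1/2\<^esup>\<close>, \<open>y = x + w\<close>, \<open>u = x\<^bsup>-1\<^esup>\<close> and \<open>v = u - y\<^bsup>-1\<^esup>\<close>.\<close>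

lemma nn_integral_pd_mu_affine_recursion:
  fixes f \<psi> :: "'n::{finite,wellorder} sqmat \<Rightarrow> ennreal"
  assumes f[measurable]: "f \<in> borel_measurable pd_borel" and \<psi>[measurable]: "\<psi> \<in> borel_measurable pd_borel"
  shows "(\<integral>\<^sup>+x. \<integral>\<^sup>+z. f (pd_sqrt x ** (mat 1 + z) ** pd_sqrt x) *
      (\<psi> (matrix_inv x) * pd_pow (- \<beta>) x) * (pd_pow \<alpha> z * pd_pow (- \<beta>) (mat 1 + z)) \<partial>pd_mu \<partial>pd_mu) =
    (\<integral>\<^sup>+y. f y * pd_pow (\<alpha> - \<beta>) y * (\<integral>\<^sup>+v. \<psi> (matrix_inv y + v) * pd_pow \<alpha> v \<partial>pd_mu) \<partial>pd_mu)"
proof -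
  let ?L = "sym_lebesgue :: 'n sqmat measure"
  let ?mu = "pd_mu :: 'n sqmat measure"
  interpret L: sigma_finite_measure ?L by (rule sigma_finite_sym_lebesgue)
  interpret P: pair_sigma_finite ?L ?L ..
  define m where "m = (real CARD('n) + 1) / 2"
  have W: "pd_weight x = pd_pow (- m) x" if "x \<in> pd_mats" for x :: "'n sqmat"
    using pd_weight_eq[OF that] by (simp add: m_def minus_divide_left)
  \<comment> \<open>The target is a convolution over all symmetric matrices with integrand a(x) h(y
    - x) b(y): \<open>h\<close> belongs to w = y - x, and \<open>b\<close> collects f and the power
    of det y.\<close>
  define a where "a x = pd_weight x * (\<psi> (matrix_inv x) * pd_pow (- \<alpha>) x)" for x
  define b where "b y = f y * indicator pd_mats y * pd_pow (- \<beta>) y" for y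
  define h where "h w = pd_weight w * pd_pow \<alpha> w" for w :: "'n sqmat"
  have am[measurable]: "a \<in> borel_measurable borel"
    unfolding a_def by (rule pd_weight_mult_measurable) measurable
  have fi[measurable]: "(\<lambda>y. f y * indicator pd_mats y) \<in> borel_measurable borel"
    using f by (simp add: borel_measurable_pd_borel_iff)
  have bm[measurable]: "b \<in> borel_measurable borel" unfolding b_def by measurable
  have hm[measurable]: "h \<in> borel_measurable borel" unfolding h_def by measurable
  have \<psi>i[measurable]: "(\<lambda>y. \<psi> y * indicator pd_mats y) \<in> borel_measurable borel"
    using \<psi> by (simp add: borel_measurable_pd_borel_iff)
  have Lcong: "g \<in> borel_measurable borel \<Longrightarrow> g \<in> borel_measurable ?L" for g :: "'n sqmat \<Rightarrow> ennreal"
    by (subst measurable_cong_sets[OF sets_sym_lebesgue refl])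
  have ids[measurable]: "(\<lambda>x. x) \<in> measurable ?mu borel"
    by (subst measurable_cong_sets[OF sets_pd_mu refl]) measurable
  \<comment> \<open>Congruence invariance removes the roots. The powers -\<beta> of det x and det (I
    + z) combine to the power -\<beta> of det y, and det z = det w / det x leaves the power
    -\<alpha> of det x.\<close>
  have inner: "(\<integral>\<^sup>+z. f (pd_sqrt x ** (mat 1 + z) ** pd_sqrt x) *
      (\<psi> (matrix_inv x) * pd_pow (- \<beta>) x) * (pd_pow \<alpha> z * pd_pow (- \<beta>) (mat 1 + z)) \<partial>?mu) =
      (\<psi> (matrix_inv x) * pd_pow (- \<alpha>) x) * (\<integral>\<^sup>+w. h w * b (x + w) \<partial>?L)" if x: "x \<in> pd_mats" for x
  proof -
    let ?F = "\<lambda>w. (\<psi> (matrix_inv x) * pd_pow (- \<alpha>) x) * (pd_pow \<alpha> w * b (x + w))"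
    have Fm: "?F \<in> borel_measurable pd_borel" by measurable
    have "f (pd_sqrt x ** (mat 1 + z) ** pd_sqrt x) * (\<psi> (matrix_inv x) * pd_pow (- \<beta>) x) *
        (pd_pow \<alpha> z * pd_pow (- \<beta>) (mat 1 + z)) = ?F (pd_sqrt x ** z ** pd_sqrt x)" if z: "z \<in> pd_mats" for z
    proof -
      let ?w = "pd_sqrt x ** z ** pd_sqrt x"
      have w: "?w \<in> pd_mats" by (rule pd_congruence_pd[OF pd_sqrt_pd[OF x] z])
      have 1: "pd_pow \<alpha> ?w = pd_pow \<alpha> x * pd_pow \<alpha> z"
        by (rule pd_pow_prod[OF det_sqrt_congruence[OF x] x z])
      have "det (x + ?w) = det x * det (mat 1 + z)"
        unfolding sqrt_congruence_add_1[OF x, symmetric] by (rule det_sqrt_congruence[OF x])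
      then have 2: "pd_pow (- \<beta>) (x + ?w) = pd_pow (- \<beta>) x * pd_pow (- \<beta>) (mat 1 + z)"
        by (rule pd_pow_prod[OF _ x pd_add[OF mat_1_pd z]])
      have 3: "pd_pow (- \<alpha>) x * pd_pow \<alpha> x = 1" by (simp add: pd_pow_add pd_pow_0[OF x])
      have "?F ?w = f (x + ?w) * \<psi> (matrix_inv x) * (pd_pow (- \<alpha>) x * pd_pow \<alpha> x) * pd_pow \<alpha> z
          * (pd_pow (- \<beta>) x * pd_pow (- \<beta>) (mat 1 + z))"
        using pd_add[OF x w] by (simp add: b_def 1 2 mult_ac)
      then show ?thesis unfolding 3 sqrt_congruence_add_1[OF x] by (simp add: mult_ac)
    qed
    then have "(\<integral>\<^sup>+z. f (pd_sqrt x ** (mat 1 + z) ** pd_sqrt x) *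
      (\<psi> (matrix_inv x) * pd_pow (- \<beta>) x) * (pd_pow \<alpha> z * pd_pow (- \<beta>) (mat 1 + z)) \<partial>?mu) =
      (\<integral>\<^sup>+z. ?F (pd_sqrt x ** z ** pd_sqrt x) \<partial>?mu)"
      by (intro nn_integral_cong) simp
    also have "\<dots> = (\<integral>\<^sup>+w. ?F w \<partial>?mu)"
      by (rule nn_integral_pd_mu_congruence[OF pd_sqrt_pd[OF x] Fm])
    also have "\<dots> = (\<integral>\<^sup>+w. pd_weight w * ?F w \<partial>?L)" by (rule nn_integral_pd_mu[OF Fm])
    also have "\<dots> = (\<integral>\<^sup>+w. (\<psi> (matrix_inv x) * pd_pow (- \<alpha>) x) * (h w * b (x + w)) \<partial>?L)"
      by (intro nn_integral_cong) (simp add: h_def mult_ac)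
    also have "\<dots> = (\<psi> (matrix_inv x) * pd_pow (- \<alpha>) x) * (\<integral>\<^sup>+w. h w * b (x + w) \<partial>?L)"
      by (intro nn_integral_cmult Lcong) measurable
    finally show ?thesis .
  qed
  \<comment> \<open>With u = x^(-1), the factorization of y - u^(-1) splits h(y - x) into powers of
    det y and det u times h(u - y^(-1)). The total power of det u is m, which cancels the density of
    \<open>pd_mu\<close>, so that the passage to v is a plain translation.\<close>
  have conv: "(\<integral>\<^sup>+x. a x * h (y - x) \<partial>?L) = pd_pow (\<alpha> - m) y * (\<integral>\<^sup>+v. \<psi> (matrix_inv y + v) * pd_pow \<alpha> v \<partial>?mu)"
    if y: "y \<in> pd_mats" for y
  proof -
    have iy: "matrix_inv y \<in> pd_mats" by (rule pd_inv[OF y])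
    let ?q = "\<lambda>x. \<psi> (matrix_inv x) * pd_pow (- \<alpha>) x * h (y - x)"
    let ?r = "\<lambda>v. \<psi> (matrix_inv y + v) * pd_pow \<alpha> v"
    have qm: "?q \<in> borel_measurable pd_borel" by measurable
    have "(\<lambda>v. \<psi> (matrix_inv y + v)) \<in> borel_measurable pd_borel"
      by (rule measurable_compose[OF _ \<psi>]) (use iy in \<open>auto simp: measurable_pd_borel_iff pd_add\<close>)
    then have rm: "?r \<in> borel_measurable pd_borel" by measurable
    have "(\<integral>\<^sup>+x. a x * h (y - x) \<partial>?L) = (\<integral>\<^sup>+x. pd_weight x * ?q x \<partial>?L)"
      by (intro nn_integral_cong) (simp add: a_def mult_ac)
    also have "\<dots> = (\<integral>\<^sup>+x. ?q x \<partial>?mu)" by (rule nn_integral_pd_mu[OF qm, symmetric])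
    also have "\<dots> = (\<integral>\<^sup>+u. ?q (matrix_inv u) \<partial>?mu)" by (rule nn_integral_pd_mu_inverse[OF qm, symmetric])
    also have "\<dots> = (\<integral>\<^sup>+u. pd_pow (\<alpha> - m) y * (\<psi> u * indicator pd_mats u * pd_pow m u * h (u - matrix_inv y)) \<partial>?mu)"
    proof (rule nn_integral_cong)
      fix u assume "u \<in> space ?mu"
      then have u: "u \<in> pd_mats" by simp
      show "?q (matrix_inv u) = pd_pow (\<alpha> - m) y * (\<psi> u * indicator pd_mats u * pd_pow m u * h (u - matrix_inv y))"
      proof (cases "u - matrix_inv y \<in> pd_mats")
        case True
        then have yu: "y - matrix_inv u \<in> pd_mats" using pd_inv_diff_iff[OF u y] by simp
        have hp: "h w = pd_pow (\<alpha> - m) w" if "w \<in> pd_mats" for w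
          by (simp add: h_def W[OF that] pd_pow_add)
        have "det (y - matrix_inv u) * det u = det y * det (u - matrix_inv y)"
          using det_inv_diff[OF u y] pd_det_pos[OF u] by simp
        then have "pd_pow (\<alpha> - m) (y - matrix_inv u) * pd_pow (\<alpha> - m) u = pd_pow (\<alpha> - m) y * pd_pow (\<alpha> - m) (u - matrix_inv y)"
          using y u yu True by (simp add: pd_pow_def ennreal_mult[symmetric] powr_mult[symmetric] pd_det_pos less_imp_le)
        then have "pd_pow (\<alpha> - m) (y - matrix_inv u) * (pd_pow (\<alpha> - m) u * pd_pow m u) = pd_pow (\<alpha> - m) y * pd_pow (\<alpha> - m) (u - matrix_inv y) * pd_pow m u"
          by (simp only: mult.assoc[symmetric])
        moreover have "pd_pow (\<alpha> - m) u * pd_pow m u = pd_pow \<alpha> u" by (simp add: pd_pow_add)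
        ultimately have "pd_pow \<alpha> u * pd_pow (\<alpha> - m) (y - matrix_inv u) = pd_pow (\<alpha> - m) y * pd_pow (\<alpha> - m) (u - matrix_inv y) * pd_pow m u"
          by (simp add: mult.commute)
        then show ?thesis
          using u by (simp add: hp[OF True] hp[OF yu] pd_pow_inv matrix_inv_matrix_inv mult_ac)
      next
        case False
        then have "y - matrix_inv u \<notin> pd_mats" using pd_inv_diff_iff[OF u y] by simp
        then show ?thesis using False by (simp add: h_def pd_weight_outside)
      qed
    qed
    also have "\<dots> = pd_pow (\<alpha> - m) y * (\<integral>\<^sup>+u. \<psi> u * indicator pd_mats u * pd_pow m u * h (u - matrix_inv y) \<partial>?mu)"
    proof (rule nn_integral_cmult)
      have "(\<lambda>u. \<psi> u * indicator pd_mats u * pd_pow m u * h (u - matrix_inv y)) \<in> borel_measurable borel" by measurable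
      from measurable_compose[OF ids this]
      show "(\<lambda>u. \<psi> u * indicator pd_mats u * pd_pow m u * h (u - matrix_inv y)) \<in> borel_measurable ?mu" .
    qed
    also have "(\<integral>\<^sup>+u. \<psi> u * indicator pd_mats u * pd_pow m u * h (u - matrix_inv y) \<partial>?mu) =
        (\<integral>\<^sup>+u. pd_weight u * (\<psi> u * indicator pd_mats u * pd_pow m u * h (u - matrix_inv y)) \<partial>?L)"
    proof (rule nn_integral_pd_mu)
      have "(\<lambda>u. \<psi> u * indicator pd_mats u * pd_pow m u * h (u - matrix_inv y)) \<in> borel_measurable borel" by measurable
      from measurable_compose[OF id_measurable_pd_borel this]
      show "(\<lambda>u. \<psi> u * indicator pd_mats u * pd_pow m u * h (u - matrix_inv y)) \<in> borel_measurable pd_borel" .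
    qed
    also have "\<dots> = (\<integral>\<^sup>+u. \<psi> u * indicator pd_mats u * h (u - matrix_inv y) \<partial>?L)"
    proof (rule nn_integral_cong)
      fix u :: "'n sqmat"
      show "pd_weight u * (\<psi> u * indicator pd_mats u * pd_pow m u * h (u - matrix_inv y)) = \<psi> u * indicator pd_mats u * h (u - matrix_inv y)"
      proof (cases "u \<in> pd_mats")
        case True
        have "pd_weight u * pd_pow m u = 1" by (simp add: W[OF True] pd_pow_add pd_pow_0[OF True])
        then have "(pd_weight u * pd_pow m u) * (\<psi> u * h (u - matrix_inv y)) = \<psi> u * h (u - matrix_inv y)" by simp
        then show ?thesis using True by (simp add: mult_ac)
      qed simp
    qed
    also have "\<dots> = (\<integral>\<^sup>+v. \<psi> (v + matrix_inv y) * indicator pd_mats (v + matrix_inv y) * h (v + matrix_inv y - matrix_inv y) \<partial>?L)"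
      using nn_integral_sym_lebesgue_translate[of "\<lambda>u. \<psi> u * indicator pd_mats u * h (u - matrix_inv y)" "matrix_inv y"]
        pd_symmetric[OF iy] by simp
    also have "\<dots> = (\<integral>\<^sup>+v. pd_weight v * ?r v \<partial>?L)"
    proof (rule nn_integral_cong)
      fix v :: "'n sqmat"
      show "\<psi> (v + matrix_inv y) * indicator pd_mats (v + matrix_inv y) * h (v + matrix_inv y - matrix_inv y) = pd_weight v * ?r v"
        using pd_add[OF _ iy, of v] by (cases "v \<in> pd_mats") (auto simp: h_def pd_weight_outside mult_ac add.commute)
    qed
    also have "\<dots> = (\<integral>\<^sup>+v. ?r v \<partial>?mu)" by (rule nn_integral_pd_mu[OF rm, symmetric])
    finally show ?thesis .
  qed
  have "(\<integral>\<^sup>+x. \<integral>\<^sup>+z. f (pd_sqrt x ** (mat 1 + z) ** pd_sqrt x) *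
      (\<psi> (matrix_inv x) * pd_pow (- \<beta>) x) * (pd_pow \<alpha> z * pd_pow (- \<beta>) (mat 1 + z)) \<partial>?mu \<partial>?mu) =
      (\<integral>\<^sup>+x. (\<psi> (matrix_inv x) * pd_pow (- \<alpha>) x) * (\<integral>\<^sup>+w. h w * b (x + w) \<partial>?L) \<partial>?mu)"
    by (intro nn_integral_cong inner) simp
  also have "\<dots> = (\<integral>\<^sup>+x. pd_weight x * ((\<psi> (matrix_inv x) * pd_pow (- \<alpha>) x) * (\<integral>\<^sup>+w. h w * b (x + w) \<partial>?L)) \<partial>?L)"
  proof (rule nn_integral_pd_mu)
    have "(\<lambda>x. \<integral>\<^sup>+w. h w * b (x + w) \<partial>?L) \<in> borel_measurable borel"
      by (rule L.borel_measurable_nn_integral) measurable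
    from measurable_compose[OF id_measurable_pd_borel this]
    show "(\<lambda>x. \<psi> (matrix_inv x) * pd_pow (- \<alpha>) x * (\<integral>\<^sup>+w. h w * b (x + w) \<partial>?L)) \<in> borel_measurable pd_borel"
      by measurable
  qed
  \<comment> \<open>\<open>sym_lebesgue\<close> may be translated only by a symmetric x, hence the
    argument almost everywhere.\<close>
  also have "\<dots> = (\<integral>\<^sup>+x. (\<integral>\<^sup>+y. a x * (h (y - x) * b y) \<partial>?L) \<partial>?L)"
    using AE_sym_lebesgue
  proof (intro nn_integral_cong_AE, eventually_elim)
    fix x :: "'n sqmat" assume x: "transpose x = x"
    have "(\<integral>\<^sup>+w. h w * b (x + w) \<partial>?L) = (\<integral>\<^sup>+w. h (w + x - x) * b (w + x) \<partial>?L)" by (simp add: add.commute)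
    also have "\<dots> = (\<integral>\<^sup>+y. h (y - x) * b y \<partial>?L)"
      by (rule nn_integral_sym_lebesgue_translate[OF _ x, of "\<lambda>y. h (y - x) * b y"]) measurable
    finally have *: "(\<integral>\<^sup>+w. h w * b (x + w) \<partial>?L) = (\<integral>\<^sup>+y. h (y - x) * b y \<partial>?L)" .
    have "(\<integral>\<^sup>+y. a x * (h (y - x) * b y) \<partial>?L) = a x * (\<integral>\<^sup>+y. h (y - x) * b y \<partial>?L)"
      by (intro nn_integral_cmult Lcong) measurable
    then show "pd_weight x * ((\<psi> (matrix_inv x) * pd_pow (- \<alpha>) x) * (\<integral>\<^sup>+w. h w * b (x + w) \<partial>?L)) = (\<integral>\<^sup>+y. a x * (h (y - x) * b y) \<partial>?L)"
      by (simp only: * a_def mult.assoc)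
  qed
  also have "\<dots> = (\<integral>\<^sup>+y. (\<integral>\<^sup>+x. a x * (h (y - x) * b y) \<partial>?L) \<partial>?L)"
    by (rule P.Fubini') measurable
  also have "\<dots> = (\<integral>\<^sup>+y. pd_weight y * (f y * pd_pow (\<alpha> - \<beta>) y * (\<integral>\<^sup>+v. \<psi> (matrix_inv y + v) * pd_pow \<alpha> v \<partial>?mu)) \<partial>?L)"
  proof (rule nn_integral_cong)
    fix y :: "'n sqmat"
    have "(\<integral>\<^sup>+x. a x * (h (y - x) * b y) \<partial>?L) = (\<integral>\<^sup>+x. (a x * h (y - x)) * b y \<partial>?L)"
      by (simp only: mult.assoc)
    also have "\<dots> = (\<integral>\<^sup>+x. a x * h (y - x) \<partial>?L) * b y"
      by (intro nn_integral_multc Lcong) measurable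
    also have "\<dots> = pd_weight y * (f y * pd_pow (\<alpha> - \<beta>) y * (\<integral>\<^sup>+v. \<psi> (matrix_inv y + v) * pd_pow \<alpha> v \<partial>?mu))"
    proof (cases "y \<in> pd_mats")
      case True
      have "pd_pow (\<alpha> - m) y * pd_pow (- \<beta>) y = pd_weight y * pd_pow (\<alpha> - \<beta>) y"
      proof -
        have "\<alpha> - m + - \<beta> = - m + (\<alpha> - \<beta>)" by simp
        then show ?thesis by (simp only: W[OF True] pd_pow_add)
      qed
      then have "(pd_pow (\<alpha> - m) y * pd_pow (- \<beta>) y) * (f y * (\<integral>\<^sup>+v. \<psi> (matrix_inv y + v) * pd_pow \<alpha> v \<partial>?mu)) =
         (pd_weight y * pd_pow (\<alpha> - \<beta>) y) * (f y * (\<integral>\<^sup>+v. \<psi> (matrix_inv y + v) * pd_pow \<alpha> v \<partial>?mu))" by simp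
      then show ?thesis using True by (simp only: conv[OF True]) (simp add: b_def mult_ac)
    next
      case False
      then show ?thesis by (simp add: b_def pd_weight_outside)
    qed
    finally show "(\<integral>\<^sup>+x. a x * (h (y - x) * b y) \<partial>?L) = pd_weight y * (f y * pd_pow (\<alpha> - \<beta>) y * (\<integral>\<^sup>+v. \<psi> (matrix_inv y + v) * pd_pow \<alpha> v \<partial>?mu))" .
  qed
  also have "\<dots> = (\<integral>\<^sup>+y. f y * pd_pow (\<alpha> - \<beta>) y * (\<integral>\<^sup>+v. \<psi> (matrix_inv y + v) * pd_pow \<alpha> v \<partial>?mu) \<partial>?mu)"
  proof (rule nn_integral_pd_mu[symmetric])
    have pm: "(\<lambda>p. \<psi> (matrix_inv (fst p) + snd p)) \<in> borel_measurable (pd_borel \<Otimes>\<^sub>M ?mu)"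
    proof (rule measurable_compose[OF _ \<psi>], rule pd_add_measurable)
      show "(\<lambda>p. matrix_inv (fst p)) \<in> measurable (pd_borel \<Otimes>\<^sub>M ?mu) pd_borel" by measurable
      have "snd \<in> measurable (pd_borel \<Otimes>\<^sub>M ?mu) ?mu" by (rule measurable_snd)
      then show "snd \<in> measurable ((pd_borel :: 'n sqmat measure) \<Otimes>\<^sub>M ?mu) pd_borel"
        by (simp only: measurable_cong_sets[OF refl sets_pd_mu])
    qed
    have "(\<lambda>p. pd_pow \<alpha> (snd p)) \<in> borel_measurable ((pd_borel :: 'n sqmat measure) \<Otimes>\<^sub>M ?mu)"
      by (intro pd_pow_measurable measurable_compose[OF measurable_snd ids])
    then have "(\<lambda>y. \<integral>\<^sup>+v. \<psi> (matrix_inv y + v) * pd_pow \<alpha> v \<partial>?mu) \<in> borel_measurable pd_borel"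
      using pm by (intro sigma_finite_measure.borel_measurable_nn_integral[OF sigma_finite_pd_mu])
        (simp add: case_prod_beta')
    then show "(\<lambda>y. f y * pd_pow (\<alpha> - \<beta>) y * (\<integral>\<^sup>+v. \<psi> (matrix_inv y + v) * pd_pow \<alpha> v \<partial>?mu)) \<in> borel_measurable pd_borel"
      by measurable
  qed
  finally show ?thesis .
qed

section \<open>Unnormalised beta and inverse Wishart densities and their recursions\<close>

definition beta_dens :: "real \<Rightarrow> real \<Rightarrow> 'n::{finite,wellorder} sqmat \<Rightarrow> ennreal" where
  "beta_dens a b x = pd_pow a x * pd_pow (- (a + b)) (mat 1 + x)"

definition iw_dens :: "real \<Rightarrow> 'n::{finite,wellorder} sqmat \<Rightarrow> ennreal" where
  "iw_dens b x = pd_pow (- b) x * ennreal (exp (- trace (matrix_inv x)))"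

lemma beta_dens_measurable [measurable]: "beta_dens a b \<in> borel_measurable pd_borel"
  unfolding beta_dens_def[abs_def] by measurable

lemma iw_dens_measurable [measurable]: "iw_dens b \<in> borel_measurable pd_borel"
  unfolding iw_dens_def[abs_def] by measurable

lemma measurable_pd_mu_iff: "f \<in> borel_measurable pd_mu \<longleftrightarrow> f \<in> borel_measurable pd_borel"
  by (simp only: measurable_cong_sets[OF sets_pd_mu refl])

text \<open>Both sides are 0 when the integral is infinite, so a nonzero \<open>mv_gamma\<close>
  certifies that \<open>pd_gamma\<close> is positive and finite.\<close>

lemma mv_gamma_eq: "mv_gamma T a = enn2real (pd_gamma T a)"
  unfolding mv_gamma_def pd_gamma_def
  by (rule integral_eq_nn_integral) (auto simp: measurable_pd_mu_iff)

lemma mv_gamma_nonneg: "mv_gamma T a \<ge> 0"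
  by (simp add: mv_gamma_eq)

lemma mv_beta_nonneg: "mv_beta T a b \<ge> 0"
  by (simp add: mv_beta_def mv_gamma_nonneg)

lemma beta_II_eq:
  "(beta_II a b :: 'n::{finite,wellorder} sqmat measure) =
    density pd_mu (\<lambda>x. ennreal (inverse (mv_beta TYPE('n) a b)) * beta_dens a b x)"
  by (simp add: beta_II_def beta_dens_def pd_pow_def mv_beta_nonneg ennreal_mult mult.assoc)

lemma inv_wishart_eq:
  "(inv_wishart b :: 'n::{finite,wellorder} sqmat measure) =
    density pd_mu (\<lambda>x. ennreal (inverse (mv_gamma TYPE('n) b)) * iw_dens b x)"
  by (simp add: inv_wishart_def iw_dens_def pd_pow_def mv_gamma_nonneg ennreal_mult mult.assoc)

lemma sets_beta_II [measurable_cong, simp]: "sets (beta_II a b) = sets pd_borel"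
  and sets_inv_wishart [measurable_cong, simp]: "sets (inv_wishart b) = sets pd_borel"
  by (simp_all add: beta_II_def inv_wishart_def)

lemma nn_integral_pd_density:
  fixes g f :: "'n::{finite,wellorder} sqmat \<Rightarrow> ennreal"
  assumes g: "g \<in> borel_measurable pd_borel" and f: "f \<in> borel_measurable pd_borel"
  shows "(\<integral>\<^sup>+x. f x \<partial>density pd_mu (\<lambda>x. c * g x)) = c * (\<integral>\<^sup>+x. f x * g x \<partial>pd_mu)"
proof -
  have "(\<integral>\<^sup>+x. f x \<partial>density pd_mu (\<lambda>x. c * g x)) = (\<integral>\<^sup>+x. c * g x * f x \<partial>pd_mu)"
    using g f by (intro nn_integral_density) (auto simp: measurable_pd_mu_iff)
  also have "\<dots> = (\<integral>\<^sup>+x. c * (f x * g x) \<partial>pd_mu)" by (simp add: mult_ac)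
  also have "\<dots> = c * (\<integral>\<^sup>+x. f x * g x \<partial>pd_mu)"
    using g f by (intro nn_integral_cmult) (auto simp: measurable_pd_mu_iff)
  finally show ?thesis .
qed

lemma nn_integral_beta_II:
  fixes f :: "'n::{finite,wellorder} sqmat \<Rightarrow> ennreal"
  shows "f \<in> borel_measurable pd_borel \<Longrightarrow> (\<integral>\<^sup>+x. f x \<partial>beta_II a b) =
    ennreal (inverse (mv_beta TYPE('n) a b)) * (\<integral>\<^sup>+x. f x * beta_dens a b x \<partial>pd_mu)"
  unfolding beta_II_eq by (rule nn_integral_pd_density) measurable

lemma nn_integral_inv_wishart:
  fixes f :: "'n::{finite,wellorder} sqmat \<Rightarrow> ennreal"
  shows "f \<in> borel_measurable pd_borel \<Longrightarrow> (\<integral>\<^sup>+x. f x \<partial>inv_wishart b) =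
    ennreal (inverse (mv_gamma TYPE('n) b)) * (\<integral>\<^sup>+x. f x * iw_dens b x \<partial>pd_mu)"
  unfolding inv_wishart_eq by (rule nn_integral_pd_density) measurable

text \<open>Inversion invariance of \<open>pd_mu\<close> turns the inverse Wishart density into the
  integrand of the gamma function.\<close>

lemma nn_integral_iw_dens:
  "(\<integral>\<^sup>+x. iw_dens b x \<partial>(pd_mu :: 'n::{finite,wellorder} sqmat measure)) = pd_gamma TYPE('n) b"
proof -
  let ?g = "\<lambda>x :: 'n sqmat. ennreal (det x powr b * exp (- trace x))"
  have "(\<integral>\<^sup>+x. iw_dens b x \<partial>(pd_mu :: 'n sqmat measure)) = (\<integral>\<^sup>+x. ?g (matrix_inv x) \<partial>pd_mu)"
  proof (rule nn_integral_cong)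
    fix x :: "'n sqmat" assume "x \<in> space pd_mu"
    then have x: "x \<in> pd_mats" by simp
    have "?g (matrix_inv x) = pd_pow b (matrix_inv x) * ennreal (exp (- trace (matrix_inv x)))"
      by (simp add: pd_pow_def ennreal_mult)
    then show "iw_dens b x = ?g (matrix_inv x)" by (simp add: iw_dens_def pd_pow_inv[OF x])
  qed
  also have "\<dots> = (\<integral>\<^sup>+x. ?g x \<partial>pd_mu)" by (rule nn_integral_pd_mu_inverse) measurable
  finally show ?thesis by (simp add: pd_gamma_def)
qed

text \<open>The integrand is positive on the whole cone, so a zero integral forces
  \<open>pd_mu\<close> to vanish, whatever the exponent. This carries nonvanishing from \<beta> to
  \<beta> - \<alpha>.\<close>

lemma pd_gamma_eq_0:
  fixes T :: "'n::{finite,wellorder} itself"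
  assumes "pd_gamma T a = 0" shows "pd_gamma T b = 0"
proof -
  let ?g = "\<lambda>r (x :: 'n sqmat). ennreal (det x powr r * exp (- trace x))"
  have m: "?g r \<in> borel_measurable pd_mu" for r by (simp add: measurable_pd_mu_iff)
  have "AE x in pd_mu. ?g a x = 0"
    using assms nn_integral_0_iff_AE[OF m] by (simp add: pd_gamma_def)
  then have "AE x in pd_mu. ?g b x = 0"
  proof (rule AE_mp, intro AE_I2 impI)
    fix x :: "'n sqmat" assume "x \<in> space pd_mu" "?g a x = 0"
    then have "det x > 0" "det x powr a * exp (- trace x) \<le> 0"
      by (auto simp: pd_det_pos ennreal_eq_0_iff)
    then show "?g b x = 0" by (simp add: mult_le_0_iff not_le)
  qed
  then show ?thesis unfolding pd_gamma_def by (subst nn_integral_0_iff_AE[OF m])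
qed

lemma pd_inv_add_1: 
  assumes x: "x \<in> pd_mats" shows "pd_pow a (mat 1 + matrix_inv x) = pd_pow a (mat 1 + x) * pd_pow (- a) x"
proof -
  have "x ** (mat 1 + matrix_inv x) = mat 1 + x"
    by (simp add: matrix_add_ldistrib pd_inv_right[OF x] add.commute)
  then have "det (mat 1 + x) = det x * det (mat 1 + matrix_inv x)" by (metis det_mul)
  then have "pd_pow a (mat 1 + x) = pd_pow a x * pd_pow a (mat 1 + matrix_inv x)"
    by (rule pd_pow_prod[OF _ x pd_add[OF mat_1_pd pd_inv[OF x]]])
  then have "pd_pow a (mat 1 + x) * pd_pow (- a) x = (pd_pow a x * pd_pow (- a) x) * pd_pow a (mat 1 + matrix_inv x)"
    by (simp add: mult_ac)
  then show ?thesis by (simp add: pd_pow_add pd_pow_0[OF x])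
qed

text \<open>With t = I + s, the congruence by t^(1/2) turns t + v into t^(1/2) (I + v) t^(1/2), so
  that the powers of det t factor out.\<close>

lemma nn_integral_beta_shift:
  fixes s :: "'n::{finite,wellorder} sqmat"
  assumes s: "s \<in> pd_mats"
  shows "(\<integral>\<^sup>+v. pd_pow (- (\<alpha> + \<beta>)) (mat 1 + (s + v)) * pd_pow \<alpha> v \<partial>pd_mu) =
    pd_pow (- \<beta>) (mat 1 + s) * (\<integral>\<^sup>+v. beta_dens \<alpha> \<beta> v \<partial>(pd_mu :: 'n sqmat measure))"
proof -
  let ?mu = "pd_mu :: 'n sqmat measure"
  define t where "t = mat 1 + s"
  have t: "t \<in> pd_mats" unfolding t_def by (intro pd_add mat_1_pd s)
  let ?F = "\<lambda>v. pd_pow (- (\<alpha> + \<beta>)) (t + v) * pd_pow \<alpha> v"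
  have "(\<integral>\<^sup>+v. pd_pow (- (\<alpha> + \<beta>)) (mat 1 + (s + v)) * pd_pow \<alpha> v \<partial>?mu) = (\<integral>\<^sup>+v. ?F v \<partial>?mu)"
    by (simp add: t_def add.assoc)
  also have "\<dots> = (\<integral>\<^sup>+v. ?F (pd_sqrt t ** v ** pd_sqrt t) \<partial>?mu)"
    by (rule nn_integral_pd_mu_congruence[OF pd_sqrt_pd[OF t], symmetric]) measurable
  also have "\<dots> = (\<integral>\<^sup>+v. pd_pow (- \<beta>) t * beta_dens \<alpha> \<beta> v \<partial>?mu)"
  proof (rule nn_integral_cong)
    fix v assume "v \<in> space ?mu"
    then have v: "v \<in> pd_mats" by simp
    let ?w = "pd_sqrt t ** v ** pd_sqrt t"
    have 1: "pd_pow \<alpha> ?w = pd_pow \<alpha> t * pd_pow \<alpha> v"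
      by (rule pd_pow_prod[OF det_sqrt_congruence[OF t] t v])
    have "det (t + ?w) = det t * det (mat 1 + v)"
      unfolding sqrt_congruence_add_1[OF t, symmetric] by (rule det_sqrt_congruence[OF t])
    then have 2: "pd_pow (- (\<alpha> + \<beta>)) (t + ?w) = pd_pow (- (\<alpha> + \<beta>)) t * pd_pow (- (\<alpha> + \<beta>)) (mat 1 + v)"
      by (rule pd_pow_prod[OF _ t pd_add[OF mat_1_pd v]])
    have 3: "pd_pow (- (\<alpha> + \<beta>)) t * pd_pow \<alpha> t = pd_pow (- \<beta>) t" by (simp add: pd_pow_add)
    show "?F ?w = pd_pow (- \<beta>) t * beta_dens \<alpha> \<beta> v"
      unfolding 1 2 3[symmetric] beta_dens_def by (simp only: mult_ac)
  qed
  also have "\<dots> = pd_pow (- \<beta>) t * (\<integral>\<^sup>+v. beta_dens \<alpha> \<beta> v \<partial>?mu)"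
    by (rule nn_integral_cmult) (simp add: measurable_pd_mu_iff)
  finally show ?thesis by (simp add: t_def)
qed

text \<open>The affine recursion with the power -(\<alpha> + \<beta>) of det (I + u) as
  \<open>\<psi>\<close>: since det (I + x^(-1)) = det (I + x) / det x, the factor of x becomes the
  beta density, and \<open>nn_integral_beta_shift\<close> evaluates the inner integral.\<close>

lemma beta_dens_recursion:
  fixes f :: "'n::{finite,wellorder} sqmat \<Rightarrow> ennreal"
  assumes f[measurable]: "f \<in> borel_measurable pd_borel"
  shows "(\<integral>\<^sup>+x. (\<integral>\<^sup>+z. f (pd_sqrt x ** (mat 1 + z) ** pd_sqrt x) * beta_dens \<alpha> \<beta> x * beta_dens \<alpha> (\<beta> - \<alpha>) z \<partial>pd_mu) \<partial>pd_mu) =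
    (\<integral>\<^sup>+v. beta_dens \<alpha> \<beta> v \<partial>(pd_mu :: 'n sqmat measure)) * (\<integral>\<^sup>+y. f y * beta_dens \<alpha> (\<beta> - \<alpha>) y \<partial>pd_mu)"
proof -
  let ?mu = "pd_mu :: 'n sqmat measure"
  let ?C = "\<integral>\<^sup>+v. beta_dens \<alpha> \<beta> v \<partial>?mu"
  let ?\<psi> = "\<lambda>u :: 'n sqmat. pd_pow (- (\<alpha> + \<beta>)) (mat 1 + u)"
  have 1: "?\<psi> (matrix_inv x) * pd_pow (- \<beta>) x = beta_dens \<alpha> \<beta> x" if "x \<in> pd_mats" for x
    by (simp add: beta_dens_def pd_inv_add_1[OF that] pd_pow_add mult.assoc) (simp add: mult.commute)
  have "(\<integral>\<^sup>+x. (\<integral>\<^sup>+z. f (pd_sqrt x ** (mat 1 + z) ** pd_sqrt x) * beta_dens \<alpha> \<beta> x * beta_dens \<alpha> (\<beta> - \<alpha>) z \<partial>?mu) \<partial>?mu) =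
    (\<integral>\<^sup>+x. \<integral>\<^sup>+z. f (pd_sqrt x ** (mat 1 + z) ** pd_sqrt x) *
      (?\<psi> (matrix_inv x) * pd_pow (- \<beta>) x) * (pd_pow \<alpha> z * pd_pow (- \<beta>) (mat 1 + z)) \<partial>?mu \<partial>?mu)"
  proof (intro nn_integral_cong)
    fix x z :: "'n sqmat" assume "x \<in> space ?mu"
    then have x: "x \<in> pd_mats" by simp
    have "beta_dens \<alpha> (\<beta> - \<alpha>) z = pd_pow \<alpha> z * pd_pow (- \<beta>) (mat 1 + z)"
      by (simp add: beta_dens_def)
    then show "f (pd_sqrt x ** (mat 1 + z) ** pd_sqrt x) * beta_dens \<alpha> \<beta> x * beta_dens \<alpha> (\<beta> - \<alpha>) z =
      f (pd_sqrt x ** (mat 1 + z) ** pd_sqrt x) * (?\<psi> (matrix_inv x) * pd_pow (- \<beta>) x) * (pd_pow \<alpha> z * pd_pow (- \<beta>) (mat 1 + z))"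
      by (simp only: 1[OF x])
  qed
  also have "\<dots> = (\<integral>\<^sup>+y. f y * pd_pow (\<alpha> - \<beta>) y * (\<integral>\<^sup>+v. ?\<psi> (matrix_inv y + v) * pd_pow \<alpha> v \<partial>?mu) \<partial>?mu)"
    by (rule nn_integral_pd_mu_affine_recursion[OF f]) measurable
  also have "\<dots> = (\<integral>\<^sup>+y. ?C * (f y * beta_dens \<alpha> (\<beta> - \<alpha>) y) \<partial>?mu)"
  proof (rule nn_integral_cong)
    fix y assume "y \<in> space ?mu"
    then have y: "y \<in> pd_mats" by simp
    have "f y * pd_pow (\<alpha> - \<beta>) y * (pd_pow (- \<beta>) (mat 1 + matrix_inv y) * ?C) =
       ?C * (f y * ((pd_pow (\<alpha> - \<beta>) y * pd_pow \<beta> y) * pd_pow (- \<beta>) (mat 1 + y)))"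
      by (simp add: pd_inv_add_1[OF y] mult_ac)
    also have "(pd_pow (\<alpha> - \<beta>) y * pd_pow \<beta> y) * pd_pow (- \<beta>) (mat 1 + y) = beta_dens \<alpha> (\<beta> - \<alpha>) y"
      by (simp add: pd_pow_add beta_dens_def)
    finally show "f y * pd_pow (\<alpha> - \<beta>) y * (\<integral>\<^sup>+v. ?\<psi> (matrix_inv y + v) * pd_pow \<alpha> v \<partial>?mu) = ?C * (f y * beta_dens \<alpha> (\<beta> - \<alpha>) y)"
      unfolding nn_integral_beta_shift[OF pd_inv[OF y]] .
  qed
  also have "\<dots> = ?C * (\<integral>\<^sup>+y. f y * beta_dens \<alpha> (\<beta> - \<alpha>) y \<partial>?mu)"
    by (rule nn_integral_cmult) (simp add: measurable_pd_mu_iff)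
  finally show ?thesis .
qed

text \<open>The affine recursion with exp (- trace u) as \<open>\<psi>\<close>: additivity of the
  trace splits the inner integral into exp (- trace y^(-1)) and the gamma function at
  \<alpha>.\<close>

lemma iw_dens_recursion:
  fixes f :: "'n::{finite,wellorder} sqmat \<Rightarrow> ennreal"
  assumes f[measurable]: "f \<in> borel_measurable pd_borel"
  shows "(\<integral>\<^sup>+x. (\<integral>\<^sup>+z. f (pd_sqrt x ** (mat 1 + z) ** pd_sqrt x) * iw_dens \<beta> x * beta_dens \<alpha> (\<beta> - \<alpha>) z \<partial>pd_mu) \<partial>pd_mu) =
    pd_gamma TYPE('n) \<alpha> * (\<integral>\<^sup>+y. f y * iw_dens (\<beta> - \<alpha>) y \<partial>pd_mu)"
proof -
  let ?mu = "pd_mu :: 'n sqmat measure"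
  let ?C = "pd_gamma TYPE('n) \<alpha>"
  let ?\<psi> = "\<lambda>u :: 'n sqmat. ennreal (exp (- trace u))"
  have "(\<integral>\<^sup>+x. (\<integral>\<^sup>+z. f (pd_sqrt x ** (mat 1 + z) ** pd_sqrt x) * iw_dens \<beta> x * beta_dens \<alpha> (\<beta> - \<alpha>) z \<partial>?mu) \<partial>?mu) =
    (\<integral>\<^sup>+x. \<integral>\<^sup>+z. f (pd_sqrt x ** (mat 1 + z) ** pd_sqrt x) *
      (?\<psi> (matrix_inv x) * pd_pow (- \<beta>) x) * (pd_pow \<alpha> z * pd_pow (- \<beta>) (mat 1 + z)) \<partial>?mu \<partial>?mu)"
    by (simp add: beta_dens_def iw_dens_def mult_ac)
  also have "\<dots> = (\<integral>\<^sup>+y. f y * pd_pow (\<alpha> - \<beta>) y * (\<integral>\<^sup>+v. ?\<psi> (matrix_inv y + v) * pd_pow \<alpha> v \<partial>?mu) \<partial>?mu)"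
    by (rule nn_integral_pd_mu_affine_recursion[OF f]) measurable
  also have "\<dots> = (\<integral>\<^sup>+y. ?C * (f y * iw_dens (\<beta> - \<alpha>) y) \<partial>?mu)"
  proof (rule nn_integral_cong)
    fix y assume "y \<in> space ?mu"
    have "(\<integral>\<^sup>+v. ?\<psi> (matrix_inv y + v) * pd_pow \<alpha> v \<partial>?mu) =
        (\<integral>\<^sup>+v. ?\<psi> (matrix_inv y) * ennreal (det v powr \<alpha> * exp (- trace v)) \<partial>?mu)"
      by (intro nn_integral_cong) (simp add: pd_pow_def trace_add exp_diff exp_minus field_simps flip: ennreal_mult)
    also have "\<dots> = ?\<psi> (matrix_inv y) * ?C"
      unfolding pd_gamma_def by (rule nn_integral_cmult) (simp add: measurable_pd_mu_iff)
    finally show "f y * pd_pow (\<alpha> - \<beta>) y * (\<integral>\<^sup>+v. ?\<psi> (matrix_inv y + v) * pd_pow \<alpha> v \<partial>?mu) = ?C * (f y * iw_dens (\<beta> - \<alpha>) y)"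
      by (simp add: iw_dens_def mult_ac)
  qed
  also have "\<dots> = ?C * (\<integral>\<^sup>+y. f y * iw_dens (\<beta> - \<alpha>) y \<partial>?mu)"
    by (rule nn_integral_cmult) (simp add: measurable_pd_mu_iff)
  finally show ?thesis .
qed

section \<open>Normalising constants and the two identities in law\<close>

lemma prob_space_density_cmult_iff:
  assumes g: "g \<in> borel_measurable M"
  shows "prob_space (density M (\<lambda>x. c * g x)) \<longleftrightarrow> c * (\<integral>\<^sup>+x. g x \<partial>M) = 1"
proof -
  have "emeasure (density M (\<lambda>x. c * g x)) (space M) = (\<integral>\<^sup>+x. c * g x * indicator (space M) x \<partial>M)"
    using g by (intro emeasure_density) auto
  also have "\<dots> = (\<integral>\<^sup>+x. c * g x \<partial>M)"
    by (intro nn_integral_cong) simp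
  also have "\<dots> = c * (\<integral>\<^sup>+x. g x \<partial>M)" by (rule nn_integral_cmult[OF g])
  finally show ?thesis
    using prob_space.emeasure_space_1[of "density M (\<lambda>x. c * g x)"]
      prob_spaceI[of "density M (\<lambda>x. c * g x)"] by auto
qed

lemma beta_II_normalization:
  assumes "prob_space (beta_II a b :: 'n::{finite,wellorder} sqmat measure)"
  shows "ennreal (inverse (mv_beta TYPE('n) a b)) * (\<integral>\<^sup>+x. beta_dens a b x \<partial>(pd_mu :: 'n sqmat measure)) = 1"
  using assms unfolding beta_II_eq by (subst (asm) prob_space_density_cmult_iff) (simp_all add: measurable_pd_mu_iff)

lemma inv_wishart_normalization:
  assumes "prob_space (inv_wishart b :: 'n::{finite,wellorder} sqmat measure)"
  shows "ennreal (inverse (mv_gamma TYPE('n) b)) * pd_gamma TYPE('n) b = 1"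
  using assms unfolding inv_wishart_eq nn_integral_iw_dens[symmetric]
  by (subst (asm) prob_space_density_cmult_iff) (simp_all add: measurable_pd_mu_iff)

text \<open>The case f = 1 of \<open>iw_dens_recursion\<close>. Once the gamma values are positive
  and finite, it shows that \<open>mv_beta\<close> at \<alpha>, \<beta> - \<alpha> is the mass of
  the beta density.\<close>

lemma nn_integral_iw_beta_mass:
  "pd_gamma TYPE('n::{finite,wellorder}) \<beta> * (\<integral>\<^sup>+z. beta_dens \<alpha> (\<beta> - \<alpha>) z \<partial>(pd_mu :: 'n sqmat measure)) =
    pd_gamma TYPE('n) \<alpha> * pd_gamma TYPE('n) (\<beta> - \<alpha>)"
proof -
  let ?mu = "pd_mu :: 'n sqmat measure"
  have "(\<integral>\<^sup>+x. (\<integral>\<^sup>+z. 1 * iw_dens \<beta> x * beta_dens \<alpha> (\<beta> - \<alpha>) z \<partial>?mu) \<partial>?mu) =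
      (\<integral>\<^sup>+x. iw_dens \<beta> x * (\<integral>\<^sup>+z. beta_dens \<alpha> (\<beta> - \<alpha>) z \<partial>?mu) \<partial>?mu)"
    by (intro nn_integral_cong) (simp add: nn_integral_cmult measurable_pd_mu_iff)
  also have "\<dots> = pd_gamma TYPE('n) \<beta> * (\<integral>\<^sup>+z. beta_dens \<alpha> (\<beta> - \<alpha>) z \<partial>?mu)"
    by (subst nn_integral_multc) (simp_all add: measurable_pd_mu_iff nn_integral_iw_dens)
  finally show ?thesis
    using iw_dens_recursion[of "\<lambda>_ :: 'n sqmat. 1", where \<alpha>=\<alpha> and \<beta>=\<beta>] by (simp add: nn_integral_iw_dens)
qed

text \<open>Since \<open>inverse 0 = 0\<close>, a vanishing constant would turn
  \<open>inv_wishart \<beta>\<close> or \<open>beta_II \<alpha> \<beta>\<close> into the zero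
  measure; this settles \<beta> and \<alpha>. At \<beta> - \<alpha> finiteness comes from
  \<open>pd_gamma_finite\<close> and positivity from \<open>pd_gamma_eq_0\<close>.\<close>

lemma beta_gamma_constants:
  fixes \<alpha> \<beta> :: real
  assumes \<alpha>: "\<alpha> > (real CARD('n::{finite,wellorder}) - 1) / 2" and \<beta>\<alpha>: "\<beta> - \<alpha> > (real CARD('n) - 1) / 2"
    and iw: "prob_space (inv_wishart \<beta> :: 'n sqmat measure)"
    and be: "prob_space (beta_II \<alpha> \<beta> :: 'n sqmat measure)"
  shows "\<And>r. r \<in> {\<alpha>, \<beta>, \<beta> - \<alpha>} \<Longrightarrow> mv_gamma TYPE('n) r > 0 \<and> pd_gamma TYPE('n) r = ennreal (mv_gamma TYPE('n) r)"
    and "(\<integral>\<^sup>+z. beta_dens \<alpha> (\<beta> - \<alpha>) z \<partial>(pd_mu :: 'n sqmat measure)) =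
      ennreal (mv_gamma TYPE('n) \<alpha> * mv_gamma TYPE('n) (\<beta> - \<alpha>) / mv_gamma TYPE('n) \<beta>)"
proof -
  let ?T = "TYPE('n)"
  let ?B = "\<integral>\<^sup>+z. beta_dens \<alpha> (\<beta> - \<alpha>) z \<partial>(pd_mu :: 'n sqmat measure)"
  \<comment> \<open>d \<ge> 1 makes \<alpha> positive, hence \<beta> - \<alpha> < \<beta>, as the
    interpolation requires.\<close>
  have "real CARD('n) \<ge> 1" using zero_less_card_finite[where 'a='n] by (simp add: Suc_le_eq)
  then have "0 \<le> (real CARD('n) - 1) / 2" by simp
  then have \<alpha>0: "\<alpha> > 0" using \<alpha> by (rule le_less_trans)
  have pos: "pd_gamma ?T r = ennreal (mv_gamma ?T r) \<and> mv_gamma ?T r > 0" if "mv_gamma ?T r \<noteq> 0" for r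
    using that by (auto simp: mv_gamma_eq enn2real_eq_0_iff enn2real_positive_iff less_top zero_less_iff_neq_zero)
  have "mv_gamma ?T \<beta> \<noteq> 0"
    using inv_wishart_normalization[OF iw] by auto
  then have b: "pd_gamma ?T \<beta> = ennreal (mv_gamma ?T \<beta>)" "mv_gamma ?T \<beta> > 0" using pos by auto
  have "mv_beta ?T \<alpha> \<beta> \<noteq> 0"
    using beta_II_normalization[OF be] by auto
  then have "mv_gamma ?T \<alpha> \<noteq> 0" by (auto simp: mv_beta_def)
  then have a: "pd_gamma ?T \<alpha> = ennreal (mv_gamma ?T \<alpha>)" "mv_gamma ?T \<alpha> > 0" using pos by auto
  have "pd_gamma ?T (\<beta> - \<alpha>) < \<infinity>"
    by (rule pd_gamma_finite[OF \<beta>\<alpha>, of \<beta>]) (use \<alpha>0 b in auto)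
  moreover have "pd_gamma ?T (\<beta> - \<alpha>) \<noteq> 0" using pd_gamma_eq_0[of ?T "\<beta> - \<alpha>" \<beta>] b by auto
  ultimately have "mv_gamma ?T (\<beta> - \<alpha>) \<noteq> 0" by (auto simp: mv_gamma_eq enn2real_eq_0_iff)
  then have c: "pd_gamma ?T (\<beta> - \<alpha>) = ennreal (mv_gamma ?T (\<beta> - \<alpha>))" "mv_gamma ?T (\<beta> - \<alpha>) > 0" using pos by auto
  have eq: "ennreal (mv_gamma ?T \<beta>) * ?B = ennreal (mv_gamma ?T \<alpha> * mv_gamma ?T (\<beta> - \<alpha>))"
    using nn_integral_iw_beta_mass[where \<beta>=\<beta> and \<alpha>=\<alpha> and 'n='n] a b c by (simp add: ennreal_mult)
  have "?B = ennreal (mv_gamma ?T \<alpha> * mv_gamma ?T (\<beta> - \<alpha>)) / ennreal (mv_gamma ?T \<beta>)"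
    using eq b(2) by (metis ennreal_0 ennreal_mult_divide_eq ennreal_neq_top mult.commute less_irrefl ennreal_inj less_imp_le order_refl)
  also have "\<dots> = ennreal (mv_gamma ?T \<alpha> * mv_gamma ?T (\<beta> - \<alpha>) / mv_gamma ?T \<beta>)"
    using a b c by (intro divide_ennreal) (auto intro: mult_nonneg_nonneg less_imp_le)
  finally show "?B = ennreal (mv_gamma ?T \<alpha> * mv_gamma ?T (\<beta> - \<alpha>) / mv_gamma ?T \<beta>)" .
  show "mv_gamma ?T r > 0 \<and> pd_gamma ?T r = ennreal (mv_gamma ?T r)" if "r \<in> {\<alpha>, \<beta>, \<beta> - \<alpha>}" for r
    using that a b c by auto
qed

lemma
  fixes \<alpha> \<beta> :: real
  assumes \<alpha>: "\<alpha> > (real CARD('n::{finite,wellorder}) - 1) / 2" and \<beta>\<alpha>: "\<beta> - \<alpha> > (real CARD('n) - 1) / 2"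
    and iw: "prob_space (inv_wishart \<beta> :: 'n sqmat measure)"
    and be: "prob_space (beta_II \<alpha> \<beta> :: 'n sqmat measure)"
  shows prob_space_beta_II_diff: "prob_space (beta_II \<alpha> (\<beta> - \<alpha>) :: 'n sqmat measure)" (is ?p1)
    and prob_space_inv_wishart_diff: "prob_space (inv_wishart (\<beta> - \<alpha>) :: 'n sqmat measure)" (is ?p2)
    and nn_integral_beta_II_fixpoint: "\<And>f :: 'n sqmat \<Rightarrow> ennreal. f \<in> borel_measurable pd_borel \<Longrightarrow>
      (\<integral>\<^sup>+x. (\<integral>\<^sup>+z. f (pd_sqrt x ** (mat 1 + z) ** pd_sqrt x) \<partial>beta_II \<alpha> (\<beta> - \<alpha>)) \<partial>beta_II \<alpha> \<beta>) =
      (\<integral>\<^sup>+z. f z \<partial>beta_II \<alpha> (\<beta> - \<alpha>))" (is "\<And>f. _ \<Longrightarrow> ?p3 f")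
    and nn_integral_inv_wishart_beta_II: "\<And>f :: 'n sqmat \<Rightarrow> ennreal. f \<in> borel_measurable pd_borel \<Longrightarrow>
      (\<integral>\<^sup>+x. (\<integral>\<^sup>+z. f (pd_sqrt x ** (mat 1 + z) ** pd_sqrt x) \<partial>beta_II \<alpha> (\<beta> - \<alpha>)) \<partial>inv_wishart \<beta>) =
      (\<integral>\<^sup>+z. f z \<partial>inv_wishart (\<beta> - \<alpha>))" (is "\<And>f. _ \<Longrightarrow> ?p4 f")
proof -
  let ?mu = "pd_mu :: 'n sqmat measure"
  define a b c where "a = mv_gamma TYPE('n) \<alpha>" and "b = mv_gamma TYPE('n) \<beta>" and "c = mv_gamma TYPE('n) (\<beta> - \<alpha>)"
  note const = beta_gamma_constants[OF \<alpha> \<beta>\<alpha> iw be]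
  have abc: "a > 0" "b > 0" "c > 0" "mv_gamma TYPE('n) \<alpha> = a" "mv_gamma TYPE('n) \<beta> = b" "mv_gamma TYPE('n) (\<beta> - \<alpha>) = c"
    "pd_gamma TYPE('n) \<alpha> = ennreal a" "pd_gamma TYPE('n) \<beta> = ennreal b" "pd_gamma TYPE('n) (\<beta> - \<alpha>) = ennreal c"
    using const(1)[of \<alpha>] const(1)[of \<beta>] const(1)[of "\<beta> - \<alpha>"] by (simp_all add: a_def b_def c_def)
  have B: "(\<integral>\<^sup>+z. beta_dens \<alpha> (\<beta> - \<alpha>) z \<partial>?mu) = ennreal (a * c / b)"
    using const(2) by (simp only: abc)
  have mvb: "inverse (mv_beta TYPE('n) \<alpha> (\<beta> - \<alpha>)) = b / (a * c)"
    by (simp add: mv_beta_def abc)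
  show ?p1
    unfolding beta_II_eq mvb using abc
    by (subst prob_space_density_cmult_iff) (auto simp: B measurable_pd_mu_iff ennreal_mult[symmetric])
  show ?p2
    unfolding inv_wishart_eq abc(6) using abc
    by (subst prob_space_density_cmult_iff) (auto simp: nn_integral_iw_dens measurable_pd_mu_iff ennreal_mult[symmetric])
  fix f :: "'n sqmat \<Rightarrow> ennreal" assume f[measurable]: "f \<in> borel_measurable pd_borel"
  have cm: "(\<lambda>p. pd_sqrt (fst p) ** (mat 1 + snd p) ** pd_sqrt (fst p)) \<in> measurable (pd_borel \<Otimes>\<^sub>M pd_borel) (pd_borel :: 'n sqmat measure)"
  proof -
    have "(\<lambda>p. pd_sqrt (fst p) ** (mat 1 + snd p) ** pd_sqrt (fst p)) \<in> borel_measurable (pd_borel \<Otimes>\<^sub>M (pd_borel :: 'n sqmat measure))"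
      by measurable
    then show ?thesis
      by (auto simp: measurable_pd_borel_iff space_pair_measure intro!: pd_congruence_pd pd_sqrt_pd pd_add mat_1_pd)
  qed
  let ?f = "\<lambda>x z. f (pd_sqrt x ** (mat 1 + z) ** pd_sqrt x)"
  have fm2: "(\<lambda>p. ?f (fst p) (snd p)) \<in> borel_measurable (pd_borel \<Otimes>\<^sub>M pd_borel)"
    by (rule measurable_compose[OF cm f])
  have fz: "(\<lambda>z. ?f x z) \<in> borel_measurable pd_borel" if x: "x \<in> pd_mats" for x
    using measurable_compose[OF measurable_Pair1' fm2, of x] x by simp
  have fmu: "(\<lambda>x. \<integral>\<^sup>+z. ?f x z * beta_dens \<alpha> (\<beta> - \<alpha>) z \<partial>?mu) \<in> borel_measurable pd_borel"
  proof (rule sigma_finite_measure.borel_measurable_nn_integral[OF sigma_finite_pd_mu])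
    have "(\<lambda>p. ?f (fst p) (snd p) * beta_dens \<alpha> (\<beta> - \<alpha>) (snd p)) \<in> borel_measurable (pd_borel \<Otimes>\<^sub>M pd_borel)"
      using fm2 by measurable
    then show "(\<lambda>(x, z). ?f x z * beta_dens \<alpha> (\<beta> - \<alpha>) z) \<in> borel_measurable (pd_borel \<Otimes>\<^sub>M ?mu)"
      by (simp add: case_prod_beta' measurable_cong_sets[OF sets_pair_measure_cong[OF refl sets_pd_mu] refl])
  qed
  have step: "c1 * (\<integral>\<^sup>+x. (\<integral>\<^sup>+z. ?f x z \<partial>beta_II \<alpha> (\<beta> - \<alpha>)) * g x \<partial>?mu) =
     c1 * ennreal (b / (a * c)) * (\<integral>\<^sup>+x. (\<integral>\<^sup>+z. ?f x z * g x * beta_dens \<alpha> (\<beta> - \<alpha>) z \<partial>?mu) \<partial>?mu)"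
    if g: "g \<in> borel_measurable pd_borel" for g c1
  proof -
    have "(\<integral>\<^sup>+x. (\<integral>\<^sup>+z. ?f x z \<partial>beta_II \<alpha> (\<beta> - \<alpha>)) * g x \<partial>?mu) =
        (\<integral>\<^sup>+x. ennreal (b / (a * c)) * ((\<integral>\<^sup>+z. ?f x z * beta_dens \<alpha> (\<beta> - \<alpha>) z \<partial>?mu) * g x) \<partial>?mu)"
      by (intro nn_integral_cong) (simp add: nn_integral_beta_II fz mvb mult.assoc)
    also have "\<dots> = ennreal (b / (a * c)) * (\<integral>\<^sup>+x. (\<integral>\<^sup>+z. ?f x z * beta_dens \<alpha> (\<beta> - \<alpha>) z \<partial>?mu) * g x \<partial>?mu)"
      using fmu g by (intro nn_integral_cmult) (simp add: measurable_pd_mu_iff)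
    also have "(\<integral>\<^sup>+x. (\<integral>\<^sup>+z. ?f x z * beta_dens \<alpha> (\<beta> - \<alpha>) z \<partial>?mu) * g x \<partial>?mu) =
        (\<integral>\<^sup>+x. (\<integral>\<^sup>+z. ?f x z * g x * beta_dens \<alpha> (\<beta> - \<alpha>) z \<partial>?mu) \<partial>?mu)"
    proof (rule nn_integral_cong)
      fix x assume "x \<in> space ?mu"
      then have x: "x \<in> pd_mats" by simp
      have "(\<lambda>z. ?f x z * beta_dens \<alpha> (\<beta> - \<alpha>) z) \<in> borel_measurable ?mu"
        using fz[OF x] by (simp add: measurable_pd_mu_iff)
      then have "(\<integral>\<^sup>+z. ?f x z * beta_dens \<alpha> (\<beta> - \<alpha>) z \<partial>?mu) * g x = (\<integral>\<^sup>+z. ?f x z * beta_dens \<alpha> (\<beta> - \<alpha>) z * g x \<partial>?mu)"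
        by (simp add: nn_integral_multc)
      then show "(\<integral>\<^sup>+z. ?f x z * beta_dens \<alpha> (\<beta> - \<alpha>) z \<partial>?mu) * g x = (\<integral>\<^sup>+z. ?f x z * g x * beta_dens \<alpha> (\<beta> - \<alpha>) z \<partial>?mu)"
        by (simp add: mult_ac)
    qed
    finally show ?thesis by (simp add: mult.assoc)
  qed
  have fmu': "(\<lambda>x. \<integral>\<^sup>+z. ?f x z \<partial>beta_II \<alpha> (\<beta> - \<alpha>)) \<in> borel_measurable pd_borel"
  proof (rule measurable_cong[THEN iffD2])
    show "(\<integral>\<^sup>+z. ?f x z \<partial>beta_II \<alpha> (\<beta> - \<alpha>)) = ennreal (b / (a * c)) * (\<integral>\<^sup>+z. ?f x z * beta_dens \<alpha> (\<beta> - \<alpha>) z \<partial>?mu)"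
      if "x \<in> space pd_borel" for x using that by (simp add: nn_integral_beta_II fz mvb)
    show "(\<lambda>x. ennreal (b / (a * c)) * (\<integral>\<^sup>+z. ?f x z * beta_dens \<alpha> (\<beta> - \<alpha>) z \<partial>?mu)) \<in> borel_measurable pd_borel"
      using fmu by simp
  qed
  let ?c1 = "ennreal (inverse (mv_beta TYPE('n) \<alpha> \<beta>))"
  let ?C1 = "\<integral>\<^sup>+v. beta_dens \<alpha> \<beta> v \<partial>?mu"
  have "(\<integral>\<^sup>+x. (\<integral>\<^sup>+z. ?f x z \<partial>beta_II \<alpha> (\<beta> - \<alpha>)) \<partial>beta_II \<alpha> \<beta>) =
      ?c1 * (\<integral>\<^sup>+x. (\<integral>\<^sup>+z. ?f x z \<partial>beta_II \<alpha> (\<beta> - \<alpha>)) * beta_dens \<alpha> \<beta> x \<partial>?mu)"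
    by (rule nn_integral_beta_II[OF fmu'])
  also have "\<dots> = ?c1 * ennreal (b / (a * c)) * (?C1 * (\<integral>\<^sup>+y. f y * beta_dens \<alpha> (\<beta> - \<alpha>) y \<partial>?mu))"
    by (simp only: step[OF beta_dens_measurable] beta_dens_recursion[OF f])
  also have "\<dots> = (?c1 * ?C1) * (ennreal (b / (a * c)) * (\<integral>\<^sup>+y. f y * beta_dens \<alpha> (\<beta> - \<alpha>) y \<partial>?mu))"
    by (simp only: mult_ac)
  also have "\<dots> = (\<integral>\<^sup>+z. f z \<partial>beta_II \<alpha> (\<beta> - \<alpha>))"
    by (simp only: beta_II_normalization[OF be] nn_integral_beta_II[OF f] mvb mult_1)
  finally show "?p3 f" .
  have "(\<integral>\<^sup>+x. (\<integral>\<^sup>+z. ?f x z \<partial>beta_II \<alpha> (\<beta> - \<alpha>)) \<partial>inv_wishart \<beta>) =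
      ennreal (inverse b) * (\<integral>\<^sup>+x. (\<integral>\<^sup>+z. ?f x z \<partial>beta_II \<alpha> (\<beta> - \<alpha>)) * iw_dens \<beta> x \<partial>?mu)"
    unfolding abc(5)[symmetric] by (rule nn_integral_inv_wishart[OF fmu'])
  also have "\<dots> = ennreal (inverse b) * ennreal (b / (a * c)) * (ennreal a * (\<integral>\<^sup>+y. f y * iw_dens (\<beta> - \<alpha>) y \<partial>?mu))"
    by (simp only: step[OF iw_dens_measurable] iw_dens_recursion[OF f] abc)
  also have "\<dots> = (ennreal (inverse b) * ennreal (b / (a * c)) * ennreal a) * (\<integral>\<^sup>+y. f y * iw_dens (\<beta> - \<alpha>) y \<partial>?mu)"
    by (simp only: mult_ac)
  also have "ennreal (inverse b) * ennreal (b / (a * c)) * ennreal a = ennreal (inverse c)"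
    using abc(1-3) by (simp add: ennreal_mult[symmetric] field_simps)
  also have "ennreal (inverse c) * (\<integral>\<^sup>+y. f y * iw_dens (\<beta> - \<alpha>) y \<partial>?mu) = (\<integral>\<^sup>+z. f z \<partial>inv_wishart (\<beta> - \<alpha>))"
    unfolding abc(6)[symmetric] by (rule nn_integral_inv_wishart[OF f, symmetric])
  finally show "?p4 f" .
qed

text \<open>Orthogonal congruence changes neither det z nor det (I + z), and it preserves
  \<open>pd_mu\<close>.\<close>

lemma nn_integral_beta_II_orthogonal:
  fixes f :: "'n::{finite,wellorder} sqmat \<Rightarrow> ennreal"
  assumes k: "orthogonal_matrix k" and f: "f \<in> borel_measurable pd_borel"
  shows "(\<integral>\<^sup>+z. f (k ** z ** transpose k) \<partial>beta_II a b) = (\<integral>\<^sup>+z. f z \<partial>beta_II a b)"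
proof -
  have "(\<lambda>x. k ** x ** transpose k) \<in> measurable pd_borel pd_borel"
    using k by (auto simp: measurable_pd_borel_iff pd_orthogonal_congruence_iff)
  from measurable_compose[OF this f] have fk: "(\<lambda>x. f (k ** x ** transpose k)) \<in> borel_measurable pd_borel" .
  have "k ** transpose k = mat 1" using k by (simp add: orthogonal_matrix_def)
  then have "mat 1 + k ** z ** transpose k = k ** (mat 1 + z) ** transpose k" for z
    by (simp add: matrix_add_ldistrib matrix_mult_add_rdistrib)
  then have d: "beta_dens a b (k ** z ** transpose k) = beta_dens a b z" for z
    by (simp add: beta_dens_def pd_pow_def det_orthogonal_congruence[OF k])
  show ?thesis
    unfolding nn_integral_beta_II[OF f] nn_integral_beta_II[OF fk]
    using nn_integral_pd_mu_orthogonal[OF k, of "\<lambda>z. f z * beta_dens a b z"] f by (simp add: d)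
qed

section \<open>The random walk\<close>

lemma sqrt_congruence_measurable:
  fixes f g :: "'a \<Rightarrow> 'n::{finite,wellorder} sqmat"
  assumes f: "f \<in> measurable M pd_borel" and g: "g \<in> measurable M pd_borel"
  shows "(\<lambda>x. pd_sqrt (f x) ** g x ** pd_sqrt (f x)) \<in> measurable M pd_borel"
proof -
  have s: "(\<lambda>x. pd_sqrt (f x)) \<in> borel_measurable M"
    by (rule measurable_compose[OF f pd_sqrt_borel_measurable])
  show ?thesis
    unfolding measurable_pd_borel_iff
  proof
    show "(\<lambda>x. pd_sqrt (f x) ** g x ** pd_sqrt (f x)) \<in> borel_measurable M"
      by (intro borel_measurable_matrix_mult s measurable_pd_borelD[OF g])
    show "(\<lambda>x. pd_sqrt (f x) ** g x ** pd_sqrt (f x)) \<in> space M \<rightarrow> pd_mats"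
      using f g by (auto simp: measurable_pd_borel_iff Pi_iff intro!: pd_congruence_pd pd_sqrt_pd)
  qed
qed

lemma walk_pd: "r \<in> pd_mats \<Longrightarrow> (\<And>i. i \<in> {1..n} \<Longrightarrow> x i \<in> pd_mats) \<Longrightarrow> walk r x n \<in> pd_mats"
  by (induction n) (auto intro!: pd_congruence_pd pd_sqrt_pd)

lemma walk_cong: "(\<And>i. i \<in> {1..n} \<Longrightarrow> x i = y i) \<Longrightarrow> walk r x n = walk r y n"
  by (induction n) auto

lemma walk_measurable:
  assumes "r \<in> measurable M pd_borel" "\<And>i. i \<in> {1..n} \<Longrightarrow> x i \<in> measurable M pd_borel"
  shows "(\<lambda>\<omega>. walk (r \<omega>) (\<lambda>i. x i \<omega>) n) \<in> measurable M pd_borel"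
  using assms by (induction n) (auto intro!: sqrt_congruence_measurable)

lemma pd_sum_measurable:
  fixes f :: "nat \<Rightarrow> 'a \<Rightarrow> 'n::{finite,wellorder} sqmat"
  assumes "\<And>k. k \<le> n \<Longrightarrow> f k \<in> measurable M pd_borel"
  shows "(\<lambda>\<omega>. \<Sum>k\<le>n. f k \<omega>) \<in> measurable M pd_borel"
  using assms by (induction n) (auto intro!: pd_add_measurable)

text \<open>The conditional expectation of f at A(n) + R(n)^(1/2) Z R(n)^(1/2) given R(n) = s and
  A(n) = y. With Z integrated out, everything takes place on the space of the walk.\<close>

definition beta_avg :: "real \<Rightarrow> real \<Rightarrow> ('n::{finite,wellorder} sqmat \<Rightarrow> ennreal) \<Rightarrow> 'n sqmat \<Rightarrow> 'n sqmat \<Rightarrow> ennreal" where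
  "beta_avg a b f s y = (\<integral>\<^sup>+z. f (y + pd_sqrt s ** z ** pd_sqrt s) \<partial>beta_II a b)"

text \<open>With \<open>s' = s\<^bsup>1/2\<^esup> x s\<^bsup>1/2\<^esup>\<close>, the square root of \<open>s'\<close> equals \<open>s\<^bsup>1/2\<^esup> x\<^bsup>1/2\<^esup>\<close> up to an
  orthogonal factor, which the orthogonally invariant law of \<open>z\<close> absorbs.\<close>

lemma nn_integral_beta_II_sqrt:
  fixes F :: "'n::{finite,wellorder} sqmat \<Rightarrow> ennreal"
  assumes F: "F \<in> borel_measurable pd_borel" and s: "s \<in> pd_mats" and x: "x \<in> pd_mats"
  shows "(\<integral>\<^sup>+z. F (pd_sqrt (pd_sqrt s ** x ** pd_sqrt s) ** (mat 1 + z) ** pd_sqrt (pd_sqrt s ** x ** pd_sqrt s)) \<partial>beta_II a b) =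
    (\<integral>\<^sup>+z. F (pd_sqrt s ** (pd_sqrt x ** (mat 1 + z) ** pd_sqrt x) ** pd_sqrt s) \<partial>beta_II a b)"
proof -
  define s' where "s' = pd_sqrt s ** x ** pd_sqrt s"
  have s': "s' \<in> pd_mats" unfolding s'_def by (intro pd_congruence_pd pd_sqrt_pd s x)
  define g where "g = pd_sqrt s ** pd_sqrt x"
  have tg: "transpose g = pd_sqrt x ** pd_sqrt s"
    by (simp add: g_def matrix_transpose_mul pd_symmetric pd_sqrt_pd s x)
  have gg: "g ** transpose g = s'"
  proof -
    have "g ** transpose g = pd_sqrt s ** (pd_sqrt x ** pd_sqrt x) ** pd_sqrt s"
      unfolding tg by (simp add: g_def matrix_mul_assoc)
    then show ?thesis by (simp add: pd_sqrt_mult[OF x] s'_def)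
  qed
  let ?i = "matrix_inv (pd_sqrt s')"
  have ti: "transpose ?i = ?i" by (intro pd_symmetric pd_inv pd_sqrt_pd s')
  \<comment> \<open>The orthogonal factor in the polar decomposition of g, whose Gram matrix g g^T
    is s'.\<close>
  define k where "k = ?i ** g"
  have "k ** transpose k = ?i ** (g ** transpose g) ** ?i"
    by (simp add: k_def matrix_transpose_mul ti matrix_mul_assoc)
  also have "\<dots> = mat 1" unfolding gg by (rule sqrt_congruence_inverse[OF s'])
  finally have kk: "k ** transpose k = mat 1" .
  then have k: "orthogonal_matrix k" "orthogonal_matrix (transpose k)"
    using matrix_left_right_inverse[of k "transpose k"] by (auto simp: orthogonal_matrix_def)
  have sk: "pd_sqrt s' ** k = g"
    by (simp add: k_def matrix_mul_assoc pd_inv_right pd_sqrt_pd s')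
  have tsk: "transpose k ** pd_sqrt s' = transpose g"
    unfolding sk[symmetric] by (simp add: matrix_transpose_mul pd_symmetric pd_sqrt_pd s')
  let ?H = "\<lambda>z. F (pd_sqrt s' ** (mat 1 + z) ** pd_sqrt s')"
  have Hm: "?H \<in> borel_measurable pd_borel"
  proof (rule measurable_compose[OF _ F])
    have "(\<lambda>z. pd_sqrt s' ** (mat 1 + z) ** pd_sqrt s') \<in> borel_measurable pd_borel" by measurable
    then show "(\<lambda>z. pd_sqrt s' ** (mat 1 + z) ** pd_sqrt s') \<in> measurable pd_borel pd_borel"
      using s' by (auto simp: measurable_pd_borel_iff intro!: pd_congruence_pd pd_sqrt_pd pd_add mat_1_pd)
  qed
  have "?H (k ** z ** transpose k) = F (pd_sqrt s ** (pd_sqrt x ** (mat 1 + z) ** pd_sqrt x) ** pd_sqrt s)" for z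
  proof -
    have "mat 1 + k ** z ** transpose k = k ** (mat 1 + z) ** transpose k"
      by (simp add: matrix_add_ldistrib matrix_mult_add_rdistrib kk)
    then have "pd_sqrt s' ** (mat 1 + k ** z ** transpose k) ** pd_sqrt s' = (pd_sqrt s' ** k) ** (mat 1 + z) ** (transpose k ** pd_sqrt s')"
      by (simp add: matrix_mul_assoc)
    also have "\<dots> = pd_sqrt s ** (pd_sqrt x ** (mat 1 + z) ** pd_sqrt x) ** pd_sqrt s"
      unfolding sk tsk tg by (simp add: g_def matrix_mul_assoc)
    finally show ?thesis by simp
  qed
  then show ?thesis
    using nn_integral_beta_II_orthogonal[OF k(1) Hm, of a b] by (simp add: s'_def)
qed

lemma beta_avg_measurable:
  fixes f :: "'n::{finite,wellorder} sqmat \<Rightarrow> ennreal"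
  assumes f: "f \<in> borel_measurable pd_borel" and p: "prob_space (beta_II a b :: 'n sqmat measure)"
    and S: "S \<in> measurable M pd_borel" and Y: "Y \<in> measurable M pd_borel"
  shows "(\<lambda>\<omega>. beta_avg a b f (S \<omega>) (Y \<omega>)) \<in> borel_measurable M"
proof -
  let ?K = "beta_II a b :: 'n sqmat measure"
  interpret K: prob_space ?K by (rule p)
  have snd: "snd \<in> measurable (M \<Otimes>\<^sub>M ?K) pd_borel"
    using measurable_snd[of M ?K] by (simp only: measurable_cong_sets[OF refl sets_beta_II])
  have "(\<lambda>q. Y (fst q) + pd_sqrt (S (fst q)) ** snd q ** pd_sqrt (S (fst q))) \<in> measurable (M \<Otimes>\<^sub>M ?K) pd_borel"
    by (intro pd_add_measurable sqrt_congruence_measurable snd measurable_compose[OF measurable_fst S] measurable_compose[OF measurable_fst Y])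
  from measurable_compose[OF this f]
  have "(\<lambda>(\<omega>, z). f (Y \<omega> + pd_sqrt (S \<omega>) ** z ** pd_sqrt (S \<omega>))) \<in> borel_measurable (M \<Otimes>\<^sub>M ?K)"
    by (simp add: case_prod_beta')
  then show ?thesis unfolding beta_avg_def by (rule K.borel_measurable_nn_integral)
qed

lemma random_walk_measurable:
  assumes "GL_random_walk M R N R0 X"
  shows "R0 \<in> measurable N pd_borel" "n \<ge> 1 \<Longrightarrow> X n \<in> measurable N pd_borel"
proof -
  interpret N: prob_space N using assms by (simp add: GL_random_walk_def)
  have "N.indep_vars (\<lambda>_. pd_borel) (X(0 := R0)) UNIV" using assms by (simp add: GL_random_walk_def)
  then have "(X(0 := R0)) i \<in> measurable N pd_borel" for i unfolding N.indep_vars_def by auto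
  from this[of 0] this[of n] show "R0 \<in> measurable N pd_borel" "n \<ge> 1 \<Longrightarrow> X n \<in> measurable N pd_borel" by auto
qed

text \<open>The state and the partial sum at time n are functions of the initial state and the first
  n increments, hence independent of X(n+1); the expectation is an iterated integral over the
  product law.\<close>

lemma nn_integral_walk_step:
  fixes R0 :: "'b \<Rightarrow> 'n::{finite,wellorder} sqmat"
    and \<phi> :: "'n sqmat \<Rightarrow> 'n sqmat \<Rightarrow> 'n sqmat \<Rightarrow> ennreal"
  assumes rw: "GL_random_walk M R N R0 X"
    and \<phi>: "(\<lambda>((s, y), x). \<phi> s y x) \<in> borel_measurable ((pd_borel \<Otimes>\<^sub>M pd_borel) \<Otimes>\<^sub>M pd_borel)"
  defines "S \<equiv> \<lambda>n \<omega>. walk (R0 \<omega>) (\<lambda>n. X n \<omega>) n"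
  shows "(\<integral>\<^sup>+\<omega>. \<phi> (S n \<omega>) (\<Sum>k\<le>n. S k \<omega>) (X (Suc n) \<omega>) \<partial>N) =
    (\<integral>\<^sup>+\<omega>. (\<integral>\<^sup>+x. \<phi> (S n \<omega>) (\<Sum>k\<le>n. S k \<omega>) x \<partial>distr N pd_borel (X (Suc n))) \<partial>N)"
proof -
  interpret N: prob_space N using rw by (simp add: GL_random_walk_def)
  let ?Y = "X(0 := R0)"
  let ?P = "pd_borel :: 'n sqmat measure"
  let ?g = "\<lambda>y :: nat \<Rightarrow> 'n sqmat. (walk (y 0) y n, \<Sum>k\<le>n. walk (y 0) y k)"
  have ind: "N.indep_vars (\<lambda>_. ?P) ?Y UNIV" using rw by (simp add: GL_random_walk_def)
  have w: "walk (restrict (\<lambda>i. ?Y i \<omega>) {..n} 0) (restrict (\<lambda>i. ?Y i \<omega>) {..n}) k = S k \<omega>" if "k \<le> n" for k \<omega>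
    unfolding S_def using that by (simp, intro walk_cong) auto
  have comp: "(\<lambda>y. y i) \<in> measurable (Pi\<^sub>M {..n} (\<lambda>_. ?P)) ?P" if "i \<le> n" for i
    using that by (intro measurable_component_singleton) auto
  have wm: "(\<lambda>y. walk (y 0) y k) \<in> measurable (Pi\<^sub>M {..n} (\<lambda>_. ?P)) ?P" if "k \<le> n" for k
    using walk_measurable[of "\<lambda>y. y 0" "Pi\<^sub>M {..n} (\<lambda>_. ?P)" k "\<lambda>i y. y i"] comp that by auto
  have g: "?g \<in> measurable (Pi\<^sub>M {..n} (\<lambda>_. ?P)) (?P \<Otimes>\<^sub>M ?P)"
    by (intro measurable_Pair wm pd_sum_measurable) auto
  have h: "(\<lambda>y :: nat \<Rightarrow> 'n sqmat. y (Suc n)) \<in> measurable (Pi\<^sub>M {Suc n} (\<lambda>_. ?P)) ?P"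
    by (intro measurable_component_singleton) auto
  \<comment> \<open>Two disjoint blocks of the independent family, in which index 0 carries the
    initial state.\<close>
  let ?U = "\<lambda>\<omega>. restrict (\<lambda>i. ?Y i \<omega>) {..n}" and ?V = "\<lambda>\<omega>. restrict (\<lambda>i. ?Y i \<omega>) {Suc n}"
  let ?PU = "Pi\<^sub>M {..n} (\<lambda>_. ?P)" and ?PV = "Pi\<^sub>M {Suc n} (\<lambda>_. ?P)"
  have "N.indep_var ?PU ?U ?PV ?V"
    by (rule N.indep_var_restrict[OF ind]) auto
  then have U: "?U \<in> measurable N ?PU" and V: "?V \<in> measurable N ?PV"
    and eq: "distr N ?PU ?U \<Otimes>\<^sub>M distr N ?PV ?V = distr N (?PU \<Otimes>\<^sub>M ?PV) (\<lambda>\<omega>. (?U \<omega>, ?V \<omega>))"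
    unfolding N.indep_var_distribution_eq by auto
  interpret DV: prob_space "distr N ?PV ?V" by (rule N.prob_space_distr[OF V])
  let ?F = "\<lambda>(y, v :: nat \<Rightarrow> 'n sqmat). \<phi> (walk (y 0) y n) (\<Sum>k\<le>n. walk (y 0) y k) (v (Suc n))"
  have F: "?F \<in> borel_measurable (?PU \<Otimes>\<^sub>M ?PV)"
  proof -
    have "(\<lambda>p. (?g (fst p), snd p (Suc n))) \<in> measurable (?PU \<Otimes>\<^sub>M ?PV) ((?P \<Otimes>\<^sub>M ?P) \<Otimes>\<^sub>M ?P)"
      by (intro measurable_Pair measurable_compose[OF measurable_fst g, unfolded prod.inject]
          measurable_compose[OF measurable_snd h] measurable_compose[OF measurable_fst wm] pd_sum_measurable) auto
    from measurable_compose[OF this \<phi>] show ?thesis by (simp add: case_prod_beta')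
  qed
  have FU: "?F (?U \<omega>, v) = \<phi> (S n \<omega>) (\<Sum>k\<le>n. S k \<omega>) (v (Suc n))" for \<omega> v
    by (simp only: case_prod_conv w order_refl) (intro arg_cong2[where f="\<lambda>a b. \<phi> (S n \<omega>) a b"] sum.cong refl w, simp)
  have SA: "(\<lambda>\<omega>. (S n \<omega>, \<Sum>k\<le>n. S k \<omega>)) \<in> measurable N (?P \<Otimes>\<^sub>M ?P)"
  proof -
    have gU: "?g (?U \<omega>) = (S n \<omega>, \<Sum>k\<le>n. S k \<omega>)" for \<omega>
      unfolding prod.inject by (intro conjI sum.cong refl w) auto
    show ?thesis using measurable_compose[OF U g] by (simp only: gU)
  qed
  have Xm: "X (Suc n) \<in> measurable N ?P" by (rule random_walk_measurable[OF rw]) simp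
  have "(\<integral>\<^sup>+\<omega>. \<phi> (S n \<omega>) (\<Sum>k\<le>n. S k \<omega>) (X (Suc n) \<omega>) \<partial>N) = (\<integral>\<^sup>+\<omega>. ?F (?U \<omega>, ?V \<omega>) \<partial>N)"
    by (simp only: FU) simp
  also have "\<dots> = (\<integral>\<^sup>+p. ?F p \<partial>distr N (?PU \<Otimes>\<^sub>M ?PV) (\<lambda>\<omega>. (?U \<omega>, ?V \<omega>)))"
    by (rule nn_integral_distr[symmetric]) (use U V F in auto)
  also have "\<dots> = (\<integral>\<^sup>+y. (\<integral>\<^sup>+v. ?F (y, v) \<partial>distr N ?PV ?V) \<partial>distr N ?PU ?U)"
    unfolding eq[symmetric]
    by (rule DV.nn_integral_fst[symmetric])
      (use F in \<open>simp add: measurable_cong_sets[OF sets_pair_measure_cong[OF sets_distr sets_distr] refl]\<close>)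
  also have "\<dots> = (\<integral>\<^sup>+\<omega>. (\<integral>\<^sup>+v. ?F (?U \<omega>, v) \<partial>distr N ?PV ?V) \<partial>N)"
  proof (rule nn_integral_distr[OF U])
    have "?F \<in> borel_measurable (?PU \<Otimes>\<^sub>M distr N ?PV ?V)"
      using F by (simp only: measurable_cong_sets[OF sets_pair_measure_cong[OF refl sets_distr] refl])
    then have "(\<lambda>y. \<integral>\<^sup>+v. ?F (y, v) \<partial>distr N ?PV ?V) \<in> borel_measurable ?PU"
      by (intro DV.borel_measurable_nn_integral) (simp only: case_prod_eta)
    then show "(\<lambda>y. \<integral>\<^sup>+v. ?F (y, v) \<partial>distr N ?PV ?V) \<in> borel_measurable (distr N ?PU ?U)"
      by (simp only: measurable_cong_sets[OF sets_distr refl])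
  qed
  also have "\<dots> = (\<integral>\<^sup>+\<omega>. (\<integral>\<^sup>+x. \<phi> (S n \<omega>) (\<Sum>k\<le>n. S k \<omega>) x \<partial>distr N pd_borel (X (Suc n))) \<partial>N)"
  proof (rule nn_integral_cong)
    fix \<omega> assume "\<omega> \<in> space N"
    have \<phi>': "(\<lambda>x. \<phi> (S n \<omega>) (\<Sum>k\<le>n. S k \<omega>) x) \<in> borel_measurable ?P"
    proof -
      have "(S n \<omega>, \<Sum>k\<le>n. S k \<omega>) \<in> space (?P \<Otimes>\<^sub>M ?P)"
        using measurable_space[OF SA \<open>\<omega> \<in> space N\<close>] .
      from measurable_compose[OF measurable_Pair1'[OF this] \<phi>] show ?thesis by simp
    qed
    have "(\<integral>\<^sup>+v. ?F (?U \<omega>, v) \<partial>distr N ?PV ?V) = (\<integral>\<^sup>+\<eta>. \<phi> (S n \<omega>) (\<Sum>k\<le>n. S k \<omega>) (?V \<eta> (Suc n)) \<partial>N)"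
      unfolding FU by (rule nn_integral_distr[OF V])
        (simp only: measurable_cong_sets[OF sets_distr refl], rule measurable_compose[OF h \<phi>'])
    also have "\<dots> = (\<integral>\<^sup>+x. \<phi> (S n \<omega>) (\<Sum>k\<le>n. S k \<omega>) x \<partial>distr N pd_borel (X (Suc n)))"
      using \<phi>' by (subst nn_integral_distr[OF Xm]) simp_all
    finally show "(\<integral>\<^sup>+v. ?F (?U \<omega>, v) \<partial>distr N ?PV ?V) = (\<integral>\<^sup>+x. \<phi> (S n \<omega>) (\<Sum>k\<le>n. S k \<omega>) x \<partial>distr N pd_borel (X (Suc n)))" .
  qed
  finally show ?thesis .
qed

lemma nn_integral_beta_avg_walk:
  fixes \<alpha> \<beta> :: real and R0 :: "'b \<Rightarrow> 'n::{finite,wellorder} sqmat"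
    and f :: "'n sqmat \<Rightarrow> ennreal"
  assumes \<alpha>: "\<alpha> > (real CARD('n) - 1) / 2" and \<beta>\<alpha>: "\<beta> - \<alpha> > (real CARD('n) - 1) / 2"
    and iw: "prob_space (inv_wishart \<beta> :: 'n sqmat measure)"
    and be: "prob_space (beta_II \<alpha> \<beta> :: 'n sqmat measure)"
    and rw: "GL_random_walk M R N R0 X"
    and X: "\<And>n. n \<ge> 1 \<Longrightarrow> distr N pd_borel (X n) = beta_II \<alpha> \<beta>"
    and R0: "distr N pd_borel R0 = inv_wishart \<beta>"
    and f: "f \<in> borel_measurable pd_borel"
  defines "S \<equiv> \<lambda>n \<omega>. walk (R0 \<omega>) (\<lambda>n. X n \<omega>) n"
  shows "(\<integral>\<^sup>+\<omega>. beta_avg \<alpha> (\<beta> - \<alpha>) f (S n \<omega>) (\<Sum>k\<le>n. S k \<omega>) \<partial>N) = (\<integral>\<^sup>+x. f x \<partial>inv_wishart (\<beta> - \<alpha>))"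
proof (induction n)
  case 0
  have R0m: "R0 \<in> measurable N pd_borel" by (rule random_walk_measurable[OF rw])
  have "(\<integral>\<^sup>+\<omega>. beta_avg \<alpha> (\<beta> - \<alpha>) f (S 0 \<omega>) (\<Sum>k\<le>0. S k \<omega>) \<partial>N) =
      (\<integral>\<^sup>+\<omega>. beta_avg \<alpha> (\<beta> - \<alpha>) f (R0 \<omega>) (R0 \<omega>) \<partial>N)"
    by (simp add: S_def)
  also have "\<dots> = (\<integral>\<^sup>+x. beta_avg \<alpha> (\<beta> - \<alpha>) f x x \<partial>distr N pd_borel R0)"
    by (rule nn_integral_distr[OF R0m, symmetric])
      (simp add: beta_avg_measurable[OF f prob_space_beta_II_diff[OF \<alpha> \<beta>\<alpha> iw be]])
  also have "\<dots> = (\<integral>\<^sup>+x. (\<integral>\<^sup>+z. f (pd_sqrt x ** (mat 1 + z) ** pd_sqrt x) \<partial>beta_II \<alpha> (\<beta> - \<alpha>)) \<partial>inv_wishart \<beta>)"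
    unfolding R0 beta_avg_def by (intro nn_integral_cong) (simp add: sqrt_congruence_add_1 sets_eq_imp_space_eq[OF sets_inv_wishart])
  also have "\<dots> = (\<integral>\<^sup>+x. f x \<partial>inv_wishart (\<beta> - \<alpha>))"
    by (rule nn_integral_inv_wishart_beta_II[OF \<alpha> \<beta>\<alpha> iw be f])
  finally show ?case .
next
  case (Suc n)
  let ?P = "pd_borel :: 'n sqmat measure"
  let ?K = "beta_II \<alpha> (\<beta> - \<alpha>) :: 'n sqmat measure"
  \<comment> \<open>The value of \<open>beta_avg\<close> after one more step with increment x, from
    state s and partial sum y.\<close>
  define \<phi> where "\<phi> s y x = beta_avg \<alpha> (\<beta> - \<alpha>) f (pd_sqrt s ** x ** pd_sqrt s) (y + pd_sqrt s ** x ** pd_sqrt s)" for s y x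
  have SP: "S k \<omega> \<in> pd_mats" if "\<omega> \<in> space N" for k \<omega>
    using measurable_space[OF random_walk_measurable(1)[OF rw] that] measurable_space[OF random_walk_measurable(2)[OF rw] that]
    unfolding S_def by (intro walk_pd) auto
  have AP: "(\<Sum>k\<le>n. S k \<omega>) \<in> pd_mats" if "\<omega> \<in> space N" for n \<omega>
    by (induction n) (auto intro!: pd_add SP that)
  have \<phi>m: "(\<lambda>((s, y), x). \<phi> s y x) \<in> borel_measurable ((?P \<Otimes>\<^sub>M ?P) \<Otimes>\<^sub>M ?P)"
  proof -
    have s: "(\<lambda>q. fst (fst q)) \<in> measurable ((?P \<Otimes>\<^sub>M ?P) \<Otimes>\<^sub>M ?P) ?P"
      and y: "(\<lambda>q. snd (fst q)) \<in> measurable ((?P \<Otimes>\<^sub>M ?P) \<Otimes>\<^sub>M ?P) ?P"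
      and x: "(\<lambda>q. snd q) \<in> measurable ((?P \<Otimes>\<^sub>M ?P) \<Otimes>\<^sub>M ?P) ?P"
      by measurable
    have "(\<lambda>q. \<phi> (fst (fst q)) (snd (fst q)) (snd q)) \<in> borel_measurable ((?P \<Otimes>\<^sub>M ?P) \<Otimes>\<^sub>M ?P)"
      unfolding \<phi>_def
      by (intro beta_avg_measurable[OF f prob_space_beta_II_diff[OF \<alpha> \<beta>\<alpha> iw be]] sqrt_congruence_measurable pd_add_measurable s y x)
    then show ?thesis by (simp add: case_prod_beta')
  qed
  have "(\<integral>\<^sup>+\<omega>. beta_avg \<alpha> (\<beta> - \<alpha>) f (S (Suc n) \<omega>) (\<Sum>k\<le>Suc n. S k \<omega>) \<partial>N) =
      (\<integral>\<^sup>+\<omega>. \<phi> (S n \<omega>) (\<Sum>k\<le>n. S k \<omega>) (X (Suc n) \<omega>) \<partial>N)"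
    by (simp add: \<phi>_def S_def)
  also have "\<dots> = (\<integral>\<^sup>+\<omega>. (\<integral>\<^sup>+x. \<phi> (S n \<omega>) (\<Sum>k\<le>n. S k \<omega>) x \<partial>beta_II \<alpha> \<beta>) \<partial>N)"
    unfolding S_def nn_integral_walk_step[OF rw \<phi>m] by (simp add: X)
  \<comment> \<open>The new increment can be averaged out: by
    \<open>nn_integral_beta_II_sqrt\<close>, x and z enter only through x^(1/2) (I + z) x^(1/2),
    which has the law of z.\<close>
  also have "\<dots> = (\<integral>\<^sup>+\<omega>. beta_avg \<alpha> (\<beta> - \<alpha>) f (S n \<omega>) (\<Sum>k\<le>n. S k \<omega>) \<partial>N)"
  proof (rule nn_integral_cong)
    fix \<omega> assume w: "\<omega> \<in> space N"
    let ?s = "S n \<omega>" and ?y = "\<Sum>k\<le>n. S k \<omega>"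
    have s: "?s \<in> pd_mats" by (rule SP[OF w])
    have y: "?y \<in> pd_mats" by (rule AP[OF w])
    let ?F = "\<lambda>w. f (?y + w)"
    have Fm: "?F \<in> borel_measurable pd_borel"
      by (rule measurable_compose[OF _ f], rule pd_add_measurable) (use y in auto)
    let ?G = "\<lambda>w. ?F (pd_sqrt ?s ** w ** pd_sqrt ?s)"
    have Gm: "?G \<in> borel_measurable pd_borel"
      by (rule measurable_compose[OF _ Fm], rule sqrt_congruence_measurable) (use s in auto)
    have "(\<integral>\<^sup>+x. \<phi> ?s ?y x \<partial>beta_II \<alpha> \<beta>) = (\<integral>\<^sup>+x. (\<integral>\<^sup>+z. ?G (pd_sqrt x ** (mat 1 + z) ** pd_sqrt x) \<partial>?K) \<partial>beta_II \<alpha> \<beta>)"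
    proof (rule nn_integral_cong)
      fix x :: "'n sqmat" assume "x \<in> space (beta_II \<alpha> \<beta>)"
      then have x: "x \<in> pd_mats" by (simp add: sets_eq_imp_space_eq[OF sets_beta_II])
      let ?t = "pd_sqrt ?s ** x ** pd_sqrt ?s"
      have t: "?t \<in> pd_mats" by (intro pd_congruence_pd pd_sqrt_pd s x)
      have "\<phi> ?s ?y x = (\<integral>\<^sup>+z. ?F (pd_sqrt ?t ** (mat 1 + z) ** pd_sqrt ?t) \<partial>?K)"
        unfolding \<phi>_def beta_avg_def sqrt_congruence_add_1[OF t] by (simp add: add.assoc)
      also have "\<dots> = (\<integral>\<^sup>+z. ?G (pd_sqrt x ** (mat 1 + z) ** pd_sqrt x) \<partial>?K)"
        by (rule nn_integral_beta_II_sqrt[OF Fm s x])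
      finally show "\<phi> ?s ?y x = (\<integral>\<^sup>+z. ?G (pd_sqrt x ** (mat 1 + z) ** pd_sqrt x) \<partial>?K)" .
    qed
    also have "\<dots> = (\<integral>\<^sup>+z. ?G z \<partial>?K)"
      by (rule nn_integral_beta_II_fixpoint[OF \<alpha> \<beta>\<alpha> iw be Gm])
    finally show "(\<integral>\<^sup>+x. \<phi> ?s ?y x \<partial>beta_II \<alpha> \<beta>) = beta_avg \<alpha> (\<beta> - \<alpha>) f ?s ?y"
      by (simp add: beta_avg_def)
  qed
  also have "\<dots> = (\<integral>\<^sup>+x. f x \<partial>inv_wishart (\<beta> - \<alpha>))" by (rule Suc.IH)
  finally show ?case .
qed

text \<open>The integrand is a measurable function of the path, so equality of the path laws carries
  the identity from \<open>walk\<close> on N over to R on M.\<close>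

lemma nn_integral_beta_avg_random_walk:
  fixes \<alpha> \<beta> :: real and R0 :: "'b \<Rightarrow> 'n::{finite,wellorder} sqmat"
    and f :: "'n sqmat \<Rightarrow> ennreal"
  assumes \<alpha>: "\<alpha> > (real CARD('n) - 1) / 2" and \<beta>\<alpha>: "\<beta> - \<alpha> > (real CARD('n) - 1) / 2"
    and iw: "prob_space (inv_wishart \<beta> :: 'n sqmat measure)"
    and be: "prob_space (beta_II \<alpha> \<beta> :: 'n sqmat measure)"
    and rw: "GL_random_walk M R N R0 X"
    and X: "\<And>n. n \<ge> 1 \<Longrightarrow> distr N pd_borel (X n) = beta_II \<alpha> \<beta>"
    and R0: "distr N pd_borel R0 = inv_wishart \<beta>"
    and f: "f \<in> borel_measurable pd_borel"
  shows "(\<integral>\<^sup>+\<omega>. beta_avg \<alpha> (\<beta> - \<alpha>) f (R n \<omega>) (\<Sum>k\<le>n. R k \<omega>) \<partial>M) = (\<integral>\<^sup>+x. f x \<partial>inv_wishart (\<beta> - \<alpha>))"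
proof -
  let ?P = "pd_borel :: 'n sqmat measure"
  let ?W = "Pi\<^sub>M UNIV (\<lambda>_ :: nat. ?P)"
  let ?g = "\<lambda>p. beta_avg \<alpha> (\<beta> - \<alpha>) f (p n) (\<Sum>k\<le>n. p k)"
  have Rm: "R n \<in> measurable M ?P" for n using rw by (simp add: GL_random_walk_def)
  have g: "?g \<in> borel_measurable ?W"
    by (intro beta_avg_measurable[OF f prob_space_beta_II_diff[OF \<alpha> \<beta>\<alpha> iw be]] pd_sum_measurable measurable_component_singleton) auto
  have m1: "(\<lambda>\<omega> n. R n \<omega>) \<in> measurable M ?W"
    by (rule measurable_PiM_single') (use Rm measurable_space[OF Rm] in auto)
  have wm: "(\<lambda>\<omega>. walk (R0 \<omega>) (\<lambda>n. X n \<omega>) n) \<in> measurable N ?P" for n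
    by (intro walk_measurable random_walk_measurable[OF rw]) auto
  have m2: "(\<lambda>\<omega>. walk (R0 \<omega>) (\<lambda>n. X n \<omega>)) \<in> measurable N ?W"
    by (rule measurable_PiM_single') (use wm measurable_space[OF wm] in auto)
  have "(\<integral>\<^sup>+\<omega>. beta_avg \<alpha> (\<beta> - \<alpha>) f (R n \<omega>) (\<Sum>k\<le>n. R k \<omega>) \<partial>M) = (\<integral>\<^sup>+p. ?g p \<partial>distr M ?W (\<lambda>\<omega> n. R n \<omega>))"
    by (rule nn_integral_distr[OF m1, symmetric]) (simp add: g)
  also have "\<dots> = (\<integral>\<^sup>+p. ?g p \<partial>distr N ?W (\<lambda>\<omega>. walk (R0 \<omega>) (\<lambda>n. X n \<omega>)))"
    using rw by (simp add: GL_random_walk_def)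
  also have "\<dots> = (\<integral>\<^sup>+\<omega>. ?g (walk (R0 \<omega>) (\<lambda>n. X n \<omega>)) \<partial>N)"
    by (rule nn_integral_distr[OF m2]) (simp add: g)
  also have "\<dots> = (\<integral>\<^sup>+x. f x \<partial>inv_wishart (\<beta> - \<alpha>))"
    by (rule nn_integral_beta_avg_walk[OF \<alpha> \<beta>\<alpha> iw be rw X R0 f])
  finally show ?thesis .
qed

text \<open>The indicator of a compact K is the limit of the continuous functions max 0 (1 - m *
  infdist x K), all bounded by 1, and the compact subsets of the cone generate its Borel
  sets.\<close>

lemma pd_measure_eqI:
  fixes M N :: "'n::{finite,wellorder} sqmat measure"
  assumes M: "prob_space M" "sets M = sets pd_borel" and N: "prob_space N" "sets N = sets pd_borel"
    and eq: "\<And>g :: 'n sqmat \<Rightarrow> real. continuous_on UNIV g \<Longrightarrow> (\<And>x. 0 \<le> g x) \<Longrightarrow> (\<And>x. g x \<le> 1) \<Longrightarrow>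
      (\<integral>\<^sup>+x. ennreal (g x) \<partial>M) = (\<integral>\<^sup>+x. ennreal (g x) \<partial>N)"
  shows "M = N"
proof (rule measure_eqI_generator_eq)
  let ?E = "{K :: 'n sqmat set. compact K \<and> K \<subseteq> pd_mats}"
  show "Int_stable ?E" by (auto simp: Int_stable_def compact_Int)
  show "?E \<subseteq> Pow pd_mats" by auto
  show "sets M = sigma_sets pd_mats ?E" "sets N = sigma_sets pd_mats ?E"
    using M N by (simp_all add: pd_borel_eq_sigma_compact)
  show "emeasure M K = emeasure N K" if K: "K \<in> ?E" for K
  proof (cases "K = {}")
    case False
    define g where "g m x = max 0 (1 - real m * infdist x K)" for m :: nat and x
    have gc: "continuous_on UNIV (g m)" for m
      unfolding g_def by (intro continuous_intros)
    have g01: "0 \<le> g m x" "g m x \<le> 1" for m x by (auto simp: g_def infdist_nonneg)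
    have lim: "(\<lambda>m. ennreal (g m x)) \<longlonglongrightarrow> indicator K x" for x
    proof (cases "x \<in> K")
      case True
      then show ?thesis by (simp add: g_def)
    next
      case False
      then have d: "infdist x K > 0"
        using K \<open>K \<noteq> {}\<close> in_closed_iff_infdist_zero[of K x] infdist_nonneg[of x K] compact_imp_closed[of K]
        by (auto simp: less_le)
      obtain m0 where m0: "1 / infdist x K \<le> real m0" using real_arch_simple by blast
      have "g m x = 0" if "m \<ge> m0" for m
      proof -
        have "1 \<le> real m0 * infdist x K" using m0 d by (simp add: divide_le_eq)
        also have "\<dots> \<le> real m * infdist x K" using that d by (intro mult_right_mono) auto
        finally show ?thesis by (simp add: g_def)
      qed
      then have "\<forall>\<^sub>F m in sequentially. ennreal (g m x) = indicator K x"
        using False by (auto simp: eventually_sequentially intro!: exI[of _ m0])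
      then show ?thesis by (rule tendsto_eventually)
    qed
    have conv: "(\<lambda>m. \<integral>\<^sup>+x. ennreal (g m x) \<partial>Q) \<longlonglongrightarrow> emeasure Q K"
      if Q: "prob_space Q" "sets Q = sets pd_borel" for Q
    proof -
      interpret Q: prob_space Q by (rule Q(1))
      have KQ: "K \<in> sets Q" using K by (simp add: Q(2) sets_pd_borel_iff borel_compact)
      have gm: "(\<lambda>x. ennreal (g m x)) \<in> borel_measurable Q" for m
      proof -
        have "(\<lambda>x. ennreal (g m x)) \<in> borel_measurable borel"
          using borel_measurable_continuous_onI[OF gc] by measurable
        from measurable_compose[OF id_measurable_pd_borel this]
        show ?thesis by (simp only: measurable_cong_sets[OF Q(2) refl])
      qed
      have "(\<lambda>m. \<integral>\<^sup>+x. ennreal (g m x) \<partial>Q) \<longlonglongrightarrow> (\<integral>\<^sup>+x. indicator K x \<partial>Q)"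
        by (rule nn_integral_dominated_convergence[where w="\<lambda>_. 1", OF gm])
          (use KQ lim g01 in \<open>auto simp: Q.emeasure_space_1\<close>)
      then show ?thesis using KQ by simp
    qed
    have "(\<lambda>m. \<integral>\<^sup>+x. ennreal (g m x) \<partial>M) \<longlonglongrightarrow> emeasure N K"
      unfolding eq[OF gc g01] by (rule conv[OF N])
    with conv[OF M] show ?thesis by (rule LIMSEQ_unique)
  qed simp
  show "range pd_level \<subseteq> ?E" using compact_pd_level pd_level_subset by blast
  show "(\<Union>i. pd_level i) = (pd_mats :: 'n sqmat set)" by (rule pd_level_Union)
  show "emeasure M (pd_level i) \<noteq> \<infinity>" for i
    using prob_space.emeasure_le_1[OF M(1), of "pd_level i"] by (auto simp: top_unique)
qed

text \<open>The traces are non-negative, additive and dominate the norms, so their bounded partial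
  sums give absolute convergence. The limit lies in the open cone, and not merely in its closure,
  because its quadratic form dominates that of the first term.\<close>

lemma pd_convergence_from_trace_bound:
  fixes r :: "nat \<Rightarrow> 'n::{finite,wellorder} sqmat"
  assumes r: "\<And>n. r n \<in> pd_mats" and bd: "\<And>n. trace (\<Sum>k\<le>n. r k) \<le> c"
  shows "\<exists>L\<in>pd_mats. (\<lambda>n. \<Sum>k\<le>n. r k) \<longlonglongrightarrow> L" and "(\<lambda>n. trace (r n)) \<longlonglongrightarrow> 0"
proof -
  have tr: "trace (\<Sum>k\<le>n. r k) = (\<Sum>k\<le>n. trace (r k))" for n
    by (induction n) (simp_all add: trace_add)
  have "summable (\<lambda>k. trace (r k))"
  proof (rule bounded_imp_summable)
    show "\<And>n. 0 \<le> trace (r n)" using pd_trace_nonneg r by blast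
    show "\<And>n. (\<Sum>k\<le>n. trace (r k)) \<le> c" using bd tr by simp
  qed
  then show "(\<lambda>n. trace (r n)) \<longlonglongrightarrow> 0" by (rule summable_LIMSEQ_zero)
  have "summable r"
    by (rule summable_comparison_test'[OF \<open>summable (\<lambda>k. trace (r k))\<close>, of 0]) (rule pd_norm_le_trace[OF r])
  then have lim: "(\<lambda>n. \<Sum>k\<le>n. r k) \<longlonglongrightarrow> suminf r" by (rule summable_LIMSEQ')
  have "suminf r \<in> pd_mats"
    unfolding pd_mats_def
  proof (intro CollectI conjI allI impI)
    have sP: "(\<Sum>k\<le>n. r k) \<in> pd_mats" for n by (induction n) (auto intro!: pd_add r)
    have "continuous_on UNIV (\<lambda>x :: 'n sqmat. transpose x)" by (intro continuous_intros)
    then have "(\<lambda>n. transpose (\<Sum>k\<le>n. r k)) \<longlonglongrightarrow> transpose (suminf r)"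
      using lim by (rule continuous_on_tendsto_compose) auto
    then show "transpose (suminf r) = suminf r"
      using lim LIMSEQ_unique by (simp add: pd_symmetric[OF sP])
    fix v :: "real ^ 'n::_" assume v: "v \<noteq> 0"
    have "continuous_on UNIV (\<lambda>x :: 'n sqmat. v \<bullet> (x *v v))" by (intro continuous_intros)
    then have l: "(\<lambda>n. v \<bullet> ((\<Sum>k\<le>n. r k) *v v)) \<longlonglongrightarrow> v \<bullet> (suminf r *v v)"
      using lim by (rule continuous_on_tendsto_compose) auto
    have "v \<bullet> (r 0 *v v) \<le> v \<bullet> ((\<Sum>k\<le>n. r k) *v v)" for n
    proof (induction n)
      case (Suc n)
      then show ?case
        using pd_nonneg[OF r[of "Suc n"], of v]
        by (simp add: matrix_vector_mult_add_rdistrib inner_add_right)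
    qed simp
    then have "v \<bullet> (r 0 *v v) \<le> v \<bullet> (suminf r *v v)" by (intro LIMSEQ_le_const[OF l]) auto
    then show "0 < v \<bullet> (suminf r *v v)" using pd_pos[OF r v, of 0] by linarith
  qed
  with lim show "\<exists>L\<in>pd_mats. (\<lambda>n. \<Sum>k\<le>n. r k) \<longlonglongrightarrow> L" by blast
qed

theorem theorem1p2:
  fixes \<alpha> \<beta> :: real
    and M :: "'a measure" and N :: "'b measure"
    and R :: "nat \<Rightarrow> 'a \<Rightarrow> real ^ 'n::{finite,wellorder} ^ 'n::_"
    and R0 :: "'b \<Rightarrow> real ^ 'n::_ ^ 'n::_"
    and X :: "nat \<Rightarrow> 'b \<Rightarrow> real ^ 'n::_ ^ 'n::_"
  assumes "\<alpha> > (real CARD('n) - 1) / 2"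
    and "\<beta> > (real CARD('n) - 1) / 2"
    and "\<beta> - \<alpha> > (real CARD('n) - 1) / 2"
    and "GL_random_walk M R N R0 X"
    and "\<And>n. n \<ge> 1 \<Longrightarrow> distr N pd_borel (X n) = beta_II \<alpha> \<beta>"
    and "distr N pd_borel R0 = inv_wishart \<beta>"
  shows "\<exists>L \<in> measurable M pd_borel.
      (AE \<omega> in M. (\<lambda>n. \<Sum>k\<le>n. R k \<omega>) \<longlonglongrightarrow> L \<omega>) \<and>
      distr M pd_borel L = inv_wishart (\<beta> - \<alpha>)"
proof -
  note \<alpha> = assms(1) and \<beta>\<alpha> = assms(3) and rw = assms(4)
  let ?P = "pd_borel :: 'n sqmat measure"
  let ?K = "beta_II \<alpha> (\<beta> - \<alpha>) :: 'n sqmat measure"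
  let ?I = "inv_wishart (\<beta> - \<alpha>) :: 'n sqmat measure"
  interpret M: prob_space M using rw by (simp add: GL_random_walk_def)
  interpret N: prob_space N using rw by (simp add: GL_random_walk_def)
  \<comment> \<open>As laws of random variables these two measures are probabilities; the properties
    of their constants are derived from that.\<close>
  have iw: "prob_space (inv_wishart \<beta> :: 'n sqmat measure)"
    unfolding assms(6)[symmetric] by (intro N.prob_space_distr random_walk_measurable[OF rw])
  have be: "prob_space (beta_II \<alpha> \<beta> :: 'n sqmat measure)"
    using N.prob_space_distr[OF random_walk_measurable(2)[OF rw, of 1]] assms(5)[of 1] by simp
  have pK: "prob_space ?K" by (rule prob_space_beta_II_diff[OF \<alpha> \<beta>\<alpha> iw be])
  have pI: "prob_space ?I" by (rule prob_space_inv_wishart_diff[OF \<alpha> \<beta>\<alpha> iw be])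
  interpret K: prob_space ?K by (rule pK)
  interpret I: prob_space ?I by (rule pI)
  define A where "A n \<omega> = (\<Sum>k\<le>n. R k \<omega>)" for n \<omega>
  have Rm: "R n \<in> measurable M ?P" for n using rw by (simp add: GL_random_walk_def)
  have Am: "A n \<in> measurable M ?P" for n
    unfolding A_def[abs_def] by (intro pd_sum_measurable Rm)
  have RP: "R n \<omega> \<in> pd_mats" if "\<omega> \<in> space M" for n \<omega> using measurable_space[OF Rm that] by simp
  have AP: "A n \<omega> \<in> pd_mats" if "\<omega> \<in> space M" for n \<omega> using measurable_space[OF Am that] by simp
  have inv: "(\<integral>\<^sup>+\<omega>. beta_avg \<alpha> (\<beta> - \<alpha>) f (R n \<omega>) (A n \<omega>) \<partial>M) = (\<integral>\<^sup>+x. f x \<partial>?I)"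
    if "f \<in> borel_measurable pd_borel" for f :: "'n sqmat \<Rightarrow> ennreal" and n
    unfolding A_def by (rule nn_integral_beta_avg_random_walk[OF \<alpha> \<beta>\<alpha> iw be rw assms(5,6) that])
  have spK: "space ?K = pd_mats" by (simp add: sets_eq_imp_space_eq[OF sets_beta_II])
  have spI: "space ?I = pd_mats" by (simp add: sets_eq_imp_space_eq[OF sets_inv_wishart])

  define T where "T c = {y \<in> pd_mats. real c < trace (y :: 'n sqmat)}" for c :: nat
  have Tm: "T c \<in> sets ?P" for c
  proof -
    have "{y \<in> space ?P. real c < trace y} \<in> sets ?P" by measurable
    then show ?thesis by (simp add: T_def)
  qed
  define E where "E c n = {\<omega> \<in> space M. real c < trace (A n \<omega>)}" for c n :: nat
  have Em: "E c n \<in> sets M" for c n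
  proof -
    have [measurable]: "A n \<in> borel_measurable M" by (rule measurable_pd_borelD[OF Am])
    show ?thesis unfolding E_def by measurable
  qed
  \<comment> \<open>The added term has non-negative trace, so if the trace of A(n) exceeds c then so
    does that of the full sum, for every z. The law of the full sum is the same for all n, which
    makes the bound uniform.\<close>
  have E_le: "emeasure M (E c n) \<le> emeasure ?I (T c)" for c n
  proof -
    have "emeasure M (E c n) = (\<integral>\<^sup>+\<omega>. indicator (E c n) \<omega> \<partial>M)" using Em by simp
    also have "\<dots> \<le> (\<integral>\<^sup>+\<omega>. beta_avg \<alpha> (\<beta> - \<alpha>) (indicator (T c)) (R n \<omega>) (A n \<omega>) \<partial>M)"
    proof (rule nn_integral_mono)
      fix \<omega> assume w: "\<omega> \<in> space M"
      show "indicator (E c n) \<omega> \<le> beta_avg \<alpha> (\<beta> - \<alpha>) (indicator (T c)) (R n \<omega>) (A n \<omega>)"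
      proof (cases "\<omega> \<in> E c n")
        case True
        have "indicator (T c) (A n \<omega> + pd_sqrt (R n \<omega>) ** z ** pd_sqrt (R n \<omega>)) = (1 :: ennreal)" if z: "z \<in> pd_mats" for z
        proof -
          have t: "pd_sqrt (R n \<omega>) ** z ** pd_sqrt (R n \<omega>) \<in> pd_mats"
            by (intro pd_congruence_pd pd_sqrt_pd RP w z)
          then show ?thesis
            using True pd_trace_nonneg[OF t] AP[OF w] by (auto simp: T_def E_def trace_add pd_add)
        qed
        then have "beta_avg \<alpha> (\<beta> - \<alpha>) (indicator (T c)) (R n \<omega>) (A n \<omega>) = (\<integral>\<^sup>+z. 1 \<partial>?K)"
          unfolding beta_avg_def by (intro nn_integral_cong) (simp add: spK)
        then show ?thesis using True by (simp add: K.emeasure_space_1)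
      qed simp
    qed
    also have "\<dots> = (\<integral>\<^sup>+x. indicator (T c) x \<partial>?I)"
      by (rule inv) (rule borel_measurable_indicator[OF Tm])
    finally show ?thesis using Tm by simp
  qed
  \<comment> \<open>The traces increase along a path, so the uniform bound passes to the union over
    n.\<close>
  have EU_le: "emeasure M (\<Union>n. E c n) \<le> emeasure ?I (T c)" for c
  proof -
    have "incseq (E c)"
    proof (rule incseq_SucI)
      fix n
      show "E c n \<subseteq> E c (Suc n)"
        using pd_trace_nonneg[OF RP, of _ "Suc n"] by (force simp: E_def A_def trace_add)
    qed
    then have "emeasure M (\<Union>n. E c n) = (SUP n. emeasure M (E c n))"
      using Em by (intro SUP_emeasure_incseq[symmetric]) auto
    also have "\<dots> \<le> emeasure ?I (T c)" by (rule SUP_least) (rule E_le)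
    finally show ?thesis .
  qed
  have T_lim: "(\<lambda>c. emeasure ?I (T c)) \<longlonglongrightarrow> 0"
  proof -
    have "decseq T" by (rule antimonoI) (auto simp: T_def)
    moreover have "(\<Inter>c. T c) = {}"
    proof -
      have "y \<notin> (\<Inter>c. T c)" for y
      proof -
        obtain c where "trace y \<le> real c" using real_arch_simple by blast
        then have "y \<notin> T c" by (simp add: T_def)
        then show ?thesis by blast
      qed
      then show ?thesis by blast
    qed
    ultimately show ?thesis
      using Lim_emeasure_decseq[of T ?I] Tm I.emeasure_finite by auto
  qed
  \<comment> \<open>The event that the traces are unbounded is contained in every one of these
    unions, so its probability is below every tail of \<open>?I\<close>.\<close>
  have "emeasure M (\<Inter>c. \<Union>n. E c n) \<le> 0"
  proof (rule LIMSEQ_le_const[OF T_lim], intro exI allI impI)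
    fix c :: nat
    have "emeasure M (\<Inter>c. \<Union>n. E c n) \<le> emeasure M (\<Union>n. E c n)"
      using Em by (intro emeasure_mono) auto
    then show "emeasure M (\<Inter>c. \<Union>n. E c n) \<le> emeasure ?I (T c)" using EU_le[of c] by (rule order_trans)
  qed
  then have "(\<Inter>c. \<Union>n. E c n) \<in> null_sets M" using Em by auto
  then have "AE \<omega> in M. \<omega> \<notin> (\<Inter>c. \<Union>n. E c n)" by (rule AE_not_in)
  then have bd: "AE \<omega> in M. \<exists>c. \<forall>n. trace (A n \<omega>) \<le> c"
    using AE_space
  proof eventually_elim
    fix \<omega> assume "\<omega> \<notin> (\<Inter>c. \<Union>n. E c n)" "\<omega> \<in> space M"
    then show "\<exists>c. \<forall>n. trace (A n \<omega>) \<le> c" by (auto simp: E_def not_less)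
  qed

  \<comment> \<open>The value \<open>mat 1\<close> where the limit fails to lie in the cone keeps
    \<open>L\<close> inside it everywhere, as measurability into \<open>pd_borel\<close>
    demands.\<close>
  define L where "L \<omega> = (if lim (\<lambda>n. A n \<omega>) \<in> pd_mats then lim (\<lambda>n. A n \<omega>) else mat 1)" for \<omega>
  have Lm: "L \<in> measurable M ?P"
  proof -
    have [measurable]: "A n \<in> borel_measurable M" for n by (rule measurable_pd_borelD[OF Am])
    have [measurable]: "(\<lambda>\<omega>. lim (\<lambda>n. A n \<omega>)) \<in> borel_measurable M" by (rule borel_measurable_lim_metric) measurable
    have "L \<in> borel_measurable M" unfolding L_def[abs_def] by measurable
    then show ?thesis by (auto simp: measurable_pd_borel_iff L_def mat_1_pd)
  qed
  have conv: "AE \<omega> in M. (\<lambda>n. A n \<omega>) \<longlonglongrightarrow> L \<omega> \<and> (\<lambda>n. trace (R n \<omega>)) \<longlonglongrightarrow> 0"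
    using bd AE_space
  proof eventually_elim
    fix \<omega> assume b: "\<exists>c. \<forall>n. trace (A n \<omega>) \<le> c" and w: "\<omega> \<in> space M"
    then obtain c where c: "\<And>n. trace (\<Sum>k\<le>n. R k \<omega>) \<le> c" unfolding A_def by blast
    from pd_convergence_from_trace_bound[OF RP[OF w] c]
    obtain l where l: "l \<in> pd_mats" "(\<lambda>n. A n \<omega>) \<longlonglongrightarrow> l" and t: "(\<lambda>n. trace (R n \<omega>)) \<longlonglongrightarrow> 0"
      unfolding A_def by blast
    have "lim (\<lambda>n. A n \<omega>) = l" by (rule limI[OF l(2)])
    then show "(\<lambda>n. A n \<omega>) \<longlonglongrightarrow> L \<omega> \<and> (\<lambda>n. trace (R n \<omega>)) \<longlonglongrightarrow> 0"
      using l t by (simp add: L_def)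
  qed

  have "distr M pd_borel L = ?I"
  proof (rule pd_measure_eqI)
    show "prob_space (distr M pd_borel L)" by (rule M.prob_space_distr[OF Lm])
    show "prob_space ?I" by (rule pI)
    fix g :: "'n sqmat \<Rightarrow> real"
    assume g: "continuous_on UNIV g" "\<And>x. 0 \<le> g x" "\<And>x. g x \<le> 1"
    have gb: "(\<lambda>x. ennreal (g x)) \<in> borel_measurable borel"
      using borel_measurable_continuous_onI[OF g(1)] by measurable
    have gm: "(\<lambda>x. ennreal (g x)) \<in> borel_measurable pd_borel"
      by (rule measurable_compose[OF id_measurable_pd_borel gb])
    let ?b = "beta_avg \<alpha> (\<beta> - \<alpha>) (\<lambda>x. ennreal (g x))"
    have b1: "?b s y \<le> 1" for s y
    proof -
      have "?b s y \<le> (\<integral>\<^sup>+z. 1 \<partial>?K)" unfolding beta_avg_def using g(3) by (intro nn_integral_mono) simp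
      then show ?thesis by (simp add: K.emeasure_space_1)
    qed
    \<comment> \<open>The inner of two dominated convergences, over z for a fixed path: the term
      containing z has norm at most the trace of R(n) times the norm of z, and this tends to
      0.\<close>
    have blim: "AE \<omega> in M. (\<lambda>n. ?b (R n \<omega>) (A n \<omega>)) \<longlonglongrightarrow> ennreal (g (L \<omega>))"
      using conv AE_space
    proof eventually_elim
      fix \<omega> assume c: "(\<lambda>n. A n \<omega>) \<longlonglongrightarrow> L \<omega> \<and> (\<lambda>n. trace (R n \<omega>)) \<longlonglongrightarrow> 0" and w: "\<omega> \<in> space M"
      let ?u = "\<lambda>n z. A n \<omega> + pd_sqrt (R n \<omega>) ** z ** pd_sqrt (R n \<omega>)"
      have um: "(\<lambda>z. ennreal (g (?u n z))) \<in> borel_measurable ?K" for n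
      proof -
        have "(\<lambda>z. ?u n z) \<in> borel_measurable pd_borel" by measurable
        from measurable_compose[OF this gb] show ?thesis
          by (simp only: measurable_cong_sets[OF sets_beta_II refl])
      qed
      have ulim: "(\<lambda>n. ennreal (g (?u n z))) \<longlonglongrightarrow> ennreal (g (L \<omega>))" for z
      proof -
        have "(\<lambda>n. trace (R n \<omega>) * norm z) \<longlonglongrightarrow> 0 * norm z" using c by (intro tendsto_intros) auto
        then have z0: "(\<lambda>n. trace (R n \<omega>) * norm z) \<longlonglongrightarrow> 0" by simp
        have "(\<lambda>n. pd_sqrt (R n \<omega>) ** z ** pd_sqrt (R n \<omega>)) \<longlonglongrightarrow> 0"
          by (rule Lim_null_comparison[OF _ z0]) (simp add: norm_sqrt_congruence_le RP w)
        then have "(\<lambda>n. ?u n z) \<longlonglongrightarrow> L \<omega> + 0" using c by (intro tendsto_add) auto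
        then have "(\<lambda>n. g (?u n z)) \<longlonglongrightarrow> g (L \<omega>)"
          by (intro continuous_on_tendsto_compose[OF g(1)]) auto
        then show ?thesis by (rule tendsto_ennrealI)
      qed
      have "(\<lambda>n. ?b (R n \<omega>) (A n \<omega>)) \<longlonglongrightarrow> (\<integral>\<^sup>+z. ennreal (g (L \<omega>)) \<partial>?K)"
        unfolding beta_avg_def
        by (rule nn_integral_dominated_convergence[where w="\<lambda>_. 1", OF um])
          (use ulim g in \<open>auto simp: K.emeasure_space_1\<close>)
      then show "(\<lambda>n. ?b (R n \<omega>) (A n \<omega>)) \<longlonglongrightarrow> ennreal (g (L \<omega>))"
        by (simp add: K.emeasure_space_1)
    qed
    have bm: "(\<lambda>\<omega>. ?b (R n \<omega>) (A n \<omega>)) \<in> borel_measurable M" for n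
      by (rule beta_avg_measurable[OF gm pK Rm Am])
    have gLm: "(\<lambda>\<omega>. ennreal (g (L \<omega>))) \<in> borel_measurable M"
      by (rule measurable_compose[OF measurable_pd_borelD[OF Lm] gb])
    \<comment> \<open>The outer dominated convergence, over paths. By \<open>inv\<close> the
      integrals on the left are constant in n, so the limit identifies the law of
      \<open>L\<close>.\<close>
    have "(\<lambda>n. \<integral>\<^sup>+\<omega>. ?b (R n \<omega>) (A n \<omega>) \<partial>M) \<longlonglongrightarrow> (\<integral>\<^sup>+\<omega>. ennreal (g (L \<omega>)) \<partial>M)"
      by (rule nn_integral_dominated_convergence[where w="\<lambda>_. 1", OF bm gLm])
        (use b1 blim in \<open>auto simp: M.emeasure_space_1\<close>)
    then have "(\<lambda>n :: nat. \<integral>\<^sup>+x. ennreal (g x) \<partial>?I) \<longlonglongrightarrow> (\<integral>\<^sup>+\<omega>. ennreal (g (L \<omega>)) \<partial>M)"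
      by (simp only: inv[OF gm])
    then have "(\<integral>\<^sup>+x. ennreal (g x) \<partial>?I) = (\<integral>\<^sup>+\<omega>. ennreal (g (L \<omega>)) \<partial>M)"
      by (rule LIMSEQ_unique[OF tendsto_const])
    also have "\<dots> = (\<integral>\<^sup>+x. ennreal (g x) \<partial>distr M pd_borel L)"
      by (rule nn_integral_distr[OF Lm, symmetric]) (simp add: gm)
    finally show "(\<integral>\<^sup>+x. ennreal (g x) \<partial>distr M pd_borel L) = (\<integral>\<^sup>+x. ennreal (g x) \<partial>?I)" ..
  qed simp_all
  moreover have "AE \<omega> in M. (\<lambda>n. \<Sum>k\<le>n. R k \<omega>) \<longlonglongrightarrow> L \<omega>"
    using conv unfolding A_def by (rule AE_mp) auto
  ultimately show ?thesis using Lm by blast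
qed

end
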